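(* Let $(\Omega,\mathcal{F},(\mathcal{F}_t)_{t\geq 0},\mathbb{P})$ be a complete filtered probability space, let $N$ be a conditional Poisson process with $\mathcal{F}_0$-measurable intensity $X$, and let $Y$ be a non-negative $\mathcal{B}([0,\infty))\otimes\mathcal{F}_0$-measurable process such that $$\mathbb{P}\Big[\int_0^t Y_sX_s\,\mathrm{d}s<\infty\quad\forall\, t\geq 0\Big]=1.$$ Let $\widetilde{N}_t=N_t-\int_0^tX_s\,\mathrm{d}s$, and consider the stochastic exponential $Z=\mathcal{E}\big(\int_0^\cdot (Y_s-1)\,\mathrm{d}\widetilde{N}_s\big)$, that is, $$Z_t=\exp\Big(-\int_0^t (Y_s-1)X_s\,\mathrm{d}s\Big)\prod_{s\in(0,t]}\big(1+(Y_s-1)\,\Delta N_s\big),\quad t\geq 0,$$ with the convention $\prod_\varnothing=1$. Then the following statements are true: (i) $Z$ is a non-negative right-continuous $(\mathcal{F}_t)$-martingale under $\mathbb{P}$ with $Z_0=1$. (ii) Let $S\geq 0$ be a bounded $\mathcal{F}_0$-measurable random variable. The probability measure $\mathbb{Q}$ defined by $$\mathbb{Q}(A)=\mathbb{E}\big[\mathbf{1}_A Z_S\big],\quad A\in\mathcal{F},$$ is such that $\mathbb{Q}=\mathbb{P}$ on $\mathcal{F}_0$, and the process $$\widetilde{N}^{\mathbb{Q}}_{t\wedge S}=N_{t\wedge S}-\int_0^{t\wedge S}Y_sX_s\,\mathrm{d}s,\quad t\geq 0,$$ is a local $(\mathcal{F}_t)$-martingale under $\mathbb{Q}$. In particular,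 $N$ is a conditional Poisson process with intensity $YX$ up to time $S$ under $\mathbb{Q}$, i.e. for all $u\in\mathbb{R}$ and $t\geq r\geq 0$, $\mathbb{Q}$-almost surely $$\mathbb{E}_{\mathbb{Q}}\Big[\exp\big(iu(N_{t\wedge S}-N_{r\wedge S})\big)\,\Big|\,\mathcal{F}_r\Big]=\exp\Big((\mathrm{e}^{iu}-1)\int_{r\wedge S}^{t\wedge S}Y_sX_s\,\mathrm{d}s\Big).$$
   Context: Conventions: $\mathbb{N}=\{1,2,\dots\}$, $\mathbb{N}_0=\{0,1,2,\dots\}$; $\mathbb{E}$ is expectation under $\mathbb{P}$; $\Delta N_s=N_s-N_{s-}$. Simple point process: $N$ is given by $(\mathcal{F}_t)$-stopping times $(T_n)_{n=0}^\infty$ with values in $[0,\infty]$ via $$N_t=\sum_{n\in\mathbb{N}}\mathbf{1}_{\{T_n\leq t\}},\quad t\geq 0,$$ where $\mathbb{P}[T_0=0]=1$ and, for every $n\in\mathbb{N}_0$, $\mathbb{P}\big[T_{n+1}<\infty\Rightarrow T_n<T_{n+1}\big]=1$. The process $X:[0,\infty)\times\Omega\to[0,\infty)$ is $\mathcal{B}([0,\infty))\otimes\mathcal{F}_0$-measurable (this is what "$\mathcal{F}_0$-measurable process" means) and locally integrable: $\mathbb{P}\big[\int_0^t X_s\,\mathrm{d}s<\infty\ \ \forall\, t\geq 0\big]=1$. Conditional Poisson process: the simple point process $N$ is a conditional Poisson process with $\mathcal{F}_0$-measurable intensity $X$ if for all $u\in\mathbb{R}$ and $t\geq r\geq 0$,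 almost surely $$\mathbb{E}\Big[\exp\big(iu(N_t-N_r)\big)\,\Big|\,\mathcal{F}_r\Big]=\exp\Big((\mathrm{e}^{iu}-1)\int_r^t X_s\,\mathrm{d}s\Big).$$ This implicitly entails $N_t<\infty$ almost surely for all $t\geq 0$. *)

theory Defs
  imports "HOL-Probability.Probability"
begin

text \<open>
  The time axis \<open>[0,\<infinity>)\<close> is the set of non-negative elements of \<^typ>\<open>real\<close>; values of a
  filtration or a process at negative times are irrelevant. The library locale \<^locale>\<open>filtration\<close>
  would also constrain negative times.
\<close>

locale complete_filtered_prob_space = prob_space M + complete_measure M
  for M :: "'a measure" +
  fixes F :: "real \<Rightarrow> 'a measure"
  assumes subalg: "\<And>t. 0 \<le> t \<Longrightarrow> subalgebra M (F t)"
    and sets_mono: "\<And>s t. 0 \<le> s \<Longrightarrow> s \<le> t \<Longrightarrow> sets (F s) \<subseteq> sets (F t)"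
    and null_sets_F0: "null_sets M \<subseteq> sets (F 0)"

text \<open>
  Stopping times with values in \<open>[0,\<infinity>]\<close>; the library's \<^const>\<open>stopping_time\<close> takes values
  in the index type of the filtration, which excludes \<open>\<infinity>\<close> here.
\<close>

definition ext_stopping_time :: "(real \<Rightarrow> 'a measure) \<Rightarrow> ('a \<Rightarrow> ennreal) \<Rightarrow> bool" where
  "ext_stopping_time F T \<longleftrightarrow> (\<forall>t\<ge>0. Measurable.pred (F t) (\<lambda>\<omega>. T \<omega> \<le> ennreal t))"

definition adapted :: "(real \<Rightarrow> 'a measure) \<Rightarrow> (real \<Rightarrow> 'a \<Rightarrow> real) \<Rightarrow> bool" where
  "adapted F V \<longleftrightarrow> (\<forall>t\<ge>0. V t \<in> borel_measurable (F t))"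

definition martingale ::
  "'a measure \<Rightarrow> (real \<Rightarrow> 'a measure) \<Rightarrow> (real \<Rightarrow> 'a \<Rightarrow> real) \<Rightarrow> bool" where
  "martingale M F V \<longleftrightarrow>
     adapted F V \<and>
     (\<forall>t\<ge>0. integrable M (V t)) \<and>
     (\<forall>s t. 0 \<le> s \<longrightarrow> s \<le> t \<longrightarrow> (AE \<omega> in M. real_cond_exp M (F s) (V t) \<omega> = V s \<omega>))"

definition right_continuous_paths :: "'a measure \<Rightarrow> (real \<Rightarrow> 'a \<Rightarrow> real) \<Rightarrow> bool" where
  "right_continuous_paths M V \<longleftrightarrow>
     (AE \<omega> in M. \<forall>t\<ge>0. ((\<lambda>s. V s \<omega>) \<longlongrightarrow> V t \<omega>) (at_right t))"

definition left_limits_paths :: "'a measure \<Rightarrow> (real \<Rightarrow> 'a \<Rightarrow> real) \<Rightarrow> bool" where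
  "left_limits_paths M V \<longleftrightarrow>
     (AE \<omega> in M. \<forall>t>0. \<exists>l. ((\<lambda>s. V s \<omega>) \<longlongrightarrow> l) (at_left t))"

definition stopped :: "(real \<Rightarrow> 'a \<Rightarrow> real) \<Rightarrow> ('a \<Rightarrow> ennreal) \<Rightarrow> real \<Rightarrow> 'a \<Rightarrow> real" where
  "stopped V T t \<omega> = V (enn2real (min (ennreal t) (T \<omega>))) \<omega>"

definition local_martingale ::
  "'a measure \<Rightarrow> (real \<Rightarrow> 'a measure) \<Rightarrow> (real \<Rightarrow> 'a \<Rightarrow> real) \<Rightarrow> bool" where
  "local_martingale M F V \<longleftrightarrow>
     adapted F V \<and> right_continuous_paths M V \<and> left_limits_paths M V \<and>
     (\<exists>\<tau>. (\<forall>n::nat. ext_stopping_time F (\<tau> n)) \<and>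
          (AE \<omega> in M. incseq (\<lambda>n. \<tau> n \<omega>) \<and> (\<lambda>n. \<tau> n \<omega>) \<longlonglongrightarrow> \<infinity>) \<and>
          (\<forall>n. martingale M F (\<lambda>t \<omega>. stopped V (\<tau> n) t \<omega> - V 0 \<omega>)))"

definition complex_cond_exp ::
  "'a measure \<Rightarrow> 'a measure \<Rightarrow> ('a \<Rightarrow> complex) \<Rightarrow> 'a \<Rightarrow> complex" where
  "complex_cond_exp M G f \<omega> =
     Complex (real_cond_exp M G (\<lambda>x. Re (f x)) \<omega>) (real_cond_exp M G (\<lambda>x. Im (f x)) \<omega>)"

definition simple_point_process ::
  "'a measure \<Rightarrow> (real \<Rightarrow> 'a measure) \<Rightarrow> (real \<Rightarrow> 'a \<Rightarrow> ennreal) \<Rightarrow> bool" where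
  "simple_point_process M F N \<longleftrightarrow>
     (\<exists>T :: nat \<Rightarrow> 'a \<Rightarrow> ennreal.
        (\<forall>n. ext_stopping_time F (T n)) \<and>
        (AE \<omega> in M. T 0 \<omega> = 0) \<and>
        (\<forall>n. AE \<omega> in M. T (Suc n) \<omega> < \<infinity> \<longrightarrow> T n \<omega> < T (Suc n) \<omega>) \<and>
        (\<forall>t\<ge>0. \<forall>\<omega>\<in>space M. N t \<omega> = (\<Sum>n. if T (Suc n) \<omega> \<le> ennreal t then 1 else 0)))"

definition nonneg_F0_process ::
  "'a measure \<Rightarrow> (real \<Rightarrow> 'a measure) \<Rightarrow> (real \<Rightarrow> 'a \<Rightarrow> real) \<Rightarrow> bool" where
  "nonneg_F0_process M F V \<longleftrightarrow>
     (\<lambda>(s, \<omega>). V s \<omega>) \<in> borel_measurable (restrict_space borel {0..} \<Otimes>\<^sub>M F 0) \<and>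
     (\<forall>s\<ge>0. \<forall>\<omega>\<in>space M. 0 \<le> V s \<omega>)"

text \<open>Used for non-negative processes only.\<close>

definition locally_integrable :: "'a measure \<Rightarrow> (real \<Rightarrow> 'a \<Rightarrow> real) \<Rightarrow> bool" where
  "locally_integrable M V \<longleftrightarrow>
     (AE \<omega> in M. \<forall>t\<ge>0. (\<integral>\<^sup>+ s\<in>{0..t}. ennreal (V s \<omega>) \<partial>lborel) < \<infinity>)"

text \<open>
  \<open>N\<close> takes values in \<open>[0,\<infinity>]\<close>. The finiteness clause makes explicit what the
  characteristic-function identity tacitly requires; by it, \<^const>\<open>enn2real\<close> loses information
  on a null set only.
\<close>

definition conditional_poisson_process ::
  "'a measure \<Rightarrow> (real \<Rightarrow> 'a measure) \<Rightarrow> (real \<Rightarrow> 'a \<Rightarrow> ennreal) \<Rightarrow> (real \<Rightarrow> 'a \<Rightarrow> real) \<Rightarrow> bool" where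
  "conditional_poisson_process M F N X \<longleftrightarrow>
     simple_point_process M F N \<and>
     nonneg_F0_process M F X \<and> locally_integrable M X \<and>
     (\<forall>t\<ge>0. AE \<omega> in M. N t \<omega> < \<infinity>) \<and>
     (\<forall>(u::real) r t. 0 \<le> r \<longrightarrow> r \<le> t \<longrightarrow>
        (AE \<omega> in M.
           complex_cond_exp M (F r)
             (\<lambda>\<omega>. exp (\<i> * of_real (u * (enn2real (N t \<omega>) - enn2real (N r \<omega>))))) \<omega> =
           exp ((exp (\<i> * of_real u) - 1) * of_real (LBINT s:{r..t}. X s \<omega>))))"

definition jump :: "(real \<Rightarrow> 'a \<Rightarrow> ennreal) \<Rightarrow> real \<Rightarrow> 'a \<Rightarrow> real" where
  "jump N s \<omega> = enn2real (N s \<omega>) - Lim (at_left s) (\<lambda>r. enn2real (N r \<omega>))"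

text \<open>
  The stochastic exponential of \<open>\<integral> (Y\<^sub>s - 1) d(N\<^sub>s - \<integral>\<^sub>0\<^sup>s X\<^sub>r dr)\<close>. All factors at times without
  a jump equal 1, so the product over \<open>(0,t]\<close> is the product over the (almost surely finitely many)
  jump times.
\<close>

definition stoch_exponential ::
  "(real \<Rightarrow> 'a \<Rightarrow> ennreal) \<Rightarrow> (real \<Rightarrow> 'a \<Rightarrow> real) \<Rightarrow> (real \<Rightarrow> 'a \<Rightarrow> real) \<Rightarrow> real \<Rightarrow> 'a \<Rightarrow> real" where
  "stoch_exponential N X Y t \<omega> =
     exp (- (LBINT s:{0..t}. (Y s \<omega> - 1) * X s \<omega>)) *
     (\<Prod>s\<in>{s\<in>{0<..t}. jump N s \<omega> \<noteq> 0}. 1 + (Y s \<omega> - 1) * jump N s \<omega>)"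

end

theory Submission
  imports Defs
begin

text \<open>
  Fix \<open>r\<close> and condition on \<open>F r\<close>. By uniqueness of Fourier coefficients, the increments of \<open>N\<close>
  are mixed Poisson, so they have mean \<open>\<integral> X\<close> and exponential moments. A monotone class argument on
  predictable rectangles turns the mean into the compensation formula
  \<open>E (\<Sum>n. H (T n)) = E (\<integral> H s * X s ds)\<close> for predictable \<open>H\<close>. For an \<open>F 0\<close>-measurable complex \<open>g\<close>,
  \<open>Z = exp (- \<integral> (g - 1) * X) * \<Prod> g (T n)\<close> solves a linear integral equation path by path; the
  formula with \<open>H = C * Z\<^sub>- * (g - 1)\<close> then gives \<open>E (C * Z t) = E C\<close> for every \<open>F r\<close>-measurable \<open>C\<close>.

  Taking \<open>g = Y\<close> proves that \<open>Z\<close> is a martingale. Replacing \<open>Y\<close> by 1 after \<open>S\<close> turns \<open>Z S\<close> into the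
  value at a deterministic time, and multiplying \<open>Y\<close> by the phase \<open>exp (\<i> * u)\<close> between \<open>min r S\<close> and
  \<open>min t S\<close> gives the conditional characteristic function under \<open>Q\<close>. That increment is hence
  again mixed Poisson under \<open>Q\<close>, and its mean yields the local martingale property.
\<close>

subsection \<open>Integral equation of a jump exponential\<close>

text \<open>Three obstacles shape the proof. Neither the integral of \<open>X\<close> nor that of
  \<open>Y * X\<close> need have a finite mean. Both are \<open>F 0\<close>-measurable, however, so
  all localisation is by events of \<open>F 0\<close> such as \<open>cum 0 t w \<le> m\<close>:
  these keep every weight \<open>F r\<close>-measurable, and on them the mixed Poisson law provides
  exponential moments. Next, \<open>g\<close> and \<open>X\<close> have no regularity in time, so
  the continuous factor of \<open>Z\<close> is differentiable at best almost everywhere; the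
  fundamental theorem for it is derived from the integral alone. Finally, the hypotheses hold almost
  surely, while products over jumps are treated path by path. The middle part therefore assumes good
  behaviour on every path, and the last part supplies it by making the paths trivial on a null set,
  which completeness places in \<open>F 0\<close>. The passage from bounded to unbounded
  \<open>g\<close> moves the compensating exponential into the test variable: \<open>E (C * \<Prod>
  g (T n)) = E (C * exp (\<integral> (g - 1) * X))\<close> has both sides increasing in non-negative
  \<open>C\<close> and \<open>g\<close>, which \<open>Z\<close> itself is not.\<close>

lemma LBINT_Icc_combine:
  fixes f :: "real \<Rightarrow> 'b::{banach, second_countable_topology}"
  assumes "set_integrable lborel {a..b} f" "a \<le> c" "c \<le> b"
  shows "(LBINT u:{a..b}. f u) = (LBINT u:{a..c}. f u) + (LBINT u:{c..b}. f u)"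
proof -
  have "(LBINT u:{a..c} \<union> {c..b}. f u) = (LBINT u:{a..c}. f u) + (LBINT u:{c..b}. f u)"
  proof (rule set_integral_Un_AE)
    show "AE x in lborel. \<not> (x \<in> {a..c} \<and> x \<in> {c..b})"
      using AE_lborel_singleton[of c] by eventually_elim auto
    show "set_integrable lborel {a..c} f" "set_integrable lborel {c..b} f"
      using assms by (auto intro: set_integrable_subset)
  qed auto
  then show ?thesis using assms by (simp add: ivl_disj_un_two_touch)
qed

lemma continuous_on_LBINT:
  fixes f :: "real \<Rightarrow> 'b::euclidean_space"
  assumes "set_integrable lborel {a..b} f"
  shows "continuous_on {a..b} (\<lambda>x. LBINT u:{a..x}. f u)"
proof -
  have "continuous_on {a..b} (\<lambda>x. integral {a..x} f)"
    using assms by (intro indefinite_integral_continuous_1 set_borel_integral_eq_integral)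
  moreover have "(LBINT u:{a..x}. f u) = integral {a..x} f" if "x \<in> {a..b}" for x
    using that assms by (intro set_borel_integral_eq_integral set_integrable_subset[OF assms]) auto
  ultimately show ?thesis by (subst continuous_on_cong[OF refl]) auto
qed

lemma set_integrable_continuous_mult:
  fixes f h :: "real \<Rightarrow> complex"
  assumes f: "set_integrable lborel {a..b} f" and h: "continuous_on {a..b} h"
  shows "set_integrable lborel {a..b} (\<lambda>x. h x * f x)"
proof -
  have "compact (h ` {a..b})" by (intro compact_continuous_image h) auto
  then obtain B where B: "\<And>x. x \<in> {a..b} \<Longrightarrow> norm (h x) \<le> B"
    by (meson bounded_iff compact_imp_bounded imageI)
  have m1: "(\<lambda>x. indicator {a..b} x *\<^sub>R h x) \<in> borel_measurable lborel"
    using borel_measurable_continuous_on_indicator[OF _ h] by simp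
  have m2: "(\<lambda>x. indicator {a..b} x *\<^sub>R f x) \<in> borel_measurable lborel"
    using f by (auto simp: set_integrable_def)
  \<comment> \<open>Outside the interval neither \<open>h\<close> nor \<open>f\<close> is known to
    be measurable, so the product is formed from the two functions cut off to
    \<open>{a..b}\<close>.\<close>
  have "(\<lambda>x. (indicator {a..b} x *\<^sub>R h x) * (indicator {a..b} x *\<^sub>R f x)) \<in> borel_measurable lborel"
    using m1 m2 by measurable
  also have "(\<lambda>x. (indicator {a..b} x *\<^sub>R h x) * (indicator {a..b} x *\<^sub>R f x))
     = (\<lambda>x. indicator {a..b} x *\<^sub>R (h x * f x))"
    by (auto simp: indicator_def)
  finally have m: "(\<lambda>x. indicator {a..b} x *\<^sub>R (h x * f x)) \<in> borel_measurable lborel" .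
  show ?thesis
    unfolding set_integrable_def
  proof (rule Bochner_Integration.integrable_bound[OF _ m])
    show "integrable lborel (\<lambda>x. B *\<^sub>R (indicator {a..b} x *\<^sub>R f x))"
      using f by (intro integrable_scaleR_right) (auto simp: set_integrable_def)
    show "AE x in lborel. norm (indicator {a..b} x *\<^sub>R (h x * f x))
        \<le> norm (B *\<^sub>R (indicator {a..b} x *\<^sub>R f x))"
      using B by (intro AE_I2)
        (auto simp: norm_mult indicator_def intro!: mult_right_mono order_trans[OF _ abs_ge_self])
  qed
qed

lemma norm_exp_minus_one_le: "norm (exp z - 1) \<le> exp (norm z) * norm (z :: complex)"
  using Taylor_exp_field[of z 0] by simp

text \<open>The quadratic remainder makes the defect on a short interval second order in its mass,
  so that each bisection gains a factor.\<close>

lemma norm_exp_minus_one_minus_le: "norm (exp z - 1 - z) \<le> exp (norm z) * (norm (z :: complex))\<^sup>2"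
  using Taylor_exp_field[of z 1] by (simp add: power2_eq_square diff_diff_eq)

text \<open>
  The defect of the fundamental theorem on \<open>[x,y]\<close> is quadratic in the mass of \<open>\<bar>\<gamma>\<bar>\<close> on \<open>[x,y]\<close>;
  bisecting \<open>[x,y]\<close> into pieces of equal mass then halves the constant again and again.
\<close>

lemma LBINT_exp_primitive:
  fixes \<gamma> \<Gamma> :: "real \<Rightarrow> complex"
  assumes ab: "a \<le> b" and int: "set_integrable lborel {a..b} \<gamma>"
    and prim: "\<And>x y. a \<le> x \<Longrightarrow> x \<le> y \<Longrightarrow> y \<le> b \<Longrightarrow> \<Gamma> y - \<Gamma> x = (LBINT u:{x..y}. \<gamma> u)"
  shows "set_integrable lborel {a..b} (\<lambda>s. exp (- \<Gamma> s) * \<gamma> s)"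
    and "(LBINT s:{a..b}. exp (- \<Gamma> s) * \<gamma> s) = exp (- \<Gamma> a) - exp (- \<Gamma> b)"
proof -
  have sub: "set_integrable lborel {x..y} \<gamma>" if "a \<le> x" "y \<le> b" for x y
    using that by (auto intro: set_integrable_subset[OF int])
  have "continuous_on {a..b} (\<lambda>x. \<Gamma> a + (LBINT u:{a..x}. \<gamma> u))"
    by (intro continuous_intros continuous_on_LBINT int)
  moreover have "\<Gamma> a + (LBINT u:{a..x}. \<gamma> u) = \<Gamma> x" if "x \<in> {a..b}" for x
    using prim[of a x] that by (auto simp: algebra_simps)
  ultimately have cont: "continuous_on {a..b} \<Gamma>" by (subst (asm) continuous_on_cong[OF refl]) auto
  have ei: "set_integrable lborel {a..b} (\<lambda>s. exp (- \<Gamma> s) * \<gamma> s)"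
    by (intro set_integrable_continuous_mult int continuous_intros cont)
  then show "set_integrable lborel {a..b} (\<lambda>s. exp (- \<Gamma> s) * \<gamma> s)" .
  have esub: "set_integrable lborel {x..y} (\<lambda>s. exp (- \<Gamma> s) * \<gamma> s)" if "a \<le> x" "y \<le> b" for x y
    using that by (auto intro: set_integrable_subset[OF ei])
  have nint: "set_integrable lborel {a..b} (\<lambda>u. norm (\<gamma> u))"
    using int by (rule set_integrable_norm)
  have nsub: "set_integrable lborel {x..y} (\<lambda>u. norm (\<gamma> u))" if "a \<le> x" "y \<le> b" for x y
    using that by (auto intro: set_integrable_subset[OF nint])
  define v where "v x = (LBINT u:{a..x}. norm (\<gamma> u))" for x
  have v_diff: "v y - v x = (LBINT u:{x..y}. norm (\<gamma> u))" if "a \<le> x" "x \<le> y" "y \<le> b" for x y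
    using LBINT_Icc_combine[OF nsub[of a y], of x] that by (auto simp: v_def)
  have v_mono: "v x \<le> v y" if "a \<le> x" "x \<le> y" "y \<le> b" for x y
  proof -
    have "0 \<le> (LBINT u:{x..y}. norm (\<gamma> u))"
      unfolding set_lebesgue_integral_def by (intro integral_nonneg_AE) auto
    with v_diff[OF that] show ?thesis by simp
  qed
  have v_cont: "continuous_on {a..b} v"
    unfolding v_def by (rule continuous_on_LBINT[OF nint])
  have v_a: "v a = 0" using v_diff[of a a] ab by (simp add: v_def)
  define \<Phi> where "\<Phi> x y = exp (- \<Gamma> x) - exp (- \<Gamma> y) - (LBINT s:{x..y}. exp (- \<Gamma> s) * \<gamma> s)" for x y
  have \<Phi>_add: "\<Phi> x z = \<Phi> x y + \<Phi> y z" if "a \<le> x" "x \<le> y" "y \<le> z" "z \<le> b" for x y z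
    using LBINT_Icc_combine[OF esub[of x z], of y] that by (simp add: \<Phi>_def)
  have G_bound: "norm (\<Gamma> y - \<Gamma> x) \<le> v y - v x" if "a \<le> x" "x \<le> y" "y \<le> b" for x y
    using set_integral_norm_bound[OF sub[of x y]] that prim[OF that] v_diff[OF that] by simp
  \<comment> \<open>\<open>exp (norm (\<Gamma> a) + v b)\<close> bounds
    \<open>norm (exp (- \<Gamma> x))\<close> on the whole interval, \<open>exp (v b)\<close> bounds
    \<open>exp w\<close> for a piece of mass \<open>w\<close>, and the 2 counts the two quadratic
    error terms.\<close>
  define C where "C = 2 * exp (norm (\<Gamma> a) + v b) * exp (v b)"
  have base: "norm (\<Phi> x y) \<le> C * (v y - v x)\<^sup>2" if xy: "a \<le> x" "x \<le> y" "y \<le> b" for x y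
  proof -
    define w where "w = v y - v x"
    have w0: "0 \<le> w" "w \<le> v b"
      using v_mono[of x y] v_mono[of a x] v_mono[of y b] xy v_a ab by (auto simp: w_def)
    have d: "norm (\<Gamma> s - \<Gamma> x) \<le> w" if "s \<in> {x..y}" for s
      using G_bound[of x s] v_mono[of s y] that xy by (auto simp: w_def)
    have e: "norm (exp (\<Gamma> x - \<Gamma> s) - 1) \<le> exp w * w" if "s \<in> {x..y}" for s
    proof -
      have "norm (exp (\<Gamma> x - \<Gamma> s) - 1) \<le> exp (norm (\<Gamma> x - \<Gamma> s)) * norm (\<Gamma> x - \<Gamma> s)"
        by (rule norm_exp_minus_one_le)
      also have "\<dots> \<le> exp w * w"
        using d[OF that] by (intro mult_mono) (auto simp: norm_minus_commute)
      finally show ?thesis .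
    qed
    have i1: "set_integrable lborel {x..y} (\<lambda>s. (exp (\<Gamma> x - \<Gamma> s) - 1) * \<gamma> s)"
      using xy cont by (intro set_integrable_continuous_mult sub continuous_intros)
        (auto elim: continuous_on_subset)
    have ey: "exp (- \<Gamma> y) = exp (- \<Gamma> x) * exp (\<Gamma> x - \<Gamma> y)"
      by (simp flip: exp_add)
    have alg: "E - E * e - E * (J + (gy - gx)) = E * (- (e - 1 - (gx - gy)) - J)" for E e J gx gy :: complex
      by (simp add: algebra_simps)
    \<comment> \<open>Pulling out the value at the left end point leaves
      \<open>exp (\<Gamma> x - \<Gamma> s)\<close>, which is 1 up to an error of order
      \<open>w\<close>; the 1 integrates to \<open>\<Gamma> y - \<Gamma> x\<close>, the first-order
      term of the increment.\<close>
    have "(LBINT s:{x..y}. exp (- \<Gamma> s) * \<gamma> s)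
        = exp (- \<Gamma> x) * (LBINT s:{x..y}. exp (\<Gamma> x - \<Gamma> s) * \<gamma> s)"
      by (subst set_integral_mult_right[symmetric])
        (auto simp: exp_diff exp_minus field_simps intro!: set_lebesgue_integral_cong)
    also have "(LBINT s:{x..y}. exp (\<Gamma> x - \<Gamma> s) * \<gamma> s)
        = (LBINT s:{x..y}. (exp (\<Gamma> x - \<Gamma> s) - 1) * \<gamma> s) + (\<Gamma> y - \<Gamma> x)"
      using prim[OF xy] set_integral_add(2)[OF i1 sub[of x y]] xy by (simp add: algebra_simps)
    finally have "\<Phi> x y = exp (- \<Gamma> x) * (- (exp (\<Gamma> x - \<Gamma> y) - 1 - (\<Gamma> x - \<Gamma> y))
        - (LBINT s:{x..y}. (exp (\<Gamma> x - \<Gamma> s) - 1) * \<gamma> s))"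
 by (simp only: \<Phi>_def ey alg)
    then have "norm (\<Phi> x y) = norm (exp (- \<Gamma> x)) * norm (- (exp (\<Gamma> x - \<Gamma> y) - 1 - (\<Gamma> x - \<Gamma> y))
        - (LBINT s:{x..y}. (exp (\<Gamma> x - \<Gamma> s) - 1) * \<gamma> s))"
      by (simp add: norm_mult)
    also have "\<dots> \<le> exp (norm (\<Gamma> a) + v b) * (exp w * w\<^sup>2 + exp w * w\<^sup>2)"
    proof (rule mult_mono)
      have "norm (\<Gamma> x) \<le> norm (\<Gamma> a) + norm (\<Gamma> x - \<Gamma> a)" by norm
      also have "\<dots> \<le> norm (\<Gamma> a) + v b"
        using G_bound[of a x] v_mono[of x b] xy v_a by auto
      finally show "norm (exp (- \<Gamma> x)) \<le> exp (norm (\<Gamma> a) + v b)"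
        using abs_Re_le_cmod[of "\<Gamma> x"] by simp
      have "norm (exp (\<Gamma> x - \<Gamma> y) - 1 - (\<Gamma> x - \<Gamma> y)) \<le> exp (norm (\<Gamma> x - \<Gamma> y)) * (norm (\<Gamma> x - \<Gamma> y))\<^sup>2"
        by (rule norm_exp_minus_one_minus_le)
      also have "\<dots> \<le> exp w * w\<^sup>2"
        using d[of y] xy w0 by (intro mult_mono power_mono) (auto simp: norm_minus_commute)
      finally have 1: "norm (- (exp (\<Gamma> x - \<Gamma> y) - 1 - (\<Gamma> x - \<Gamma> y))) \<le> exp w * w\<^sup>2"
        by (metis norm_minus_cancel)
      have "norm (LBINT s:{x..y}. (exp (\<Gamma> x - \<Gamma> s) - 1) * \<gamma> s)
          \<le> (LBINT s:{x..y}. norm ((exp (\<Gamma> x - \<Gamma> s) - 1) * \<gamma> s))"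
        by (rule set_integral_norm_bound[OF i1])
      also have "\<dots> \<le> (LBINT s:{x..y}. (exp w * w) * norm (\<gamma> s))"
        using e xy by (intro set_integral_mono set_integrable_norm i1 set_integrable_mult_right nsub)
          (auto simp: norm_mult intro!: mult_right_mono)
      also have "\<dots> = exp w * w\<^sup>2"
        using v_diff[OF xy] by (simp add: w_def power2_eq_square)
      finally show "norm (- (exp (\<Gamma> x - \<Gamma> y) - 1 - (\<Gamma> x - \<Gamma> y))
        - (LBINT s:{x..y}. (exp (\<Gamma> x - \<Gamma> s) - 1) * \<gamma> s)) \<le> exp w * w\<^sup>2 + exp w * w\<^sup>2"
        using 1 by (intro order_trans[OF norm_triangle_ineq4] add_mono)
    qed auto
    also have "\<dots> = 2 * exp (norm (\<Gamma> a) + v b) * exp w * w\<^sup>2" by (simp add: algebra_simps)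
    also have "\<dots> \<le> C * w\<^sup>2"
      unfolding C_def using w0 by (intro mult_right_mono mult_left_mono) auto
    finally show ?thesis by (simp add: w_def)
  qed
  have bisect: "norm (\<Phi> x y) \<le> C * (v y - v x)\<^sup>2 / 2 ^ k" if "a \<le> x" "x \<le> y" "y \<le> b" for x y k
    using that
  proof (induction k arbitrary: x y)
    case 0
    then show ?case using base[of x y] by simp
  next
    case (Suc k)
    \<comment> \<open>\<open>v\<close> is continuous even where \<open>\<gamma>\<close> is wild, so
      a point of half mass exists. Two pieces of mass \<open>w / 2\<close> have squares that add up
      to \<open>w\<^sup>2 / 2\<close>.\<close>
    have "\<exists>z\<ge>x. z \<le> y \<and> v z = (v x + v y) / 2"
      using Suc.prems v_mono[of x y] v_cont by (intro IVT') (auto elim: continuous_on_subset)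
    then obtain z where z: "x \<le> z" "z \<le> y" "v z = (v x + v y) / 2" by auto
    have "norm (\<Phi> x y) \<le> norm (\<Phi> x z) + norm (\<Phi> z y)"
      using \<Phi>_add[of x z y] z Suc.prems by (simp add: norm_triangle_ineq)
    also have "\<dots> \<le> C * (v z - v x)\<^sup>2 / 2 ^ k + C * (v y - v z)\<^sup>2 / 2 ^ k"
      using z Suc.prems by (intro add_mono Suc.IH) auto
    also have "\<dots> = C * (v y - v x)\<^sup>2 / 2 ^ Suc k"
      unfolding z(3) by (simp add: field_simps power2_eq_square)
    finally show ?case .
  qed
  have "(\<lambda>k. C * (v b - v a)\<^sup>2 / 2 ^ k) \<longlonglongrightarrow> 0"
    by (rule LIMSEQ_divide_realpow_zero) simp
  then have "norm (\<Phi> a b) \<le> 0"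
    by (rule LIMSEQ_le_const) (use bisect[of a b] ab in auto)
  then show "(LBINT s:{a..b}. exp (- \<Gamma> s) * \<gamma> s) = exp (- \<Gamma> a) - exp (- \<Gamma> b)"
    by (simp add: \<Phi>_def)
qed

text \<open>In the order of \<open>\<tau>\<close>, the factor \<open>h i\<close> changes the running
  product by \<open>h i - 1\<close> times its value just before. The induction removes the index
  with the largest \<open>\<tau>\<close>, since this leaves the inner products of all other indices
  unchanged.\<close>

lemma prod_telescope_ordered:
  fixes h :: "'i \<Rightarrow> 'b::comm_ring_1" and \<tau> :: "'i \<Rightarrow> 'c::linorder"
  assumes "finite I" "inj_on \<tau> I"
  shows "prod h I = 1 + (\<Sum>i\<in>I. (h i - 1) * (\<Prod>j\<in>{j\<in>I. \<tau> j < \<tau> i}. h j))"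
  using assms
proof (induction "card I" arbitrary: I)
  case 0
  then show ?case by simp
next
  case (Suc k)
  then have ne: "I \<noteq> {}" by auto
  define m where "m = Max (\<tau> ` I)"
  have "m \<in> \<tau> ` I" using Suc ne by (auto simp: m_def)
  then obtain i0 where i0: "i0 \<in> I" "\<tau> i0 = m" by auto
  have le: "\<tau> i \<le> \<tau> i0" if "i \<in> I" for i using that Suc i0 by (simp add: m_def)
  define J where "J = I - {i0}"
  have J: "k = card J" "finite J" "inj_on \<tau> J"
    using Suc.hyps(2) Suc.prems i0 by (auto simp: J_def inj_on_diff)
  have I: "I = insert i0 J" "i0 \<notin> J" using i0 by (auto simp: J_def)
  have lt: "\<tau> i < \<tau> i0" if "i \<in> J" for i
    using le[of i] that Suc.prems(2) i0 by (auto simp: J_def inj_on_def order_less_le)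
  have e0: "{j\<in>I. \<tau> j < \<tau> i0} = J" using lt I by auto
  have e1: "{j\<in>I. \<tau> j < \<tau> i} = {j\<in>J. \<tau> j < \<tau> i}" if "i \<in> J" for i
    using lt[OF that] I by auto
  have "prod h I = h i0 * prod h J" using I J by simp
  also have "\<dots> = (h i0 - 1) * prod h J + prod h J" by (simp add: algebra_simps)
  also have "\<dots> = 1 + ((h i0 - 1) * prod h J + (\<Sum>i\<in>J. (h i - 1) * (\<Prod>j\<in>{j\<in>J. \<tau> j < \<tau> i}. h j)))"
    using Suc.hyps(1)[OF J] by simp
  also have "\<dots> = 1 + (\<Sum>i\<in>I. (h i - 1) * (\<Prod>j\<in>{j\<in>I. \<tau> j < \<tau> i}. h j))"
  proof -
    have "(\<Sum>i\<in>J. (h i - 1) * (\<Prod>j\<in>{j\<in>J. \<tau> j < \<tau> i}. h j)) = (\<Sum>i\<in>J. (h i - 1) * (\<Prod>j\<in>{j\<in>I. \<tau> j < \<tau> i}. h j))"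
      by (intro sum.cong refl) (simp only: e1)
    moreover have "(\<Sum>i\<in>I. (h i - 1) * (\<Prod>j\<in>{j\<in>I. \<tau> j < \<tau> i}. h j)) =
      (h i0 - 1) * (\<Prod>j\<in>{j\<in>I. \<tau> j < \<tau> i0}. h j) + (\<Sum>i\<in>J. (h i - 1) * (\<Prod>j\<in>{j\<in>I. \<tau> j < \<tau> i}. h j))"
      using J(2) I(2) by (subst (1) I(1)) simp
    ultimately show ?thesis by (simp only: e0)
  qed
  finally show ?case .
qed

text \<open>This is the equation \<open>dZ = Z\<^sub>- (g - 1) dN - Z\<^sub>- (g - 1) X dt\<close>
  on one path; the strict \<open>\<tau> j < s\<close> in the products encodes the left limit
  \<open>Z\<^sub>-\<close>. Integration by parts is avoided: the product is a step function of
  \<open>s\<close>, so only integrals of \<open>exp (- \<Gamma>) * \<gamma>\<close> from a jump time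
  to \<open>t\<close> occur, and these are known.\<close>

lemma jump_exponential_equation:
  fixes \<gamma> \<Gamma> :: "real \<Rightarrow> complex" and h :: "'i \<Rightarrow> complex" and \<tau> :: "'i \<Rightarrow> real"
  assumes rt: "r \<le> t" and int: "set_integrable lborel {r..t} \<gamma>"
    and prim: "\<And>x y. r \<le> x \<Longrightarrow> x \<le> y \<Longrightarrow> y \<le> t \<Longrightarrow> \<Gamma> y - \<Gamma> x = (LBINT u:{x..y}. \<gamma> u)"
    and \<Gamma>r: "\<Gamma> r = 0"
    and I: "finite I" "inj_on \<tau> I" "\<And>i. i \<in> I \<Longrightarrow> r < \<tau> i \<and> \<tau> i \<le> t"
  shows "(\<Sum>i\<in>I. exp (- \<Gamma> (\<tau> i)) * (\<Prod>j\<in>{j\<in>I. \<tau> j < \<tau> i}. h j) * (h i - 1))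
      - (LBINT s:{r..t}. exp (- \<Gamma> s) * (\<Prod>j\<in>{j\<in>I. \<tau> j < s}. h j) * \<gamma> s)
      = exp (- \<Gamma> t) * prod h I - 1"
proof -
  define d where "d i = (h i - 1) * (\<Prod>j\<in>{j\<in>I. \<tau> j < \<tau> i}. h j)" for i
  \<comment> \<open>Telescoping over the indices before \<open>s\<close> turns the left-limit
    product into a linear combination of step functions with coefficients \<open>d i\<close> that do
    not depend on \<open>s\<close>.\<close>
  have P: "(\<Prod>j\<in>{j\<in>I. \<tau> j < s}. h j) = 1 + (\<Sum>i\<in>I. if \<tau> i < s then d i else 0)" for s
  proof -
    have "(\<Prod>j\<in>{j\<in>I. \<tau> j < s}. h j)
      = 1 + (\<Sum>i\<in>{j\<in>I. \<tau> j < s}. (h i - 1) * (\<Prod>j\<in>{j\<in>{j\<in>I. \<tau> j < s}. \<tau> j < \<tau> i}. h j))"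
      using I by (intro prod_telescope_ordered) (auto elim: inj_on_subset)
    also have "(\<Sum>i\<in>{j\<in>I. \<tau> j < s}. (h i - 1) * (\<Prod>j\<in>{j\<in>{j\<in>I. \<tau> j < s}. \<tau> j < \<tau> i}. h j))
      = (\<Sum>i\<in>{j\<in>I. \<tau> j < s}. d i)"
    proof (intro sum.cong refl)
      fix i assume i: "i \<in> {j\<in>I. \<tau> j < s}"
      have "{j\<in>{j\<in>I. \<tau> j < s}. \<tau> j < \<tau> i} = {j\<in>I. \<tau> j < \<tau> i}" using i by auto
      then show "(h i - 1) * (\<Prod>j\<in>{j\<in>{j\<in>I. \<tau> j < s}. \<tau> j < \<tau> i}. h j) = d i" by (simp add: d_def)
    qed
    also have "\<dots> = (\<Sum>i\<in>I. if \<tau> i < s then d i else 0)"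
      using I by (intro sum.inter_filter) auto
    finally show ?thesis .
  qed
  let ?e = "\<lambda>s. exp (- \<Gamma> s) * \<gamma> s"
  have ei: "set_integrable lborel {x..t} ?e \<and> (LBINT s:{x..t}. ?e s) = exp (- \<Gamma> x) - exp (- \<Gamma> t)"
    if "r \<le> x" "x \<le> t" for x
    using that prim int
    by (intro conjI LBINT_exp_primitive) (auto elim!: set_integrable_subset)
  have eI: "set_integrable lborel {r..t} (\<lambda>s. if \<tau> i < s then d i * ?e s else 0)"
    "(LBINT s:{r..t}. if \<tau> i < s then d i * ?e s else 0) = d i * (exp (- \<Gamma> (\<tau> i)) - exp (- \<Gamma> t))"
    if i: "i \<in> I" for i
  proof -
    have ti: "r < \<tau> i" "\<tau> i \<le> t" using I i by auto
    have eq: "indicator {r..t} s *\<^sub>R (if \<tau> i < s then d i * ?e s else 0) =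
      indicator {\<tau> i<..t} s *\<^sub>R (d i * ?e s)" for s
      using ti by (auto simp: indicator_def)
    have 1: "set_integrable lborel {\<tau> i<..t} (\<lambda>s. d i * ?e s)"
      using ei[of "\<tau> i"] ti
      by (intro set_integrable_mult_right) (auto elim!: set_integrable_subset)
    then show "set_integrable lborel {r..t} (\<lambda>s. if \<tau> i < s then d i * ?e s else 0)"
      unfolding set_integrable_def eq .
    have "(LBINT s:{r..t}. if \<tau> i < s then d i * ?e s else 0) = (LBINT s:{\<tau> i<..t}. d i * ?e s)"
      unfolding set_lebesgue_integral_def eq ..
    also have "\<dots> = (LBINT s:{\<tau> i..t}. d i * ?e s)"
    proof (rule set_integral_cong_set)
      show "set_borel_measurable lborel {\<tau> i<..t} (\<lambda>s. d i * ?e s)"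
        using 1 by (simp add: set_integrable_def set_borel_measurable_def)
      show "set_borel_measurable lborel {\<tau> i..t} (\<lambda>s. d i * ?e s)"
      proof -
        have "set_integrable lborel {\<tau> i..t} (\<lambda>s. d i * ?e s)"
          using ei[of "\<tau> i"] ti by (intro set_integrable_mult_right) auto
        then show ?thesis by (simp add: set_integrable_def set_borel_measurable_def)
      qed
      show "AE x in lborel. (x \<in> {\<tau> i..t}) = (x \<in> {\<tau> i<..t})"
        using AE_lborel_singleton[of "\<tau> i"] by eventually_elim auto
    qed
    also have "\<dots> = d i * (exp (- \<Gamma> (\<tau> i)) - exp (- \<Gamma> t))"
      using ei[of "\<tau> i"] ti by simp
    finally show "(LBINT s:{r..t}. if \<tau> i < s then d i * ?e s else 0) = d i * (exp (- \<Gamma> (\<tau> i)) - exp (- \<Gamma> t))" .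
  qed
  have sumI: "set_integrable lborel {r..t} (\<lambda>s. \<Sum>i\<in>I. if \<tau> i < s then d i * ?e s else 0)"
    "(LBINT s:{r..t}. \<Sum>i\<in>I. if \<tau> i < s then d i * ?e s else 0)
     = (\<Sum>i\<in>I. d i * (exp (- \<Gamma> (\<tau> i)) - exp (- \<Gamma> t)))"
    unfolding set_integrable_def set_lebesgue_integral_def scaleR_sum_right
    using eI unfolding set_integrable_def set_lebesgue_integral_def
    by (auto intro!: Bochner_Integration.integrable_sum simp: Bochner_Integration.integral_sum)
  have "(LBINT s:{r..t}. exp (- \<Gamma> s) * (\<Prod>j\<in>{j\<in>I. \<tau> j < s}. h j) * \<gamma> s)
    = (LBINT s:{r..t}. ?e s + (\<Sum>i\<in>I. if \<tau> i < s then d i * ?e s else 0))"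
    by (intro set_lebesgue_integral_cong)
      (auto simp: P algebra_simps sum_distrib_left sum_distrib_right if_distrib cong: if_cong intro!: sum.cong)
  also have "\<dots> = (1 - exp (- \<Gamma> t)) + (\<Sum>i\<in>I. d i * (exp (- \<Gamma> (\<tau> i)) - exp (- \<Gamma> t)))"
    using ei[of r] rt \<Gamma>r sumI by (simp add: set_integral_add)
  finally have L: "(LBINT s:{r..t}. exp (- \<Gamma> s) * (\<Prod>j\<in>{j\<in>I. \<tau> j < s}. h j) * \<gamma> s)
     = (1 - exp (- \<Gamma> t)) + (\<Sum>i\<in>I. d i * exp (- \<Gamma> (\<tau> i))) - exp (- \<Gamma> t) * (\<Sum>i\<in>I. d i)"
    by (simp add: right_diff_distrib sum_subtractf sum_distrib_left sum_distrib_right mult.commute)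
  have S: "(\<Sum>i\<in>I. exp (- \<Gamma> (\<tau> i)) * (\<Prod>j\<in>{j\<in>I. \<tau> j < \<tau> i}. h j) * (h i - 1))
    = (\<Sum>i\<in>I. d i * exp (- \<Gamma> (\<tau> i)))"
    by (simp add: d_def mult_ac)
  have Q: "prod h I = 1 + (\<Sum>i\<in>I. d i)"
    using prod_telescope_ordered[OF I(1,2), of h] by (simp add: d_def)
  show ?thesis unfolding L S Q by (simp add: algebra_simps)
qed

subsection \<open>Mixed Poisson distributions\<close>

lemma integral_exp_ii_period:
  fixes m :: int
  shows "(LBINT u:{0..2*pi}. exp (\<i> * of_int m * of_real u)) = (if m = 0 then 2 * pi else 0 :: complex)"
proof (cases "m = 0")
  case True
  then show ?thesis by (simp add: set_lebesgue_integral_def scaleR_conv_of_real)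
next
  case False
  define F where "F u = exp (\<i> * of_int m * of_real u) / (\<i> * of_int m)" for u :: real
  have "(LBINT u:{0..2*pi}. exp (\<i> * of_int m * of_real u)) = F (2 * pi) - F 0"
    unfolding set_lebesgue_integral_def
  proof (rule integral_FTC_Icc)
    show "continuous_on {0..2 * pi} (\<lambda>u. exp (\<i> * of_int m * of_real u) :: complex)"
      by (intro continuous_intros)
    show "(F has_vector_derivative exp (\<i> * of_int m * of_real x)) (at x within {0..2 * pi})" for x
      unfolding F_def using False
      by (auto intro!: derivative_eq_intros has_vector_derivative_real_field simp: field_simps)
  qed simp
  moreover have "exp (\<i> * of_int m * of_real (2 * pi)) = 1"
    using exp_integer_2pi[of "of_int m"] by (simp add: mult_ac)
  ultimately show ?thesis using False by (simp add: F_def)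
qed

text \<open>Multiply by \<open>exp (- \<i> * k * u)\<close> and integrate over a period:
  orthogonality leaves \<open>2 * pi * c k\<close>. Absolute summability permits integration term by
  term.\<close>

lemma fourier_coefficients_unique:
  fixes c :: "nat \<Rightarrow> complex"
  assumes c: "summable (\<lambda>l. norm (c l))"
    and zero: "\<And>u::real. (\<Sum>l. c l * iexp (u * real l)) = 0"
  shows "c k = 0"
proof -
  let ?f = "\<lambda>l u. indicator {0..2*pi} u *\<^sub>R (c l * exp (\<i> * of_int (int l - int k) * of_real u))"
  have nrm: "norm (exp (\<i> * of_int j * of_real u)) = 1" for j :: int and u
    using norm_exp_i_times[of "of_int j * u"] by (simp add: mult.assoc)
  have int: "integrable lborel (?f l)" for l
    by (intro borel_integrable_compact continuous_intros) auto
  have norm_f: "norm (?f l u) = indicator {0..2*pi} u * norm (c l)" for l u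
    by (simp add: norm_mult nrm)
  have "(\<Sum>l. ?f l u) = 0" for u
  proof -
    have "summable (\<lambda>l. c l * iexp (u * real l))"
      using c by (intro summable_norm_cancel[of "\<lambda>l. c l * iexp (u * real l)"])
        (simp add: norm_mult del: of_real_mult)
    then have "(\<Sum>l. (c l * iexp (u * real l)) * exp (- \<i> * of_nat k * of_real u)) = 0"
      using zero[of u] by (subst suminf_mult2[symmetric]) auto
    also have "(\<lambda>l. (c l * iexp (u * real l)) * exp (- \<i> * of_nat k * of_real u))
      = (\<lambda>l. c l * exp (\<i> * of_int (int l - int k) * of_real u))"
      by (simp add: mult.assoc flip: exp_add) (simp add: algebra_simps)
    finally show ?thesis by (simp add: indicator_def)
  qed
  then have "0 = (\<integral>u. (\<Sum>l. ?f l u) \<partial>lborel)" by simp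
  also have "\<dots> = (\<Sum>l. \<integral>u. ?f l u \<partial>lborel)"
  proof (intro integral_suminf int AE_I2)
    show "summable (\<lambda>l. norm (?f l u))" for u
      unfolding norm_f by (intro summable_mult c)
    have "(\<integral>u. norm (?f l u) \<partial>lborel) = 2 * pi * norm (c l)" for l
      unfolding norm_f by simp
    then show "summable (\<lambda>l. \<integral>u. norm (?f l u) \<partial>lborel)"
      by (simp only:) (intro summable_mult c)
  qed
  also have "\<dots> = (\<Sum>l. if l = k then 2 * pi * c l else 0)"
  proof (intro suminf_cong)
    fix l
    have "(\<integral>u. ?f l u \<partial>lborel) = c l * (LBINT u:{0..2*pi}. exp (\<i> * of_int (int l - int k) * of_real u))"
      by (subst set_integral_mult_right[symmetric]) (simp only: set_lebesgue_integral_def)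
    also have "\<dots> = (if l = k then 2 * pi * c l else 0)"
      by (subst integral_exp_ii_period) simp
    finally show "(\<integral>u. ?f l u \<partial>lborel) = (if l = k then 2 * pi * c l else 0)" .
  qed
  also have "\<dots> = 2 * pi * c k" using suminf_finite[of "{k}" "\<lambda>l. if l = k then 2 * pi * c l else 0"] by simp
  finally show ?thesis by simp
qed

section \<open>Law and moments of a mixed Poisson variable\<close>

context finite_measure
begin

text \<open>Applied once to the indicators of \<open>D = l\<close> and once to the Poisson weights.
  In both cases the weights sum to at most 1, and this bound justifies exchanging sum and
  integral.\<close>

lemma integral_fourier_series:
  fixes p :: "nat \<Rightarrow> 'a \<Rightarrow> real"
  assumes [measurable]: "\<And>l. p l \<in> borel_measurable M"
    and p0: "\<And>l w. w \<in> space M \<Longrightarrow> 0 \<le> p l w"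
    and p1: "\<And>n w. w \<in> space M \<Longrightarrow> (\<Sum>l<n. p l w) \<le> 1"
  shows "summable (\<lambda>l. \<integral>w. p l w \<partial>M)"
    and "(\<integral>w. (\<Sum>l. of_real (p l w) * iexp (u * real l)) \<partial>M)
      = (\<Sum>l. of_real (\<integral>w. p l w \<partial>M) * iexp (u * real l))"
proof -
  have p_le: "p l w \<le> 1" if "w \<in> space M" for l w
    using p1[OF that, of "Suc l"] p0[OF that] sum_nonneg[of "{..<l}" "\<lambda>l. p l w"] by simp
  have int: "integrable M (p l)" for l
    by (rule integrable_const_bound[where B = 1]) (use p0 p_le in auto)
  show s: "summable (\<lambda>l. \<integral>w. p l w \<partial>M)"
  proof (rule summableI_nonneg_bounded)
    show "0 \<le> (\<integral>w. p l w \<partial>M)" for l using p0 by (intro integral_nonneg_AE) auto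
    fix n
    have "(\<Sum>l<n. \<integral>w. p l w \<partial>M) = (\<integral>w. (\<Sum>l<n. p l w) \<partial>M)"
      by (rule Bochner_Integration.integral_sum[symmetric]) (rule int)
    also have "\<dots> \<le> (\<integral>w. 1 \<partial>M)"
      using p1 by (intro integral_mono Bochner_Integration.integrable_sum int) auto
    finally show "(\<Sum>l<n. \<integral>w. p l w \<partial>M) \<le> (\<integral>w. 1 \<partial>M)" .
  qed
  let ?f = "\<lambda>l w. of_real (p l w) * iexp (u * real l)"
  have n: "norm (?f l w) = \<bar>p l w\<bar>" for l w by (simp add: norm_mult del: of_real_mult)
  have "(\<integral>w. (\<Sum>l. ?f l w) \<partial>M) = (\<Sum>l. \<integral>w. ?f l w \<partial>M)"
  proof (intro integral_suminf AE_I2)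
    show "integrable M (?f l)" for l by (intro integrable_mult_left integrable_of_real int)
    show "summable (\<lambda>l. norm (?f l w))" if "w \<in> space M" for w
      unfolding n using p0[OF that] p1[OF that]
      by (intro summableI_nonneg_bounded[where x = 1]) auto
    have "(\<integral>w. norm (?f l w) \<partial>M) = (\<integral>w. p l w \<partial>M)" for l
      unfolding n using p0 by (intro Bochner_Integration.integral_cong) auto
    then show "summable (\<lambda>l. \<integral>w. norm (?f l w) \<partial>M)" using s by simp
  qed
  then show "(\<integral>w. (\<Sum>l. ?f l w) \<partial>M) = (\<Sum>l. of_real (\<integral>w. p l w \<partial>M) * iexp (u * real l))"
    by simp
qed

context
  fixes D :: "'a \<Rightarrow> nat" and L :: "'a \<Rightarrow> real" and A :: "'a set"
  assumes D[measurable]: "D \<in> measurable M (count_space UNIV)"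
    and L[measurable]: "L \<in> borel_measurable M" and L0: "\<And>w. w \<in> space M \<Longrightarrow> 0 \<le> L w"
    and A[measurable]: "A \<in> sets M"
    and char_eq: "\<And>u::real. (\<integral>w. indicator A w *\<^sub>R iexp (u * real (D w)) \<partial>M)
      = (\<integral>w. indicator A w *\<^sub>R exp ((iexp u - 1) * of_real (L w)) \<partial>M)"
begin

text \<open>\<open>D\<close> is integer-valued, so both sides of \<open>char_eq\<close> are Fourier
  series in \<open>u\<close>: on the left with coefficients \<open>P (A, D = l)\<close>, on the
  right after expanding \<open>exp (iexp u * L)\<close> in powers of \<open>iexp u\<close>.
  Comparing coefficients gives the law of \<open>D\<close> on \<open>A\<close>; later
  \<open>A\<close> runs through a conditioning sigma-algebra.\<close>

lemma mixed_poisson_distribution: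
  "measure M (A \<inter> D -` {k} \<inter> space M) = (\<integral>w. indicator A w * (exp (- L w) * L w ^ k / fact k) \<partial>M)"
proof -
  define p where "p l w = (indicator (A \<inter> D -` {l} \<inter> space M) w :: real)" for l w
  define q where "q l w = (indicator A w * (exp (- L w) * L w ^ l / fact l) :: real)" for l w
  have exp_sums: "(\<lambda>l. z ^ l / fact l) sums exp z" for z :: complex
    using exp_converges[of z] by (simp add: scaleR_conv_of_real divide_inverse mult.commute)
  have exp_sums_r: "(\<lambda>l. z ^ l / fact l) sums exp z" for z :: real
    using exp_converges[of z] by (simp add: divide_inverse mult.commute)
  have pm[measurable]: "p l \<in> borel_measurable M" for l unfolding p_def by (intro borel_measurable_indicator) (use measurable_sets[OF D, of "{l}"] A in \<open>auto simp: Int_assoc\<close>)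
  have qm[measurable]: "q l \<in> borel_measurable M" for l unfolding q_def by measurable
  have p1: "(\<Sum>l<n. p l w) \<le> 1" for n w
  proof -
    have "(\<Sum>l<n. p l w) \<le> (\<Sum>l<n. if l = D w then 1 else 0)"
      by (intro sum_mono) (auto simp: p_def indicator_def)
    also have "\<dots> \<le> 1" by simp
    finally show ?thesis .
  qed
  have q0: "0 \<le> q l w" if "w \<in> space M" for l w using L0[OF that] by (simp add: q_def)
  have q1: "(\<Sum>l<n. q l w) \<le> 1" if "w \<in> space M" for n w
  proof -
    have "(\<Sum>l<n. q l w) = indicator A w * exp (- L w) * (\<Sum>l<n. L w ^ l / fact l)"
      by (simp add: q_def sum_distrib_left mult_ac)
    also have "\<dots> \<le> 1 * exp (- L w) * exp (L w)"
      using L0[OF that] exp_sums_r[of "L w"]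
      by (intro mult_mono mult_right_mono indicator_le_1)
        (auto intro!: sum_nonneg sum_le_suminf[THEN order_trans] simp: sums_iff)
    finally show ?thesis by (simp flip: exp_add)
  qed
  have P: "(\<Sum>l. of_real (p l w) * iexp (u * real l))
      = indicator A w *\<^sub>R iexp (u * real (D w))" if "w \<in> space M" for w u
    using that by (subst suminf_finite[of "{D w}"]) (auto simp: p_def indicator_def)
  have Q: "(\<Sum>l. of_real (q l w) * iexp (u * real l))
      = indicator A w *\<^sub>R exp ((iexp u - 1) * of_real (L w))" for w u
  proof -
    let ?z = "iexp u * of_real (L w) :: complex"
    have "(\<lambda>l. (of_real (indicator A w) * exp (- of_real (L w))) * (?z ^ l / fact l))
       sums ((of_real (indicator A w) * exp (- of_real (L w))) * exp ?z)"
      by (intro sums_mult exp_sums)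
    also have "(\<lambda>l. (of_real (indicator A w) * exp (- of_real (L w))) * (?z ^ l / fact l))
       = (\<lambda>l. of_real (q l w) * iexp (u * real l))"
      by (simp add: q_def power_mult_distrib exp_of_real[symmetric] mult_ac flip: exp_of_nat_mult)
    also have "(of_real (indicator A w) * exp (- of_real (L w))) * exp ?z
       = indicator A w *\<^sub>R exp ((iexp u - 1) * of_real (L w))"
      by (simp add: scaleR_conv_of_real mult.assoc left_diff_distrib flip: exp_add)
    finally show ?thesis by (simp add: sums_iff)
  qed
  note fp = integral_fourier_series[OF pm, OF _ p1] and fq = integral_fourier_series[OF qm q0 q1]
  have p0: "0 \<le> p l w" for l w by (simp add: p_def)
  define c where "c l = complex_of_real ((\<integral>w. p l w \<partial>M) - (\<integral>w. q l w \<partial>M))" for l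
  have ip: "0 \<le> (\<integral>w. p l w \<partial>M)" "0 \<le> (\<integral>w. q l w \<partial>M)" for l
    using p0 q0 by (auto intro!: integral_nonneg_AE)
  have sc: "summable (\<lambda>l. norm (c l))"
  proof (rule summable_comparison_test')
    show "summable (\<lambda>l. (\<integral>w. p l w \<partial>M) + (\<integral>w. q l w \<partial>M))"
      using fp(1)[OF p0] fq(1) by (intro summable_add)
    show "norm (norm (c l)) \<le> (\<integral>w. p l w \<partial>M) + (\<integral>w. q l w \<partial>M)" for l
      using ip[of l] unfolding c_def by (simp del: of_real_diff)
  qed
  have sn: "summable (\<lambda>l. complex_of_real (a l) * iexp (u * real l))"
    if "summable a" "\<And>l. 0 \<le> a l" for a u
    by (rule summable_norm_cancel) (use that in \<open>simp add: norm_mult del: of_real_mult\<close>)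
  have "(\<Sum>l. c l * iexp (u * real l)) = 0" for u
  proof -
    have "(\<Sum>l. c l * iexp (u * real l))
      = (\<Sum>l. of_real (\<integral>w. p l w \<partial>M) * iexp (u * real l))
      - (\<Sum>l. of_real (\<integral>w. q l w \<partial>M) * iexp (u * real l))"
      unfolding c_def of_real_diff left_diff_distrib
      by (rule suminf_diff[OF sn sn, symmetric]) (use fp(1)[OF p0] fq(1) ip in auto)
    also have "\<dots> = (\<integral>w. indicator A w *\<^sub>R iexp (u * real (D w)) \<partial>M)
      - (\<integral>w. indicator A w *\<^sub>R exp ((iexp u - 1) * of_real (L w)) \<partial>M)"
    proof (rule arg_cong2[of _ _ _ _ "(-)"])
      show "(\<Sum>l. of_real (\<integral>w. p l w \<partial>M) * iexp (u * real l))
          = (\<integral>w. indicator A w *\<^sub>R iexp (u * real (D w)) \<partial>M)"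
        by (subst fp(2)[OF p0, symmetric]) (intro Bochner_Integration.integral_cong refl P)
      show "(\<Sum>l. of_real (\<integral>w. q l w \<partial>M) * iexp (u * real l))
          = (\<integral>w. indicator A w *\<^sub>R exp ((iexp u - 1) * of_real (L w)) \<partial>M)"
        by (subst fq(2)[symmetric]) (assumption | intro Bochner_Integration.integral_cong refl Q)+
    qed
    finally show ?thesis by (simp only: char_eq diff_self)
  qed
  from fourier_coefficients_unique[OF sc this, of k]
  have "(\<integral>w. p k w \<partial>M) = (\<integral>w. q k w \<partial>M)" by (simp add: c_def)
  then show ?thesis by (simp add: p_def q_def)
qed

text \<open>Stated with extended non-negative integrals because moments of \<open>L\<close> may be
  infinite. The choices \<open>f k = k\<close> and \<open>f k = K ^ k\<close> give the mean and the
  exponential moments.\<close>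

lemma nn_integral_mixed_poisson:
  fixes f :: "nat \<Rightarrow> ennreal"
  shows "(\<integral>\<^sup>+w. indicator A w * f (D w) \<partial>M)
    = (\<integral>\<^sup>+w. indicator A w * (\<Sum>k. f k * ennreal (exp (- L w) * L w ^ k / fact k)) \<partial>M)"
proof -
  have q: "emeasure M (A \<inter> D -` {k} \<inter> space M)
      = (\<integral>\<^sup>+w. indicator A w * ennreal (exp (- L w) * L w ^ k / fact k) \<partial>M)" for k
  proof -
    have le1: "exp (- x) * x ^ k / fact k \<le> 1" if "0 \<le> x" for x :: real
    proof -
      have "x ^ k / fact k \<le> exp x"
      proof -
        have s: "(\<lambda>l. x ^ l / fact l) sums exp x"
          using exp_converges[of x] by (simp add: divide_inverse mult.commute)
        have "(\<Sum>l\<in>{k}. x ^ l / fact l) \<le> (\<Sum>l. x ^ l / fact l)"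
          using that s by (intro sum_le_suminf) (auto simp: sums_iff)
        then show ?thesis using s by (simp add: sums_iff)
      qed
      then show ?thesis by (simp add: exp_minus field_simps)
    qed
    have i: "integrable M (\<lambda>w. indicator A w * (exp (- L w) * L w ^ k / fact k))"
      by (rule integrable_const_bound[where B = 1])
        (use L0 le1 in \<open>auto simp: indicator_def\<close>)
    have "emeasure M (A \<inter> D -` {k} \<inter> space M)
        = ennreal (\<integral>w. indicator A w * (exp (- L w) * L w ^ k / fact k) \<partial>M)"
      by (simp add: emeasure_eq_measure mixed_poisson_distribution)
    also have "\<dots> = (\<integral>\<^sup>+w. ennreal (indicator A w * (exp (- L w) * L w ^ k / fact k)) \<partial>M)"
      using L0 by (intro nn_integral_eq_integral[symmetric] i) auto
    also have "\<dots> = (\<integral>\<^sup>+w. indicator A w * ennreal (exp (- L w) * L w ^ k / fact k) \<partial>M)"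
      by (intro nn_integral_cong) (auto simp: indicator_def)
    finally show ?thesis .
  qed
  have "(\<integral>\<^sup>+w. indicator A w * f (D w) \<partial>M)
    = (\<integral>\<^sup>+w. (\<Sum>k. f k * indicator (A \<inter> D -` {k} \<inter> space M) w) \<partial>M)"
  proof (intro nn_integral_cong)
    fix w assume "w \<in> space M"
    then show "indicator A w * f (D w) = (\<Sum>k. f k * indicator (A \<inter> D -` {k} \<inter> space M) w)"
      by (subst suminf_finite[of "{D w}"]) (auto simp: indicator_def)
  qed
  also have "\<dots> = (\<Sum>k. f k * emeasure M (A \<inter> D -` {k} \<inter> space M))"
  proof (subst nn_integral_suminf)
    have m: "A \<inter> D -` {k} \<inter> space M \<in> sets M" for k
      using measurable_sets[OF D, of "{k}"] A by (auto simp: Int_assoc)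
    then show "(\<lambda>w. f k * indicator (A \<inter> D -` {k} \<inter> space M) w) \<in> borel_measurable M" for k
      by measurable
    show "(\<Sum>k. \<integral>\<^sup>+w. f k * indicator (A \<inter> D -` {k} \<inter> space M) w \<partial>M)
      = (\<Sum>k. f k * emeasure M (A \<inter> D -` {k} \<inter> space M))"
      by (intro suminf_cong nn_integral_cmult_indicator m)
  qed
  also have "\<dots> = (\<Sum>k. \<integral>\<^sup>+w. indicator A w * (f k * ennreal (exp (- L w) * L w ^ k / fact k)) \<partial>M)"
    unfolding q by (intro suminf_cong, subst nn_integral_cmult[symmetric]) (auto simp: mult_ac)
  also have "\<dots> = (\<integral>\<^sup>+w. (\<Sum>k. indicator A w * (f k * ennreal (exp (- L w) * L w ^ k / fact k))) \<partial>M)"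
    by (subst nn_integral_suminf) auto
  finally show ?thesis by (simp add: ennreal_suminf_cmult)
qed

lemma nn_integral_mixed_poisson_mean:
  "(\<integral>\<^sup>+w. indicator A w * ennreal (real (D w)) \<partial>M) = (\<integral>\<^sup>+w. indicator A w * ennreal (L w) \<partial>M)"
proof -
  have "(\<Sum>k. ennreal (real k) * ennreal (exp (- x) * x ^ k / fact k)) = ennreal x" if x: "0 \<le> x" for x :: real
  proof -
    have "(\<lambda>k. x ^ k / fact k) sums exp x"
      using exp_converges[of x] by (simp add: divide_inverse mult.commute)
    from sums_mult[OF this, of "exp (- x) * x"]
    have s: "(\<lambda>k. exp (- x) * x * (x ^ k / fact k)) sums (exp (- x) * x * exp x)" .
    have "(\<lambda>k. real (Suc k) * (exp (- x) * x ^ Suc k / fact (Suc k))) sums x"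
    proof -
      have e1: "(\<lambda>k. exp (- x) * x * (x ^ k / fact k)) = (\<lambda>k. real (Suc k) * (exp (- x) * x ^ Suc k / fact (Suc k)))"
        unfolding fact_Suc by (simp add: mult_ac del: of_nat_Suc)
      have e2: "exp (- x) * x * exp x = x" by (simp add: exp_minus)
      show ?thesis using s unfolding e1 e2 .
    qed
    \<comment> \<open>The term at \<open>k = 0\<close> vanishes, so undoing the index shift does not
      change the sum.\<close>
    then have "(\<lambda>k. real k * (exp (- x) * x ^ k / fact k)) sums x"
      by (subst (asm) sums_Suc_iff) simp
    then show ?thesis
      using x by (intro sums_unique[symmetric])
        (auto simp: ennreal_mult[symmetric] simp del: ennreal_of_nat_eq_real_of_nat intro!: sums_ennreal[THEN iffD2])
  qed
  then show ?thesis
    by (subst nn_integral_mixed_poisson[of "\<lambda>k. ennreal (real k)"]) (intro nn_integral_cong, simp add: L0)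
qed

text \<open>The generating function of the Poisson law at \<open>K\<close>. It controls products
  over jumps whose factors are bounded by \<open>K\<close> in modulus.\<close>

lemma nn_integral_mixed_poisson_exponential:
  assumes K: "0 \<le> (K :: real)"
  shows "(\<integral>\<^sup>+w. indicator A w * ennreal (K ^ D w) \<partial>M)
    = (\<integral>\<^sup>+w. indicator A w * ennreal (exp ((K - 1) * L w)) \<partial>M)"
proof -
  have "(\<Sum>k. ennreal (K ^ k) * ennreal (exp (- x) * x ^ k / fact k)) = ennreal (exp ((K - 1) * x))"
    if x: "0 \<le> x" for x :: real
  proof -
    have "(\<lambda>k. (K * x) ^ k / fact k) sums exp (K * x)"
      using exp_converges[of "K * x"] by (simp add: divide_inverse mult.commute)
    from sums_mult[OF this, of "exp (- x)"]
    have "(\<lambda>k. K ^ k * (exp (- x) * x ^ k / fact k)) sums exp ((K - 1) * x)"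
      by (simp add: field_simps power_mult_distrib exp_diff exp_minus left_diff_distrib)
    then show ?thesis
      using x K by (intro sums_unique[symmetric])
        (auto simp: ennreal_mult[symmetric] intro!: sums_ennreal[THEN iffD2])
  qed
  then show ?thesis
    by (subst nn_integral_mixed_poisson[of "\<lambda>k. ennreal (K ^ k)"]) (intro nn_integral_cong, simp add: L0)
qed

end

end

subsection \<open>Predictable sets\<close>

text \<open>Limits and point of evaluation may vary with \<open>p\<close>. This covers
  \<open>F 0\<close>-measurable integrals with the random limit \<open>S\<close> as well as
  predictable ones, where the upper limit is \<open>fst\<close> and \<open>g = snd\<close>.\<close>

lemma borel_measurable_LBINT_section:
  fixes G :: "'c measure" and f :: "real \<Rightarrow> 'c \<Rightarrow> 'b::{banach, second_countable_topology}"
  assumes f: "(\<lambda>p. f (fst p) (snd p)) \<in> borel_measurable (borel \<Otimes>\<^sub>M G)"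
    and l[measurable]: "l \<in> borel_measurable K" and h[measurable]: "h \<in> borel_measurable K"
    and g[measurable]: "g \<in> measurable K (G)"
  shows "(\<lambda>p. LBINT s:{l p..h p}. f s (g p)) \<in> borel_measurable K"
proof -
  have [measurable]: "(\<lambda>q. f (snd q) (g (fst q))) \<in> borel_measurable (K \<Otimes>\<^sub>M lborel)"
  proof -
    have "(\<lambda>q. (snd q, g (fst q))) \<in> measurable (K \<Otimes>\<^sub>M lborel) (borel \<Otimes>\<^sub>M G)" by measurable
    from measurable_compose[OF this f] show ?thesis by simp
  qed
  have "(\<lambda>p. \<integral>s. (if l p \<le> s \<and> s \<le> h p then 1 else 0 :: real) *\<^sub>R f s (g p) \<partial>lborel) \<in> borel_measurable K"
    by (rule lborel.borel_measurable_lebesgue_integral) measurable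
  also have "(\<lambda>p. \<integral>s. (if l p \<le> s \<and> s \<le> h p then 1 else 0 :: real) *\<^sub>R f s (g p) \<partial>lborel)
     = (\<lambda>p. LBINT s:{l p..h p}. f s (g p))"
    unfolding set_lebesgue_integral_def
    by (intro ext Bochner_Integration.integral_cong) (auto simp: indicator_def)
  finally show ?thesis .
qed

text \<open>
  A jump time that never occurs is encoded by a non-positive value of \<open>\<tau> n\<close>; only positive values
  are jump times. Nothing is assumed about the order of the jump times in \<open>n\<close>.
\<close>

locale conditional_poisson_jumps = complete_filtered_prob_space M F
  for M :: "'a measure" and F :: "real \<Rightarrow> 'a measure" +
  fixes \<tau> :: "nat \<Rightarrow> 'a \<Rightarrow> real" and X :: "real \<Rightarrow> 'a \<Rightarrow> real"
  assumes jump_stopping: "\<And>n t. 0 \<le> t \<Longrightarrow> {w \<in> space M. 0 < \<tau> n w \<and> \<tau> n w \<le> t} \<in> sets (F t)"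
    and jump_measurable[measurable]: "\<And>n. \<tau> n \<in> borel_measurable M"
    and jump_inj: "\<And>n m w. w \<in> space M \<Longrightarrow> 0 < \<tau> n w \<Longrightarrow> \<tau> n w = \<tau> m w \<Longrightarrow> n = m"
    and jump_finite: "\<And>t w. w \<in> space M \<Longrightarrow> finite {n. 0 < \<tau> n w \<and> \<tau> n w \<le> t}"
    and X_measurable: "(\<lambda>p. X (fst p) (snd p)) \<in> borel_measurable (borel \<Otimes>\<^sub>M F 0)"
    and X_nonneg: "\<And>s w. 0 \<le> X s w"
    and X_integrable: "\<And>a b w. w \<in> space M \<Longrightarrow> set_integrable lborel {a..b} (\<lambda>s. X s w)"
    and jump_char: "\<And>u r t A. 0 \<le> r \<Longrightarrow> r \<le> t \<Longrightarrow> A \<in> sets (F r) \<Longrightarrow>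
      (\<integral>w. indicator A w *\<^sub>R iexp (u * real (card {n. r < \<tau> n w \<and> \<tau> n w \<le> t})) \<partial>M)
      = (\<integral>w. indicator A w *\<^sub>R exp ((iexp u - 1) * of_real (LBINT s:{r..t}. X s w)) \<partial>M)"
begin

definition jumps :: "real \<Rightarrow> real \<Rightarrow> 'a \<Rightarrow> nat set" where
  "jumps a b w = {n. a < \<tau> n w \<and> \<tau> n w \<le> b}"

abbreviation cum :: "real \<Rightarrow> real \<Rightarrow> 'a \<Rightarrow> real" where
  "cum a b w \<equiv> (LBINT s:{a..b}. X s w)"

lemma space_F[simp]: "0 \<le> t \<Longrightarrow> space (F t) = space M"
  using subalg[of t] by (simp add: subalgebra_def)

lemma sets_F_M: "0 \<le> t \<Longrightarrow> A \<in> sets (F t) \<Longrightarrow> A \<in> sets M"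
  using subalg[of t] by (auto simp: subalgebra_def)

lemma measurable_F_mono: "0 \<le> s \<Longrightarrow> s \<le> t \<Longrightarrow> f \<in> measurable (F s) N \<Longrightarrow> f \<in> measurable (F t) N"
  using sets_mono[of s t] by (auto simp: measurable_def)

lemma measurable_F_M: "0 \<le> s \<Longrightarrow> f \<in> measurable (F s) N \<Longrightarrow> f \<in> measurable M N"
  using measurable_from_subalg[OF subalg] .

lemma finite_jumps: "0 \<le> a \<Longrightarrow> w \<in> space M \<Longrightarrow> finite (jumps a b w)"
  unfolding jumps_def by (rule finite_subset[OF _ jump_finite[of w b]]) auto

lemma inj_on_jumps: "0 \<le> a \<Longrightarrow> w \<in> space M \<Longrightarrow> inj_on (\<lambda>n. \<tau> n w) (jumps a b w)"
  using jump_inj by (force simp: jumps_def inj_on_def)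

lemma jump_event: "0 \<le> a \<Longrightarrow> a \<le> b \<Longrightarrow> {w \<in> space M. a < \<tau> n w \<and> \<tau> n w \<le> b} \<in> sets (F b)"
proof -
  assume ab: "0 \<le> a" "a \<le> b"
  have "{w \<in> space M. a < \<tau> n w \<and> \<tau> n w \<le> b}
    = {w \<in> space M. 0 < \<tau> n w \<and> \<tau> n w \<le> b} - {w \<in> space M. 0 < \<tau> n w \<and> \<tau> n w \<le> a}"
    using ab by auto
  also have "\<dots> \<in> sets (F b)"
    using ab jump_stopping[of b] jump_stopping[of a] sets_mono[of a b] by auto
  finally show ?thesis .
qed

lemma card_jumps_measurable:
  assumes "0 \<le> a" "a \<le> b"
  shows "(\<lambda>w. card (jumps a b w)) \<in> measurable (F b) (count_space UNIV)"
  by (rule measurable_card) (use jump_event[OF assms] assms in \<open>simp add: jumps_def\<close>)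

lemma cum_measurable: "(\<lambda>w. cum a b w) \<in> borel_measurable (F 0)"
  by (rule borel_measurable_LBINT_section[OF X_measurable]) auto

lemma cum_nonneg: "0 \<le> cum a b w"
  unfolding set_lebesgue_integral_def using X_nonneg by (intro integral_nonneg_AE) auto

lemma X_section[measurable]: "w \<in> space M \<Longrightarrow> (\<lambda>s. X s w) \<in> borel_measurable borel"
  using measurable_compose[OF measurable_Pair2'[of w "F 0" borel] X_measurable] by simp

lemma X_pair_measurable[measurable]: "(\<lambda>p. X (fst p) (snd p)) \<in> borel_measurable (lborel \<Otimes>\<^sub>M M)"
proof -
  have "(\<lambda>p. p) \<in> measurable (lborel \<Otimes>\<^sub>M M) (borel \<Otimes>\<^sub>M F 0)"
    using measurable_F_M[of 0 "\<lambda>x. x" "F 0"]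
    by (subst measurable_pair_iff) (auto intro: measurable_compose[OF measurable_snd])
  from measurable_compose[OF this X_measurable] show ?thesis .
qed

lemma nn_integral_cum: "w \<in> space M \<Longrightarrow> (\<integral>\<^sup>+s. ennreal (X s w) * indicator {a..b} s \<partial>lborel) = ennreal (cum a b w)"
proof -
  assume w: "w \<in> space M"
  have "(\<integral>\<^sup>+s. ennreal (X s w) * indicator {a..b} s \<partial>lborel)
    = (\<integral>\<^sup>+s. ennreal (indicator {a..b} s *\<^sub>R X s w) \<partial>lborel)"
    by (intro nn_integral_cong) (auto simp: indicator_def)
  also have "\<dots> = ennreal (cum a b w)"
    unfolding set_lebesgue_integral_def
    using X_integrable[OF w, of a b] X_nonneg
    by (intro nn_integral_eq_integral) (auto simp: set_integrable_def)
  finally show ?thesis .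
qed

lemma jump_char':
  assumes "0 \<le> r" "r \<le> t" "A \<in> sets (F r)"
  shows "(\<integral>w. indicator A w *\<^sub>R iexp (u * real (card (jumps r t w))) \<partial>M)
      = (\<integral>w. indicator A w *\<^sub>R exp ((iexp u - 1) * of_real (cum r t w)) \<partial>M)"
  using jump_char[OF assms] by (simp add: jumps_def)

lemma
  assumes rt: "0 \<le> r" "r \<le> t" and A: "A \<in> sets (F r)"
  shows nn_integral_card_jumps: "(\<integral>\<^sup>+w. indicator A w * ennreal (real (card (jumps r t w))) \<partial>M)
      = (\<integral>\<^sup>+w. indicator A w * ennreal (cum r t w) \<partial>M)"
    and nn_integral_power_jumps: "0 \<le> K \<Longrightarrow> (\<integral>\<^sup>+w. indicator A w * ennreal (K ^ card (jumps r t w)) \<partial>M)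
      = (\<integral>\<^sup>+w. indicator A w * ennreal (exp ((K - 1) * cum r t w)) \<partial>M)"
proof -
  have m: "(\<lambda>w. card (jumps r t w)) \<in> measurable M (count_space UNIV)"
    "(\<lambda>w. cum r t w) \<in> borel_measurable M"
    using rt by (auto intro: measurable_F_M[of t] measurable_F_M[of 0] card_jumps_measurable cum_measurable)
  show "(\<integral>\<^sup>+w. indicator A w * ennreal (real (card (jumps r t w))) \<partial>M)
      = (\<integral>\<^sup>+w. indicator A w * ennreal (cum r t w) \<partial>M)"
    by (rule nn_integral_mixed_poisson_mean[OF m cum_nonneg sets_F_M[OF rt(1) A] jump_char'[OF rt A]])
  show "(\<integral>\<^sup>+w. indicator A w * ennreal (K ^ card (jumps r t w)) \<partial>M)
      = (\<integral>\<^sup>+w. indicator A w * ennreal (exp ((K - 1) * cum r t w)) \<partial>M)" if "0 \<le> K"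
    by (rule nn_integral_mixed_poisson_exponential[OF m cum_nonneg sets_F_M[OF rt(1) A] jump_char'[OF rt A] that])
qed

text \<open>Time ranges over all reals. By \<open>max 0 a\<close>, a rectangle that starts at a
  negative time carries an event of \<open>F 0\<close>; hence \<open>UNIV \<times> A\<close> is
  predictable for \<open>A\<close> in \<open>F 0\<close>, and \<open>F 0\<close>-measurable
  processes are predictable without cutting the time axis at 0.\<close>

definition predictable_rectangles :: "(real \<times> 'a) set set" where
  "predictable_rectangles = {{a<..b} \<times> A | a b A. A \<in> sets (F (max 0 a))}"

definition predictable :: "(real \<times> 'a) measure" where
  "predictable = sigma (UNIV \<times> space M) predictable_rectangles"

lemma predictable_rectangles_subset: "predictable_rectangles \<subseteq> Pow (UNIV \<times> space M)"
proof -
  have "A \<subseteq> space M" if "A \<in> sets (F (max 0 a))" for A a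
    using sets.sets_into_space[OF that] by simp
  then show ?thesis by (fastforce simp: predictable_rectangles_def)
qed

lemma sets_predictable: "sets predictable = sigma_sets (UNIV \<times> space M) predictable_rectangles"
  unfolding predictable_def using predictable_rectangles_subset by simp

lemma space_predictable[simp]: "space predictable = UNIV \<times> space M"
  unfolding predictable_def using predictable_rectangles_subset by (simp add: space_measure_of)

lemma rectangle_predictable: "A \<in> sets (F (max 0 a)) \<Longrightarrow> {a<..b} \<times> A \<in> sets predictable"
  unfolding sets_predictable predictable_rectangles_def by (intro sigma_sets.Basic) auto

lemma half_line_predictable:
  assumes "A \<in> sets (F c)" "0 \<le> c" shows "{c<..} \<times> A \<in> sets predictable"
proof -
  have "{c<..} \<times> A = (\<Union>n::nat. {c<..c + real n} \<times> A)"
  proof (safe, goal_cases)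
    case (1 x y)
    then show ?case by (intro UN_I[of "nat \<lceil>x - c\<rceil>"]) (auto simp: le_nat_iff of_nat_ceiling, linarith)
  qed auto
  also have "\<dots> \<in> sets predictable"
    using assms by (intro sets.countable_UN) (auto intro!: rectangle_predictable)
  finally show ?thesis .
qed

lemma F0_predictable:
  assumes "A \<in> sets (F 0)" shows "UNIV \<times> A \<in> sets predictable"
proof -
  have "UNIV \<times> A = (\<Union>n::nat. {- real n<..real n} \<times> A)"
  proof (safe, goal_cases)
    case (1 x y)
    obtain n where "\<bar>x\<bar> < real n" using reals_Archimedean2 by blast
    with 1 show ?case by (intro UN_I[of n]) auto
  qed auto
  also have "\<dots> \<in> sets predictable"
    using assms by (intro sets.countable_UN) (auto intro!: rectangle_predictable)
  finally show ?thesis .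
qed

lemma fst_predictable[measurable]: "fst \<in> borel_measurable predictable"
proof (rule borel_measurableI_greater)
  fix c :: real
  have "{p \<in> space predictable. c < fst p} = (\<Union>n::nat. {c<..c + real n} \<times> space M)"
  proof (safe, goal_cases)
    case (1 x y)
    then show ?case by (intro UN_I[of "nat \<lceil>x - c\<rceil>"]) (auto, linarith)
  qed auto
  also have "\<dots> \<in> sets predictable"
    using sets.top[of "F (max 0 c)"] by (intro sets.countable_UN) (auto intro!: rectangle_predictable)
  finally show "{p \<in> space predictable. c < fst p} \<in> sets predictable" .
qed

lemma snd_predictable[measurable]: "snd \<in> measurable predictable (F 0)"
proof (rule measurableI)
  fix A assume A: "A \<in> sets (F 0)"
  have "A \<subseteq> space M" using sets.sets_into_space[OF A] by simp
  then have "snd -` A \<inter> space predictable = UNIV \<times> A" by auto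
  then show "snd -` A \<inter> space predictable \<in> sets predictable" using F0_predictable[OF A] by simp
qed auto

text \<open>Switched on strictly after \<open>r\<close>, an \<open>F r\<close>-measurable variable
  becomes a predictable process. This is how a test variable \<open>C\<close> enters the
  compensation formula.\<close>

lemma F_predictable:
  fixes C :: "'a \<Rightarrow> 'b::{real_normed_vector, second_countable_topology}"
  assumes C: "C \<in> borel_measurable (F r)" and r: "0 \<le> r"
  shows "(\<lambda>p. if r < fst p then C (snd p) else 0) \<in> borel_measurable predictable"
proof (rule borel_measurableI)
  fix S :: "'b set" assume "open S"
  then have "C -` S \<inter> space M \<in> sets (F r)" using measurable_sets[OF C, of S] r by simp
  then have 1: "{r<..} \<times> (C -` S \<inter> space M) \<in> sets predictable" by (rule half_line_predictable[OF _ r])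
  have 2: "{p \<in> space predictable. \<not> r < fst p} \<in> sets predictable" by measurable
  have "(\<lambda>p. if r < fst p then C (snd p) else 0) -` S \<inter> space predictable
    = {r<..} \<times> (C -` S \<inter> space M) \<union> (if 0 \<in> S then {p \<in> space predictable. \<not> r < fst p} else {})"
    by (auto split: if_splits)
  also have "\<dots> \<in> sets predictable" using 1 2 by auto
  finally show "(\<lambda>p. if r < fst p then C (snd p) else 0) -` S \<inter> space predictable \<in> sets predictable" .
qed

text \<open>A jump strictly before the current time has already been observed at some rational time
  \<open>q\<close> in between. The strict inequality leaves room for \<open>q\<close>.\<close>

lemma jump_before_predictable:
  assumes "0 \<le> c"
  shows "{p \<in> space predictable. c < \<tau> n (snd p) \<and> \<tau> n (snd p) < fst p} \<in> sets predictable"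
proof -
  have "{p \<in> space predictable. c < \<tau> n (snd p) \<and> \<tau> n (snd p) < fst p}
     = (\<Union>q\<in>\<rat> \<inter> {c..}. {q<..} \<times> {w \<in> space M. c < \<tau> n w \<and> \<tau> n w \<le> q})"
  proof (safe, goal_cases)
    case (1 x y)
    then obtain q where "q \<in> \<rat>" "\<tau> n y < q" "q < x" using Rats_dense_in_real by auto
    with 1 show ?case by (intro UN_I[of q]) auto
  qed auto
  also have "\<dots> \<in> sets predictable"
  proof (rule sets.countable_UN'')
    show "countable (\<rat> \<inter> {c..})" by (intro countable_Int1 countable_rat)
    show "{q<..} \<times> {w \<in> space M. c < \<tau> n w \<and> \<tau> n w \<le> q} \<in> sets predictable" if "q \<in> \<rat> \<inter> {c..}" for q
      using that assms by (intro half_line_predictable jump_event) auto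
  qed
  finally show ?thesis .
qed

lemma jump_value_predictable:
  "(\<lambda>p. if 0 < \<tau> n (snd p) \<and> \<tau> n (snd p) < fst p then \<tau> n (snd p) else 0) \<in> borel_measurable predictable"
proof (rule borel_measurableI_greater)
  fix c :: real
  have "{p \<in> space predictable. c < (if 0 < \<tau> n (snd p) \<and> \<tau> n (snd p) < fst p then \<tau> n (snd p) else 0)}
    = (if c < 0 then space predictable else {p \<in> space predictable. c < \<tau> n (snd p) \<and> \<tau> n (snd p) < fst p})"
    by auto
  also have "\<dots> \<in> sets predictable"
    using jump_before_predictable[of c n] sets.top[of predictable] by auto
  finally show "{p \<in> space predictable. c < (if 0 < \<tau> n (snd p) \<and> \<tau> n (snd p) < fst p then \<tau> n (snd p) else 0)}
    \<in> sets predictable" .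
qed

text \<open>Once the jump has passed, its time is known and may be substituted into
  \<open>g\<close>; before that, the default 0 is substituted and the result discarded in favour of
  \<open>d\<close>. With \<open>d = 1\<close> these are the factors of the product over past
  jumps.\<close>

lemma F0_jump_predictable:
  fixes g :: "real \<Rightarrow> 'a \<Rightarrow> 'b::{real_normed_vector, second_countable_topology}"
  assumes g: "(\<lambda>p. g (fst p) (snd p)) \<in> borel_measurable (borel \<Otimes>\<^sub>M F 0)" and r: "0 \<le> r"
  shows "(\<lambda>p. if r < \<tau> n (snd p) \<and> \<tau> n (snd p) < fst p then g (\<tau> n (snd p)) (snd p) else d)
    \<in> borel_measurable predictable"
proof -
  note [measurable] = jump_value_predictable[of n] jump_before_predictable[OF r, of n]
  have "(\<lambda>p. (if 0 < \<tau> n (snd p) \<and> \<tau> n (snd p) < fst p then \<tau> n (snd p) else 0, snd p))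
    \<in> measurable predictable (borel \<Otimes>\<^sub>M F 0)"
    by measurable
  from measurable_compose[OF this g]
  have [measurable]: "(\<lambda>p. g (if 0 < \<tau> n (snd p) \<and> \<tau> n (snd p) < fst p then \<tau> n (snd p) else 0) (snd p))
    \<in> borel_measurable predictable" by simp
  have "(\<lambda>p. if r < \<tau> n (snd p) \<and> \<tau> n (snd p) < fst p
     then g (if 0 < \<tau> n (snd p) \<and> \<tau> n (snd p) < fst p then \<tau> n (snd p) else 0) (snd p) else d)
    \<in> borel_measurable predictable"
    by (rule measurable_If) measurable
  also have "(\<lambda>p. if r < \<tau> n (snd p) \<and> \<tau> n (snd p) < fst p
     then g (if 0 < \<tau> n (snd p) \<and> \<tau> n (snd p) < fst p then \<tau> n (snd p) else 0) (snd p) else d)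
    = (\<lambda>p. if r < \<tau> n (snd p) \<and> \<tau> n (snd p) < fst p then g (\<tau> n (snd p)) (snd p) else d)"
    using r by (auto simp: fun_eq_iff)
  finally show ?thesis .
qed

lemma F0_process_predictable:
  assumes g: "(\<lambda>p. g (fst p) (snd p)) \<in> borel_measurable (borel \<Otimes>\<^sub>M F 0)"
  shows "(\<lambda>p. g (fst p) (snd p)) \<in> borel_measurable predictable"
proof -
  have "(\<lambda>p. (fst p, snd p)) \<in> measurable predictable (borel \<Otimes>\<^sub>M F 0)" by measurable
  from measurable_compose[OF this g] show ?thesis by simp
qed

subsection \<open>Compensation formula\<close>

text \<open>This and the next measure are the Doleans measures of the jumps in \<open>(0,t]\<close>
  and of their compensator, restricted to the predictable sigma-algebra. Their equality is the
  compensation formula.\<close>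

definition jump_measure :: "real \<Rightarrow> (real \<times> 'a) measure" where
  "jump_measure t = distr (density (count_space UNIV \<Otimes>\<^sub>M M)
     (\<lambda>p. if 0 < \<tau> (fst p) (snd p) \<and> \<tau> (fst p) (snd p) \<le> t then 1 else 0))
     predictable (\<lambda>p. (\<tau> (fst p) (snd p), snd p))"

definition intensity_measure :: "real \<Rightarrow> (real \<times> 'a) measure" where
  "intensity_measure t = distr (density (lborel \<Otimes>\<^sub>M M)
     (\<lambda>p. ennreal (indicator {0<..t} (fst p) * X (fst p) (snd p)))) predictable (\<lambda>p. p)"

lemma sets_jump_measure[simp]: "sets (jump_measure t) = sets predictable"
  and sets_intensity_measure[simp]: "sets (intensity_measure t) = sets predictable"
  by (simp_all add: jump_measure_def intensity_measure_def)

lemma jump_pair_measurable[measurable]: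
  "(\<lambda>p. \<tau> (fst p) (snd p)) \<in> borel_measurable (count_space UNIV \<Otimes>\<^sub>M M)"
  by (rule measurable_pair_measure_countable1) auto

text \<open>The predictable sigma-algebra is contained in the product of the Borel sets of time with
  \<open>M\<close>, so measurability of the two coordinates suffices.\<close>

lemma measurable_into_predictable:
  assumes f: "f \<in> borel_measurable K" and g: "g \<in> measurable K M"
  shows "(\<lambda>x. (f x, g x)) \<in> measurable K predictable"
  unfolding predictable_def
proof (rule measurable_measure_of[OF predictable_rectangles_subset])
  show "(\<lambda>x. (f x, g x)) \<in> space K \<rightarrow> UNIV \<times> space M"
    using measurable_space[OF g] by auto
  fix R assume "R \<in> predictable_rectangles"
  then obtain a b A where R: "R = {a<..b} \<times> A" "A \<in> sets (F (max 0 a))"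
    by (auto simp: predictable_rectangles_def)
  have A[measurable]: "A \<in> sets M" using R(2) by (intro sets_F_M[of "max 0 a"]) auto
  have "(\<lambda>x. (f x, g x)) -` R \<inter> space K = (f -` {a<..b} \<inter> space K) \<inter> (g -` A \<inter> space K)"
    by (auto simp: R)
  also have "\<dots> \<in> sets K" using measurable_sets[OF f, of "{a<..b}"] measurable_sets[OF g A] by auto
  finally show "(\<lambda>x. (f x, g x)) -` R \<inter> space K \<in> sets K" .
qed

lemma jump_map_measurable[measurable]:
  "(\<lambda>p. (\<tau> (fst p) (snd p), snd p)) \<in> measurable (count_space UNIV \<Otimes>\<^sub>M M) predictable"
  by (rule measurable_into_predictable) measurable

lemma identity_predictable_measurable[measurable]: "(\<lambda>p. p) \<in> measurable (lborel \<Otimes>\<^sub>M M) predictable"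
  using measurable_into_predictable[of fst "lborel \<Otimes>\<^sub>M M" snd] by simp

lemma nn_integral_jump_measure:
  assumes [measurable]: "H \<in> borel_measurable predictable"
  shows "(\<integral>\<^sup>+p. H p \<partial>jump_measure t) = (\<integral>\<^sup>+w. (\<Sum>n\<in>jumps 0 t w. H (\<tau> n w, w)) \<partial>M)"
proof -
  interpret C: sigma_finite_measure "count_space (UNIV :: nat set)"
    by (rule sigma_finite_measure_count_space_countable) auto
  interpret P: pair_sigma_finite "count_space (UNIV :: nat set)" M ..
  have "(\<integral>\<^sup>+p. H p \<partial>jump_measure t)
    = (\<integral>\<^sup>+p. (if 0 < \<tau> (fst p) (snd p) \<and> \<tau> (fst p) (snd p) \<le> t then 1 else 0) * H (\<tau> (fst p) (snd p), snd p)
        \<partial>(count_space UNIV \<Otimes>\<^sub>M M))"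
    unfolding jump_measure_def by (simp add: nn_integral_distr nn_integral_density)
  also have "\<dots> = (\<integral>\<^sup>+w. \<integral>\<^sup>+n. (if 0 < \<tau> n w \<and> \<tau> n w \<le> t then 1 else 0) * H (\<tau> n w, w)
        \<partial>count_space UNIV \<partial>M)"
    by (subst P.nn_integral_snd[symmetric]) simp_all
  also have "\<dots> = (\<integral>\<^sup>+w. (\<Sum>n\<in>jumps 0 t w. H (\<tau> n w, w)) \<partial>M)"
  proof (intro nn_integral_cong)
    fix w assume w: "w \<in> space M"
    have "(\<Sum>n. (if 0 < \<tau> n w \<and> \<tau> n w \<le> t then 1 else 0) * H (\<tau> n w, w))
      = (\<Sum>n\<in>jumps 0 t w. (if 0 < \<tau> n w \<and> \<tau> n w \<le> t then 1 else 0) * H (\<tau> n w, w))"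
      using finite_jumps[OF order_refl w, of t] by (intro suminf_finite) (auto simp: jumps_def)
    then show "(\<integral>\<^sup>+n. (if 0 < \<tau> n w \<and> \<tau> n w \<le> t then 1 else 0) * H (\<tau> n w, w) \<partial>count_space UNIV)
      = (\<Sum>n\<in>jumps 0 t w. H (\<tau> n w, w))"
      by (simp add: nn_integral_count_space_nat jumps_def)
  qed
  finally show ?thesis .
qed

lemma nn_integral_intensity_measure:
  assumes [measurable]: "H \<in> borel_measurable predictable"
  shows "(\<integral>\<^sup>+p. H p \<partial>intensity_measure t)
    = (\<integral>\<^sup>+w. \<integral>\<^sup>+s. ennreal (indicator {0<..t} s * X s w) * H (s, w) \<partial>lborel \<partial>M)"
proof -
  interpret P: pair_sigma_finite lborel M ..
  have "(\<integral>\<^sup>+p. H p \<partial>intensity_measure t)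
    = (\<integral>\<^sup>+p. ennreal (indicator {0<..t} (fst p) * X (fst p) (snd p)) * H p \<partial>(lborel \<Otimes>\<^sub>M M))"
    unfolding intensity_measure_def by (simp add: nn_integral_distr nn_integral_density)
  also have "\<dots> = (\<integral>\<^sup>+w. \<integral>\<^sup>+s. ennreal (indicator {0<..t} s * X s w) * H (s, w) \<partial>lborel \<partial>M)"
    by (subst P.nn_integral_snd[symmetric]) simp_all
  finally show ?thesis .
qed

lemma cum_mono:
  assumes "w \<in> space M" "a' \<le> a" "b \<le> b'" shows "cum a b w \<le> cum a' b' w"
  unfolding set_lebesgue_integral_def
  using X_integrable[OF assms(1)] X_nonneg assms
  by (intro integral_mono) (auto simp: set_integrable_def indicator_def)

text \<open>\<open>a'\<close> and \<open>b'\<close> clip the rectangle to \<open>(0,t]\<close>; when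
  nothing is left, \<open>a' = b'\<close> and both masses are 0. Since \<open>A\<close> lies in
  \<open>F a'\<close>, the mean of a mixed Poisson increment over \<open>(a',b']\<close> can be
  tested on \<open>A\<close>.\<close>

lemma emeasure_jump_eq_intensity:
  fixes a b t :: real
  assumes t: "0 \<le> t" and A: "A \<in> sets (F (max 0 a))"
  defines "a' \<equiv> max 0 a" and "b' \<equiv> max (max 0 a) (min b t)"
  shows "emeasure (jump_measure t) ({a<..b} \<times> A) = (\<integral>\<^sup>+w. indicator A w * ennreal (cum a' b' w) \<partial>M)"
    and "emeasure (intensity_measure t) ({a<..b} \<times> A) = (\<integral>\<^sup>+w. indicator A w * ennreal (cum a' b' w) \<partial>M)"
proof -
  have R: "{a<..b} \<times> A \<in> sets predictable" by (rule rectangle_predictable[OF A])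
  have ab: "0 \<le> a'" "a' \<le> b'" by (auto simp: a'_def b'_def)
  have "emeasure (jump_measure t) ({a<..b} \<times> A)
    = (\<integral>\<^sup>+w. (\<Sum>n\<in>jumps 0 t w. indicator ({a<..b} \<times> A) (\<tau> n w, w)) \<partial>M)"
    using R by (subst nn_integral_jump_measure[symmetric]) auto
  also have "\<dots> = (\<integral>\<^sup>+w. indicator A w * ennreal (real (card (jumps a' b' w))) \<partial>M)"
  proof (intro nn_integral_cong)
    fix w assume w: "w \<in> space M"
    have "(\<Sum>n\<in>jumps 0 t w. indicator ({a<..b} \<times> A) (\<tau> n w, w) :: ennreal)
      = (\<Sum>n\<in>jumps 0 t w. if n \<in> jumps a' b' w then indicator A w else 0)"
      by (intro sum.cong) (auto simp: jumps_def a'_def b'_def indicator_def)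
    also have "\<dots> = (\<Sum>n\<in>jumps 0 t w \<inter> jumps a' b' w. indicator A w)"
      using finite_jumps[OF order_refl w] by (subst sum.inter_restrict) auto
    also have "jumps 0 t w \<inter> jumps a' b' w = jumps a' b' w"
      using t by (auto simp: jumps_def a'_def b'_def max_def min_def split: if_splits)
    finally show "(\<Sum>n\<in>jumps 0 t w. indicator ({a<..b} \<times> A) (\<tau> n w, w) :: ennreal)
      = indicator A w * ennreal (real (card (jumps a' b' w)))"
      by (simp add: ennreal_of_nat_eq_real_of_nat mult.commute)
  qed
  also have "\<dots> = (\<integral>\<^sup>+w. indicator A w * ennreal (cum a' b' w) \<partial>M)"
    using A by (intro nn_integral_card_jumps ab) (simp add: a'_def)
  finally show "emeasure (jump_measure t) ({a<..b} \<times> A) = (\<integral>\<^sup>+w. indicator A w * ennreal (cum a' b' w) \<partial>M)" .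
  have "emeasure (intensity_measure t) ({a<..b} \<times> A)
    = (\<integral>\<^sup>+w. \<integral>\<^sup>+s. ennreal (indicator {0<..t} s * X s w) * indicator ({a<..b} \<times> A) (s, w) \<partial>lborel \<partial>M)"
    using R by (subst nn_integral_intensity_measure[symmetric]) auto
  also have "\<dots> = (\<integral>\<^sup>+w. indicator A w * ennreal (cum a' b' w) \<partial>M)"
  proof (intro nn_integral_cong)
    fix w assume w: "w \<in> space M"
    have "(\<integral>\<^sup>+s. ennreal (indicator {0<..t} s * X s w) * indicator ({a<..b} \<times> A) (s, w) \<partial>lborel)
      = (\<integral>\<^sup>+s. indicator A w * (ennreal (X s w) * indicator {a'..b'} s) \<partial>lborel)"
    proof (intro nn_integral_cong_AE)
      show "AE s in lborel. ennreal (indicator {0<..t} s * X s w) * indicator ({a<..b} \<times> A) (s, w)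
        = indicator A w * (ennreal (X s w) * indicator {a'..b'} s)"
        using AE_lborel_singleton[of a']
      proof eventually_elim
        case (elim s)
        have "s \<in> {0<..t} \<and> s \<in> {a<..b} \<longleftrightarrow> s \<in> {a'..b'}"
          using elim by (auto simp: a'_def b'_def max_def min_def split: if_splits)
        then show ?case by (auto simp: indicator_def)
      qed
    qed
    also have "\<dots> = indicator A w * ennreal (cum a' b' w)"
      using w by (subst nn_integral_cmult) (auto simp: nn_integral_cum)
    finally show "(\<integral>\<^sup>+s. ennreal (indicator {0<..t} s * X s w) * indicator ({a<..b} \<times> A) (s, w) \<partial>lborel)
      = indicator A w * ennreal (cum a' b' w)" .
  qed
  finally show "emeasure (intensity_measure t) ({a<..b} \<times> A) = (\<integral>\<^sup>+w. indicator A w * ennreal (cum a' b' w) \<partial>M)" .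
qed

text \<open>Two measures that agree on an intersection-stable generator are equal if the generator
  contains an exhausting sequence of finite mass. As \<open>cum 0 t\<close> may have infinite mean,
  the sequence uses the events \<open>cum 0 t w \<le> real i\<close> of \<open>F 0\<close>, on which
  the mass is at most \<open>i\<close>.\<close>

theorem jump_measure_eq_intensity_measure:
  assumes t: "0 \<le> t"
  shows "jump_measure t = intensity_measure t"
proof (rule measure_eqI_generator_eq[where E = predictable_rectangles and \<Omega> = "UNIV \<times> space M"
      and A = "\<lambda>i. {- real i<..real i} \<times> {w \<in> space M. cum 0 t w \<le> real i}"])
  show "Int_stable predictable_rectangles"
  proof (rule Int_stableI)
    fix R R' assume "R \<in> predictable_rectangles" "R' \<in> predictable_rectangles"
    then obtain a b A a' b' A' where R: "R = {a<..b} \<times> A" "A \<in> sets (F (max 0 a))"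
      "R' = {a'<..b'} \<times> A'" "A' \<in> sets (F (max 0 a'))"
      by (auto simp: predictable_rectangles_def)
    have "A \<in> sets (F (max 0 (max a a')))" "A' \<in> sets (F (max 0 (max a a')))"
    proof -
      have "max 0 a \<le> max 0 (max a a')" "max 0 a' \<le> max 0 (max a a')" by auto
      then show "A \<in> sets (F (max 0 (max a a')))" "A' \<in> sets (F (max 0 (max a a')))"
        using R sets_mono by (meson max.cobounded1 subsetD)+
    qed
    moreover have "R \<inter> R' = {max a a'<..min b b'} \<times> (A \<inter> A')" using R by auto
    ultimately show "R \<inter> R' \<in> predictable_rectangles"
      unfolding predictable_rectangles_def by blast
  qed
  show "emeasure (jump_measure t) R = emeasure (intensity_measure t) R" if "R \<in> predictable_rectangles" for R
    using that emeasure_jump_eq_intensity[OF t] by (auto simp: predictable_rectangles_def)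
  have cumm: "{w \<in> space M. cum 0 t w \<le> real i} \<in> sets (F 0)" for i
    using borel_measurable_le[OF cum_measurable, of "\<lambda>_. real i" 0 t] by simp
  then show "range (\<lambda>i. {- real i<..real i} \<times> {w \<in> space M. cum 0 t w \<le> real i}) \<subseteq> predictable_rectangles"
  proof (intro image_subsetI)
    fix i
    show "{- real i<..real i} \<times> {w \<in> space M. cum 0 t w \<le> real i} \<in> predictable_rectangles"
      unfolding predictable_rectangles_def using cumm[of i]
      by (intro CollectI exI[of _ "- real i"] exI[of _ "real i"] exI[of _ "{w \<in> space M. cum 0 t w \<le> real i}"])
        auto
  qed
  show "(\<Union>i::nat. {- real i<..real i} \<times> {w \<in> space M. cum 0 t w \<le> real i}) = UNIV \<times> space M"
  proof -
    have "\<exists>i::nat. - real i < x \<and> x \<le> real i \<and> cum 0 t w \<le> real i" for x w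
    proof -
      obtain i where "max \<bar>x\<bar> (cum 0 t w) < real i" using reals_Archimedean2 by blast
      then show ?thesis by (intro exI[of _ i]) auto
    qed
    then show ?thesis by auto
  qed
  show "emeasure (jump_measure t) ({- real i<..real i} \<times> {w \<in> space M. cum 0 t w \<le> real i}) \<noteq> \<infinity>" for i
  proof -
    let ?A = "{w \<in> space M. cum 0 t w \<le> real i}"
    have "emeasure (jump_measure t) ({- real i<..real i} \<times> ?A)
       = (\<integral>\<^sup>+w. indicator ?A w * ennreal (cum 0 (max 0 (min (real i) t)) w) \<partial>M)"
      using emeasure_jump_eq_intensity(1)[OF t, of ?A "- real i" "real i"] cumm[of i] by simp
    also have "\<dots> \<le> (\<integral>\<^sup>+w. ennreal (real i) \<partial>M)"
    proof (intro nn_integral_mono)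
      fix w assume w: "w \<in> space M"
      have "cum 0 (max 0 (min (real i) t)) w \<le> cum 0 t w"
        using t by (intro cum_mono[OF w]) auto
      then show "indicator ?A w * ennreal (cum 0 (max 0 (min (real i) t)) w) \<le> ennreal (real i)"
        by (auto simp: indicator_def intro: ennreal_leI)
    qed
    also have "\<dots> < \<infinity>" by (simp add: emeasure_space_1)
    finally show ?thesis by simp
  qed
qed (use predictable_rectangles_subset in \<open>simp_all add: sets_predictable\<close>)

text \<open>Integrability is checked under the intensity measure, where it is an ordinary Lebesgue
  integral, and the equality of the two measures carries it to the jumps. Fubini then writes both
  integrals path by path.\<close>

theorem compensation_formula:
  fixes H :: "real \<times> 'a \<Rightarrow> 'b::{banach, second_countable_topology}"
  assumes t: "0 \<le> t" and H[measurable]: "H \<in> borel_measurable predictable"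
    and fin: "(\<integral>\<^sup>+w. \<integral>\<^sup>+s. ennreal (indicator {0<..t} s * X s w) * ennreal (norm (H (s, w))) \<partial>lborel \<partial>M) < \<infinity>"
  shows "integrable M (\<lambda>w. \<Sum>n\<in>jumps 0 t w. H (\<tau> n w, w))"
    and "integrable M (\<lambda>w. LBINT s:{0<..t}. X s w *\<^sub>R H (s, w))"
    and "(\<integral>w. (\<Sum>n\<in>jumps 0 t w. H (\<tau> n w, w)) \<partial>M) = (\<integral>w. (LBINT s:{0<..t}. X s w *\<^sub>R H (s, w)) \<partial>M)"
proof -
  interpret C: sigma_finite_measure "count_space (UNIV :: nat set)"
    by (rule sigma_finite_measure_count_space_countable) auto
  interpret PJ: pair_sigma_finite "count_space (UNIV :: nat set)" M ..
  interpret PI: pair_sigma_finite lborel M ..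
  have int: "integrable (intensity_measure t) H"
    unfolding integrable_iff_bounded
    using fin H by (subst nn_integral_intensity_measure) (auto cong: measurable_cong_sets)
  then have intj: "integrable (jump_measure t) H"
    by (simp add: jump_measure_eq_intensity_measure[OF t])
  let ?hi = "\<lambda>p. (indicator {0<..t} (fst p) * X (fst p) (snd p)) *\<^sub>R H p"
  have Hm[measurable]: "H \<in> borel_measurable (lborel \<Otimes>\<^sub>M M)"
    using measurable_compose[OF identity_predictable_measurable H] by simp
  have 1: "integrable (lborel \<Otimes>\<^sub>M M) ?hi"
    using int X_nonneg unfolding intensity_measure_def
    by (subst integrable_density[symmetric]) (auto simp: integrable_distr_eq)
  have 2: "(\<integral>p. H p \<partial>intensity_measure t) = (\<integral>p. ?hi p \<partial>(lborel \<Otimes>\<^sub>M M))"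
    unfolding intensity_measure_def using X_nonneg
    by (simp add: integral_distr integral_density)
  have eqi: "(\<integral>s. ?hi (s, w) \<partial>lborel) = (LBINT s:{0<..t}. X s w *\<^sub>R H (s, w))" for w
    by (simp add: set_lebesgue_integral_def)
  show "integrable M (\<lambda>w. LBINT s:{0<..t}. X s w *\<^sub>R H (s, w))"
    using PI.integrable_snd[of "\<lambda>s w. ?hi (s, w)"] 1 eqi by (simp add: case_prod_unfold)
  have I: "(\<integral>p. H p \<partial>intensity_measure t) = (\<integral>w. (LBINT s:{0<..t}. X s w *\<^sub>R H (s, w)) \<partial>M)"
    unfolding 2 using PI.integral_snd[of "\<lambda>s w. ?hi (s, w)"] 1 eqi by (simp add: case_prod_unfold)
  let ?w = "\<lambda>p. if 0 < \<tau> (fst p) (snd p) \<and> \<tau> (fst p) (snd p) \<le> t then 1 else 0 :: real"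
  let ?hj = "\<lambda>p. ?w p *\<^sub>R H (\<tau> (fst p) (snd p), snd p)"
  \<comment> \<open>The weight is rewritten as a real function, the form in which a density enters a
    Bochner integral.\<close>
  have jm: "jump_measure t = distr (density (count_space UNIV \<Otimes>\<^sub>M M) (\<lambda>p. ennreal (?w p)))
     predictable (\<lambda>p. (\<tau> (fst p) (snd p), snd p))"
    unfolding jump_measure_def by (intro arg_cong2[where f = "\<lambda>d. distr d predictable"] arg_cong2[where f = density]) auto
  have 3: "integrable (count_space UNIV \<Otimes>\<^sub>M M) ?hj"
    using intj unfolding jm
    by (subst integrable_density[symmetric]) (auto simp: integrable_distr_eq)
  have 4: "(\<integral>p. H p \<partial>jump_measure t) = (\<integral>p. ?hj p \<partial>(count_space UNIV \<Otimes>\<^sub>M M))"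
    unfolding jm by (simp add: integral_distr integral_density)
  have eqj: "(\<integral>n. ?hj (n, w) \<partial>count_space UNIV) = (\<Sum>n\<in>jumps 0 t w. H (\<tau> n w, w))"
    if w: "w \<in> space M" for w
  proof -
    have "(\<integral>n. ?hj (n, w) \<partial>count_space UNIV) = (\<Sum>n\<in>{n\<in>UNIV. ?hj (n, w) \<noteq> 0}. ?hj (n, w))"
      using finite_jumps[OF order_refl w, of t]
      by (intro lebesgue_integral_count_space_finite_support) (auto simp: jumps_def elim!: finite_subset[rotated])
    also have "\<dots> = (\<Sum>n\<in>jumps 0 t w. ?hj (n, w))"
      using finite_jumps[OF order_refl w, of t]
      by (intro sum.mono_neutral_left) (auto simp: jumps_def split: if_splits)
    finally show ?thesis by (simp add: jumps_def)
  qed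
  show "integrable M (\<lambda>w. \<Sum>n\<in>jumps 0 t w. H (\<tau> n w, w))"
  proof (subst Bochner_Integration.integrable_cong[OF refl eqj[symmetric]])
    show "integrable M (\<lambda>w. \<integral>n. ?hj (n, w) \<partial>count_space UNIV)"
      using PJ.integrable_snd[of "\<lambda>n w. ?hj (n, w)"] 3 by (simp add: case_prod_unfold)
  qed
  have "(\<integral>p. H p \<partial>jump_measure t) = (\<integral>w. (\<Sum>n\<in>jumps 0 t w. H (\<tau> n w, w)) \<partial>M)"
  proof (subst Bochner_Integration.integral_cong[OF refl eqj[symmetric]])
    show "(\<integral>p. H p \<partial>jump_measure t) = (\<integral>w. \<integral>n. ?hj (n, w) \<partial>count_space UNIV \<partial>M)"
      unfolding 4 using PJ.integral_snd[of "\<lambda>n w. ?hj (n, w)"] 3 by (simp add: case_prod_unfold)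
  qed
  then show "(\<integral>w. (\<Sum>n\<in>jumps 0 t w. H (\<tau> n w, w)) \<partial>M) = (\<integral>w. (LBINT s:{0<..t}. X s w *\<^sub>R H (s, w)) \<partial>M)"
    using I by (simp add: jump_measure_eq_intensity_measure[OF t])
qed

subsection \<open>Exponential means\<close>

definition jump_prod :: "(real \<Rightarrow> 'a \<Rightarrow> 'b::comm_monoid_mult) \<Rightarrow> real \<Rightarrow> real \<Rightarrow> 'a \<Rightarrow> 'b" where
  "jump_prod g a b w = (\<Prod>n\<in>jumps a b w. g (\<tau> n w) w)"

text \<open>The adapted counterpart of the predictable version: at time \<open>t\<close> a jump at
  \<open>t\<close> itself is known, hence \<open>\<le>\<close> in place of \<open><\<close>.\<close>

lemma F0_jump_measurable:
  assumes g: "(\<lambda>p. g (fst p) (snd p)) \<in> borel_measurable (borel \<Otimes>\<^sub>M F 0)" and r: "0 \<le> r" "r \<le> t"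
  shows "(\<lambda>w. if r < \<tau> n w \<and> \<tau> n w \<le> t then g (\<tau> n w) w else (d::'b::{real_normed_vector, second_countable_topology}))
    \<in> borel_measurable (F t)"
proof -
  have t: "0 \<le> t" using r by simp
  have val: "(\<lambda>w. if r < \<tau> n w \<and> \<tau> n w \<le> t then \<tau> n w else 0) \<in> borel_measurable (F t)"
  proof (rule borel_measurableI_greater)
    fix c :: real
    have "{w \<in> space (F t). c < (if r < \<tau> n w \<and> \<tau> n w \<le> t then \<tau> n w else 0)}
      = (if c < 0 then space (F t) else if max c r \<le> t then {w \<in> space M. max c r < \<tau> n w \<and> \<tau> n w \<le> t} else {})"
      using r t by auto
    also have "\<dots> \<in> sets (F t)"
      using jump_event[of "max c r" t n] r sets.top[of "F t"] by auto
    finally show "{w \<in> space (F t). c < (if r < \<tau> n w \<and> \<tau> n w \<le> t then \<tau> n w else 0)} \<in> sets (F t)" .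
  qed
  have id: "(\<lambda>w. w) \<in> measurable (F t) (F 0)"
    using measurable_F_mono[of 0 t "\<lambda>w. w" "F 0"] t by simp
  have "(\<lambda>w. (if r < \<tau> n w \<and> \<tau> n w \<le> t then \<tau> n w else 0, w)) \<in> measurable (F t) (borel \<Otimes>\<^sub>M F 0)"
    using val id by (rule measurable_Pair)
  from measurable_compose[OF this g]
  have [measurable]: "(\<lambda>w. g (if r < \<tau> n w \<and> \<tau> n w \<le> t then \<tau> n w else 0) w) \<in> borel_measurable (F t)" by simp
  have [measurable]: "{w \<in> space (F t). r < \<tau> n w \<and> \<tau> n w \<le> t} \<in> sets (F t)"
    using jump_event[OF r] t by simp
  have "(\<lambda>w. if r < \<tau> n w \<and> \<tau> n w \<le> t then g (if r < \<tau> n w \<and> \<tau> n w \<le> t then \<tau> n w else 0) w else d)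
    \<in> borel_measurable (F t)"
    by (rule measurable_If) measurable
  also have "(\<lambda>w. if r < \<tau> n w \<and> \<tau> n w \<le> t then g (if r < \<tau> n w \<and> \<tau> n w \<le> t then \<tau> n w else 0) w else d)
    = (\<lambda>w. if r < \<tau> n w \<and> \<tau> n w \<le> t then g (\<tau> n w) w else d)" by auto
  finally show ?thesis .
qed

text \<open>The index set of the jumps is random. Products over the deterministic ranges
  \<open>n < k\<close>, with factor 1 where there is no jump, are measurable and eventually constant
  in \<open>k\<close>.\<close>

lemma prod_lessThan_tendsto:
  fixes h :: "nat \<Rightarrow> 'b::{comm_monoid_mult, topological_space}"
  assumes "finite {n. P n}"
  shows "(\<lambda>k. \<Prod>n<k. if P n then h n else 1) \<longlonglongrightarrow> (\<Prod>n\<in>{n. P n}. h n)"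
proof (rule tendsto_eventually)
  obtain k0 where k0: "\<And>n. P n \<Longrightarrow> n < k0" using assms finite_nat_set_iff_bounded by auto
  show "\<forall>\<^sub>F k in sequentially. (\<Prod>n<k. if P n then h n else 1) = (\<Prod>n\<in>{n. P n}. h n)"
    using eventually_ge_at_top[of k0]
  proof eventually_elim
    case (elim k)
    have "{n. P n} = {n \<in> {..<k}. P n}" using elim k0 by (auto intro: less_le_trans)
    then show ?case using prod.inter_filter[of "{..<k}" h P] by simp
  qed
qed

lemma jump_prod_measurable:
  fixes g :: "real \<Rightarrow> 'a \<Rightarrow> 'b::{real_normed_field, second_countable_topology}"
  assumes g: "(\<lambda>p. g (fst p) (snd p)) \<in> borel_measurable (borel \<Otimes>\<^sub>M F 0)" and r: "0 \<le> r" "r \<le> t"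
  shows "jump_prod g r t \<in> borel_measurable (F t)"
proof (rule borel_measurable_LIMSEQ_metric)
  show "(\<lambda>w. \<Prod>n<k. if r < \<tau> n w \<and> \<tau> n w \<le> t then g (\<tau> n w) w else 1) \<in> borel_measurable (F t)" for k
    by (intro borel_measurable_prod F0_jump_measurable[OF g r])
  show "(\<lambda>k. \<Prod>n<k. if r < \<tau> n w \<and> \<tau> n w \<le> t then g (\<tau> n w) w else 1) \<longlonglongrightarrow> jump_prod g r t w"
    if "w \<in> space (F t)" for w
    unfolding jump_prod_def jumps_def
    using that r finite_jumps[of r w t] by (intro prod_lessThan_tendsto) (auto simp: jumps_def)
qed

lemma F0_section:
  assumes g: "(\<lambda>p. g (fst p) (snd p)) \<in> borel_measurable (borel \<Otimes>\<^sub>M F 0)" and w: "w \<in> space M"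
  shows "(\<lambda>s. g s w) \<in> borel_measurable borel"
  using measurable_compose[OF measurable_Pair2'[of w "F 0" borel] g] w by simp

lemma compensated_measurable:
  fixes g :: "real \<Rightarrow> 'a \<Rightarrow> 'b::{real_normed_field, second_countable_topology}"
  assumes g: "(\<lambda>p. g (fst p) (snd p)) \<in> borel_measurable (borel \<Otimes>\<^sub>M F 0)"
  shows "(\<lambda>p. (g (fst p) (snd p) - 1) * of_real (X (fst p) (snd p))) \<in> borel_measurable (borel \<Otimes>\<^sub>M F 0)"
  using g X_measurable
  by (intro borel_measurable_times borel_measurable_diff borel_measurable_of_real) auto

text \<open>The exponent for which \<open>exp (drift g a b)\<close> is the conditional mean of
  \<open>jump_prod g a b\<close> given \<open>F a\<close>, as the exponential means below show. The
  type is generic because a real and a complex version are both in use.\<close>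

definition drift :: "(real \<Rightarrow> 'a \<Rightarrow> 'b::{banach, real_normed_field, second_countable_topology}) \<Rightarrow> real \<Rightarrow> real \<Rightarrow> 'a \<Rightarrow> 'b" where
  "drift g a b w = (LBINT s:{a..b}. (g s w - 1) * of_real (X s w))"

lemma drift_measurable:
  assumes g: "(\<lambda>p. g (fst p) (snd p)) \<in> borel_measurable (borel \<Otimes>\<^sub>M F 0)"
  shows "drift g a b \<in> borel_measurable (F 0)"
  unfolding drift_def[abs_def]
  by (rule borel_measurable_LBINT_section[OF compensated_measurable[OF g]]) auto

lemma set_integrable_compensated:
  fixes g :: "real \<Rightarrow> 'a \<Rightarrow> 'b::{banach, real_normed_field, second_countable_topology}"
  assumes g: "(\<lambda>p. g (fst p) (snd p)) \<in> borel_measurable (borel \<Otimes>\<^sub>M F 0)" and w: "w \<in> space M"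
    and i: "set_integrable lborel {a..b} (\<lambda>s. norm (g s w) * X s w)"
  shows "set_integrable lborel {a..b} (\<lambda>s. (g s w - 1) * of_real (X s w))"
proof -
  have s: "set_integrable lborel {a..b} (\<lambda>s. norm (g s w) * X s w + X s w)"
    using i X_integrable[OF w] by (rule set_integral_add)
  note [measurable] = F0_section[OF compensated_measurable[OF g] w]
  show ?thesis
  proof (rule set_integrable_bound[OF s])
    show "set_borel_measurable lborel {a..b} (\<lambda>s. (g s w - 1) * of_real (X s w))"
      unfolding set_borel_measurable_def by measurable
    show "AE s in lborel. s \<in> {a..b} \<longrightarrow> norm ((g s w - 1) * of_real (X s w)) \<le> norm (norm (g s w) * X s w + X s w)"
    proof (intro AE_I2 impI)
      fix s
      have "norm ((g s w - 1) * of_real (X s w)) = norm (g s w - 1) * X s w"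
        using X_nonneg[of s w] by (simp add: norm_mult)
      also have "\<dots> \<le> (norm (g s w) + 1) * X s w"
        using norm_triangle_ineq4[of "g s w" 1] X_nonneg[of s w] by (intro mult_right_mono) auto
      also have "\<dots> \<le> norm (norm (g s w) * X s w + X s w)" by (simp add: algebra_simps)
      finally show "norm ((g s w - 1) * of_real (X s w)) \<le> norm (norm (g s w) * X s w + X s w)" .
    qed
  qed
qed

lemma bounded_weight_integrable:
  assumes g: "(\<lambda>p. g (fst p) (snd p)) \<in> borel_measurable (borel \<Otimes>\<^sub>M F 0)" and w: "w \<in> space M"
    and K: "\<And>s. norm (g s w :: 'b::{banach, real_normed_field, second_countable_topology}) \<le> K"
  shows "set_integrable lborel {a..b} (\<lambda>s. norm (g s w) * X s w)"
proof -
  note [measurable] = F0_section[OF g w] X_section[OF w]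
  have s: "set_integrable lborel {a..b} (\<lambda>s. K * X s w)"
    using X_integrable[OF w] by simp
  show ?thesis
  proof (rule set_integrable_bound[OF s])
    show "set_borel_measurable lborel {a..b} (\<lambda>s. norm (g s w) * X s w)"
      unfolding set_borel_measurable_def by measurable
    show "AE s in lborel. s \<in> {a..b} \<longrightarrow> norm (norm (g s w) * X s w) \<le> norm (K * X s w)"
      using K X_nonneg by (intro AE_I2 impI) (auto simp: abs_mult intro!: mult_right_mono order_trans[OF K])
  qed
qed

lemma norm_drift_le:
  assumes g: "(\<lambda>p. g (fst p) (snd p)) \<in> borel_measurable (borel \<Otimes>\<^sub>M F 0)" and w: "w \<in> space M"
    and K: "\<And>s. norm (g s w :: 'b::{banach, real_normed_field, second_countable_topology}) \<le> K"
  shows "norm (drift g a b w) \<le> (K + 1) * cum a b w"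
proof -
  note i = set_integrable_compensated[OF g w bounded_weight_integrable[OF g w K]]
  have "norm (drift g a b w) \<le> (LBINT s:{a..b}. norm ((g s w - 1) * of_real (X s w)))"
    unfolding drift_def by (rule set_integral_norm_bound[OF i])
  also have "\<dots> \<le> (LBINT s:{a..b}. (K + 1) * X s w)"
  proof (rule set_integral_mono)
    show "norm ((g s w - 1) * of_real (X s w)) \<le> (K + 1) * X s w" for s
      using norm_triangle_ineq4[of "g s w" 1] X_nonneg[of s w] K[of s]
      by (auto simp: norm_mult intro!: mult_right_mono)
  qed (use i X_integrable[OF w] in \<open>auto intro: set_integrable_norm\<close>)
  finally show ?thesis by simp
qed

text \<open>
  With \<open>Z\<^sub>s = exp (- drift g r s) * jump_prod g r s\<close>, the compensation formula is applied to
  \<open>C Z\<^bsub>s-\<^esub> (g\<^sub>s - 1)\<close>. Pathwise, the jump sum minus the Lebesgue integral telescopes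
  to \<open>C (Z\<^sub>t - 1)\<close>.
\<close>

lemma bounded_exponential_mean:
  fixes g :: "real \<Rightarrow> 'a \<Rightarrow> complex" and C :: "'a \<Rightarrow> complex"
  assumes rt: "0 \<le> r" "r \<le> t"
    and g: "(\<lambda>p. g (fst p) (snd p)) \<in> borel_measurable (borel \<Otimes>\<^sub>M F 0)"
    and K: "\<And>s w. norm (g s w) \<le> K" "1 \<le> K"
    and C: "C \<in> borel_measurable (F r)"
    and c: "\<And>w. norm (C w) \<le> c"
    and m: "\<And>w. w \<in> space M \<Longrightarrow> C w \<noteq> 0 \<Longrightarrow> cum 0 t w \<le> m"
  shows "integrable M (\<lambda>w. C w * exp (- drift g r t w) * jump_prod g r t w)"
    and "(\<integral>w. C w * exp (- drift g r t w) * jump_prod g r t w \<partial>M) = (\<integral>w. C w \<partial>M)"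
proof -
  have t: "0 \<le> t" using rt by simp
  \<comment> \<open>The jump factor of the left limit of \<open>Z\<close>: the jump at the current
    time is excluded, which makes \<open>W\<close> predictable.\<close>
  define W where "W p = (\<Prod>n\<in>{n. r < \<tau> n (snd p) \<and> \<tau> n (snd p) < fst p}. g (\<tau> n (snd p)) (snd p))"
    for p :: "real \<times> 'a"
  define H where "H p = (if r < fst p then C (snd p) else 0) *
    (exp (- drift g r (fst p) (snd p)) * W p * (g (fst p) (snd p) - 1))" for p
  have finW: "finite {n. r < \<tau> n w \<and> \<tau> n w < s}" if "w \<in> space M" for s w
    using finite_jumps[OF rt(1) that, of s] by (auto simp: jumps_def elim: finite_subset[rotated])
  have W_m[measurable]: "W \<in> borel_measurable predictable"
  proof (rule borel_measurable_LIMSEQ_metric)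
    show "(\<lambda>p. \<Prod>n<k. if r < \<tau> n (snd p) \<and> \<tau> n (snd p) < fst p then g (\<tau> n (snd p)) (snd p) else 1)
      \<in> borel_measurable predictable" for k
      by (intro borel_measurable_prod F0_jump_predictable[OF g rt(1)])
    show "(\<lambda>k. \<Prod>n<k. if r < \<tau> n (snd p) \<and> \<tau> n (snd p) < fst p then g (\<tau> n (snd p)) (snd p) else 1)
      \<longlonglongrightarrow> W p" if "p \<in> space predictable" for p
      unfolding W_def using that finW by (intro prod_lessThan_tendsto) auto
  qed
  have D_m[measurable]: "(\<lambda>p. drift g r (fst p) (snd p)) \<in> borel_measurable predictable"
    unfolding drift_def by (rule borel_measurable_LBINT_section[OF compensated_measurable[OF g]]) auto
  note [measurable] = F_predictable[OF C rt(1)] F0_process_predictable[OF g]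
  have H_m[measurable]: "H \<in> borel_measurable predictable" unfolding H_def by measurable
  define B where "B = {w \<in> space M. cum 0 t w \<le> m}"
  have B0: "B \<in> sets (F 0)"
    using borel_measurable_le[OF cum_measurable, of "\<lambda>_. m" 0 t] by (simp add: B_def)
  then have Br: "B \<in> sets (F r)" using sets_mono[of 0 r] rt by auto
  have BM: "B \<in> sets M" using sets_F_M[OF _ B0] by simp
  \<comment> \<open>\<open>\<bar>c\<bar>\<close> bounds \<open>C\<close>,
    \<open>exp ((K + 1) * \<bar>m\<bar>)\<close> the compensating exponential, and the last
    \<open>K + 1\<close> the factor \<open>g - 1\<close>. Absolute values are taken because
    \<open>c\<close> and \<open>m\<close> may be negative when \<open>C\<close> vanishes or the
    event is empty.\<close>
  define b where "b = \<bar>c\<bar> * exp ((K + 1) * \<bar>m\<bar>) * (K + 1)"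
  have b0: "0 \<le> b" using K by (auto simp: b_def)
  have H_le: "norm (H (s, w)) \<le> indicator B w * (b * K ^ card (jumps r t w))"
    if w: "w \<in> space M" and s: "s \<le> t" for s w
  proof (cases "r < s \<and> C w \<noteq> 0")
    case False
    then show ?thesis using b0 K by (auto simp: H_def)
  next
    case True
    have "norm (drift g r s w) \<le> (K + 1) * cum r s w" by (rule norm_drift_le[OF g w K(1)])
    also have "\<dots> \<le> (K + 1) * \<bar>m\<bar>"
      using cum_mono[OF w rt(1) s] m[OF w] True K by (intro mult_left_mono) auto
    finally have 1: "norm (exp (- drift g r s w)) \<le> exp ((K + 1) * \<bar>m\<bar>)"
      using abs_Re_le_cmod[of "drift g r s w"] by simp
    have "norm (W (s, w)) \<le> (\<Prod>n\<in>{n. r < \<tau> n w \<and> \<tau> n w < s}. K)"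
      unfolding W_def by (simp only: prod_norm[symmetric] fst_conv snd_conv) (intro prod_mono, use K in auto)
    also have "\<dots> \<le> K ^ card (jumps r t w)"
      using K s finite_jumps[OF rt(1) w, of t]
      by (auto simp: jumps_def intro!: power_increasing card_mono)
    finally have 2: "norm (W (s, w)) \<le> K ^ card (jumps r t w)" .
    have 3: "norm (g s w - 1) \<le> K + 1"
      using norm_triangle_ineq4[of "g s w" 1] K(1)[of s w] by auto
    have "norm (H (s, w)) = norm (C w) * (norm (exp (- drift g r s w)) * norm (W (s, w)) * norm (g s w - 1))"
      using True by (simp add: H_def norm_mult del: norm_exp_eq_Re)
    also have "\<dots> \<le> \<bar>c\<bar> * (exp ((K + 1) * \<bar>m\<bar>) * K ^ card (jumps r t w) * (K + 1))"
      using 1 2 3 K c[of w] by (intro mult_mono mult_nonneg_nonneg) (auto simp del: norm_exp_eq_Re)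
    also have "\<dots> = indicator B w * (b * K ^ card (jumps r t w))"
      using w m[OF w] True by (simp add: B_def b_def)
    finally show ?thesis .
  qed
  \<comment> \<open>The factor \<open>K ^ card\<close> is unbounded, but its mean on
    \<open>B\<close> is that of \<open>exp ((K - 1) * cum r t)\<close> by the generating function,
    and \<open>cum\<close> is at most \<open>m\<close> on \<open>B\<close>. That \<open>B\<close>
    belongs to \<open>F r\<close> is essential here.\<close>
  have fin: "(\<integral>\<^sup>+w. \<integral>\<^sup>+s. ennreal (indicator {0<..t} s * X s w) * ennreal (norm (H (s, w))) \<partial>lborel \<partial>M) < \<infinity>"
  proof -
    have "(\<integral>\<^sup>+w. \<integral>\<^sup>+s. ennreal (indicator {0<..t} s * X s w) * ennreal (norm (H (s, w))) \<partial>lborel \<partial>M)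
      \<le> (\<integral>\<^sup>+w. ennreal (b * \<bar>m\<bar>) * (indicator B w * ennreal (K ^ card (jumps r t w))) \<partial>M)"
    proof (rule nn_integral_mono)
      fix w assume w: "w \<in> space M"
      let ?d = "indicator B w * (b * K ^ card (jumps r t w))"
      have d0: "0 \<le> ?d" using b0 K by simp
      have "(\<integral>\<^sup>+s. ennreal (indicator {0<..t} s * X s w) * ennreal (norm (H (s, w))) \<partial>lborel)
        \<le> (\<integral>\<^sup>+s. ennreal ?d * (ennreal (X s w) * indicator {0..t} s) \<partial>lborel)"
      proof (rule nn_integral_mono)
        fix s
        show "ennreal (indicator {0<..t} s * X s w) * ennreal (norm (H (s, w)))
          \<le> ennreal ?d * (ennreal (X s w) * indicator {0..t} s)"
        proof (cases "s \<in> {0<..t}")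
          case True
          then have "X s w * norm (H (s, w)) \<le> ?d * X s w"
            using H_le[OF w, of s] X_nonneg[of s w] by (subst mult.commute, intro mult_right_mono) auto
          moreover have "indicator {0<..t} s = (1 :: real)" "indicator {0..t} s = (1 :: ennreal)"
            using True by auto
          ultimately show ?thesis using X_nonneg[of s w] d0
            by (simp only: ennreal_mult[symmetric] ennreal_leI mult_1 mult_1_right norm_ge_zero)
        qed (auto simp: indicator_def)
      qed
      also have "\<dots> = ennreal ?d * ennreal (cum 0 t w)"
        using w by (subst nn_integral_cmult) (auto simp: nn_integral_cum)
      also have "\<dots> \<le> ennreal (b * \<bar>m\<bar>) * (indicator B w * ennreal (K ^ card (jumps r t w)))"
      proof (cases "w \<in> B")
        case True
        then have "cum 0 t w \<le> \<bar>m\<bar>" by (auto simp: B_def)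
        then have "ennreal (b * K ^ card (jumps r t w) * cum 0 t w) \<le> ennreal (b * K ^ card (jumps r t w) * \<bar>m\<bar>)"
          using b0 K by (intro ennreal_leI mult_left_mono) auto
        with True show ?thesis
          using b0 K cum_nonneg[of 0 t w] by (simp add: ennreal_mult[symmetric] mult_ac)
      qed simp
      finally show "(\<integral>\<^sup>+s. ennreal (indicator {0<..t} s * X s w) * ennreal (norm (H (s, w))) \<partial>lborel)
         \<le> ennreal (b * \<bar>m\<bar>) * (indicator B w * ennreal (K ^ card (jumps r t w)))" .
    qed
    also have "\<dots> = ennreal (b * \<bar>m\<bar>) * (\<integral>\<^sup>+w. indicator B w * ennreal (K ^ card (jumps r t w)) \<partial>M)"
    proof (rule nn_integral_cmult)
      have [measurable]: "(\<lambda>w. card (jumps r t w)) \<in> measurable M (count_space UNIV)"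
        using measurable_F_M[OF t card_jumps_measurable[OF rt]] .
      show "(\<lambda>w. indicator B w * ennreal (K ^ card (jumps r t w))) \<in> borel_measurable M"
        using BM by measurable
    qed
    also have "(\<integral>\<^sup>+w. indicator B w * ennreal (K ^ card (jumps r t w)) \<partial>M)
      = (\<integral>\<^sup>+w. indicator B w * ennreal (exp ((K - 1) * cum r t w)) \<partial>M)"
      using K by (intro nn_integral_power_jumps rt Br) auto
    also have "\<dots> \<le> (\<integral>\<^sup>+w. ennreal (exp ((K - 1) * \<bar>m\<bar>)) \<partial>M)"
    proof (rule nn_integral_mono)
      fix w assume w: "w \<in> space M"
      show "indicator B w * ennreal (exp ((K - 1) * cum r t w)) \<le> ennreal (exp ((K - 1) * \<bar>m\<bar>))"
        using K cum_mono[OF w rt(1) order_refl, of t]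
        by (auto simp: indicator_def B_def intro!: ennreal_leI mult_left_mono)
    qed
    also have "ennreal (b * \<bar>m\<bar>) * \<dots> < \<infinity>" by (simp add: emeasure_space_1 ennreal_mult_less_top)
    finally show ?thesis by (simp add: mult_left_mono)
  qed
  note comp = compensation_formula[OF t H_m fin]
  have path: "(\<Sum>n\<in>jumps 0 t w. H (\<tau> n w, w)) - (LBINT s:{0<..t}. X s w *\<^sub>R H (s, w))
     = C w * exp (- drift g r t w) * jump_prod g r t w - C w" if w: "w \<in> space M" for w
  proof -
    let ?I = "jumps r t w"
    let ?P = "\<lambda>s. \<Prod>j\<in>{j\<in>?I. \<tau> j w < s}. g (\<tau> j w) w" and ?\<gamma> = "\<lambda>s. (g s w - 1) * of_real (X s w)"
    note i = set_integrable_compensated[OF g w bounded_weight_integrable[OF g w K(1)]]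
    have eq: "(\<Sum>n\<in>?I. exp (- drift g r (\<tau> n w) w) * ?P (\<tau> n w) * (g (\<tau> n w) w - 1))
      - (LBINT s:{r..t}. exp (- drift g r s w) * ?P s * ?\<gamma> s)
      = exp (- drift g r t w) * (\<Prod>j\<in>?I. g (\<tau> j w) w) - 1"
    proof (rule jump_exponential_equation[OF rt(2) i])
      show "drift g r y w - drift g r x w = (LBINT u:{x..y}. ?\<gamma> u)" if "r \<le> x" "x \<le> y" "y \<le> t" for x y
        using LBINT_Icc_combine[OF i that(1,2)] by (simp add: drift_def)
      show "drift g r r w = 0"
        by (simp add: drift_def set_lebesgue_integral_def)
         (rule integral_eq_zero_AE, use AE_lborel_singleton[of r] in eventually_elim, simp)
      show "finite ?I" "inj_on (\<lambda>n. \<tau> n w) ?I" using finite_jumps inj_on_jumps rt w by auto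
    qed (auto simp: jumps_def)
    have Weq: "?P s = W (s, w)" if "s \<le> t" for s
      unfolding W_def using that by (intro prod.cong) (auto simp: jumps_def)
    have "(\<Sum>n\<in>jumps 0 t w. H (\<tau> n w, w)) = (\<Sum>n\<in>?I. H (\<tau> n w, w))"
      using finite_jumps[OF order_refl w, of t] rt
      by (intro sum.mono_neutral_right) (auto simp: jumps_def H_def)
    also have "\<dots> = C w * (\<Sum>n\<in>?I. exp (- drift g r (\<tau> n w) w) * ?P (\<tau> n w) * (g (\<tau> n w) w - 1))"
      unfolding sum_distrib_left
    proof (intro sum.cong refl)
      fix n assume "n \<in> ?I"
      then have "r < \<tau> n w" "\<tau> n w \<le> t" by (auto simp: jumps_def)
      then show "H (\<tau> n w, w) = C w * (exp (- drift g r (\<tau> n w) w)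
        * ?P (\<tau> n w) * (g (\<tau> n w) w - 1))"
        by (simp add: H_def Weq)
    qed
    finally have 1: "(\<Sum>n\<in>jumps 0 t w. H (\<tau> n w, w)) = C w * (\<Sum>n\<in>?I. exp (- drift g r (\<tau> n w) w) * ?P (\<tau> n w) * (g (\<tau> n w) w - 1))" .
    have "(LBINT s:{0<..t}. X s w *\<^sub>R H (s, w))
      = (LBINT s:{r..t}. C w * (exp (- drift g r s w) * ?P s * ?\<gamma> s))"
      unfolding set_lebesgue_integral_def
    proof (rule integral_cong_AE)
      have [measurable]: "(\<lambda>s. H (s, w)) \<in> borel_measurable lborel"
      proof -
        have "(\<lambda>s. (s, w)) \<in> measurable lborel predictable"
          using w by (intro measurable_into_predictable) auto
        from measurable_compose[OF this H_m] show ?thesis .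
      qed
      note [measurable] = X_section[OF w]
      show m1: "(\<lambda>s. indicator {0<..t} s *\<^sub>R X s w *\<^sub>R H (s, w)) \<in> borel_measurable lborel" by measurable
      \<comment> \<open>\<open>H\<close> vanishes at \<open>s = r\<close>, whereas the integrand on
        \<open>{r..t}\<close> may not; measurability of the latter follows from that of
        \<open>H\<close> after repairing this single value.\<close>
      have "(\<lambda>s. (if s \<in> {r<..t} then 1 else 0) *\<^sub>R X s w *\<^sub>R H (s, w) +
        (if s = r then indicator {r..t} r *\<^sub>R (C w * (exp (- drift g r r w) * ?P r * ?\<gamma> r)) else 0))
        \<in> borel_measurable lborel" by measurable
      also have "(\<lambda>s. (if s \<in> {r<..t} then 1 else 0) *\<^sub>R X s w *\<^sub>R H (s, w) +
        (if s = r then indicator {r..t} r *\<^sub>R (C w * (exp (- drift g r r w) * ?P r * ?\<gamma> r)) else 0))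
        = (\<lambda>s. indicator {r..t} s *\<^sub>R (C w * (exp (- drift g r s w) * ?P s * ?\<gamma> s)))"
        using rt by (auto simp: fun_eq_iff indicator_def H_def Weq scaleR_conv_of_real)
      finally show "(\<lambda>s. indicator {r..t} s *\<^sub>R (C w * (exp (- drift g r s w) * ?P s * ?\<gamma> s)))
        \<in> borel_measurable lborel" .
      show "AE s in lborel. indicator {0<..t} s *\<^sub>R X s w *\<^sub>R H (s, w)
        = indicator {r..t} s *\<^sub>R (C w * (exp (- drift g r s w) * ?P s * ?\<gamma> s))"
        using AE_lborel_singleton[of r]
        by eventually_elim (use rt in \<open>auto simp: indicator_def H_def Weq scaleR_conv_of_real\<close>)
    qed
    also have "\<dots> = C w * (LBINT s:{r..t}. exp (- drift g r s w) * ?P s * ?\<gamma> s)"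
      by (rule set_integral_mult_right)
    finally show ?thesis
      unfolding 1 jump_prod_def by (simp only: right_diff_distrib[symmetric] eq) (simp add: algebra_simps)
  qed
  have CM: "C \<in> borel_measurable M" using measurable_F_M[OF rt(1) C] .
  have Ci: "integrable M C" using c by (intro integrable_const_bound[OF _ CM]) auto
  let ?Z = "\<lambda>w. C w * exp (- drift g r t w) * jump_prod g r t w"
  have "integrable M (\<lambda>w. (\<Sum>n\<in>jumps 0 t w. H (\<tau> n w, w)) - (LBINT s:{0<..t}. X s w *\<^sub>R H (s, w)))"
    using comp by (intro Bochner_Integration.integrable_diff)
  then have d: "integrable M (\<lambda>w. ?Z w - C w)"
    by (subst (asm) Bochner_Integration.integrable_cong[OF refl path])
  from Bochner_Integration.integrable_add[OF this Ci] show Z: "integrable M ?Z" by simp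
  have "0 = (\<integral>w. (\<Sum>n\<in>jumps 0 t w. H (\<tau> n w, w)) - (LBINT s:{0<..t}. X s w *\<^sub>R H (s, w)) \<partial>M)"
    using comp by (subst Bochner_Integration.integral_diff) auto
  also have "\<dots> = (\<integral>w. ?Z w - C w \<partial>M)"
    by (rule Bochner_Integration.integral_cong[OF refl path])
  also have "\<dots> = (\<integral>w. ?Z w \<partial>M) - (\<integral>w. C w \<partial>M)"
    by (rule Bochner_Integration.integral_diff[OF Z Ci])
  finally show "(\<integral>w. ?Z w \<partial>M) = (\<integral>w. C w \<partial>M)" by simp
qed

end

section \<open>Passage to unbounded weights by truncation\<close>

lemma nn_integral_eq_SUP_of_tendsto:
  fixes f :: "nat \<Rightarrow> 'a \<Rightarrow> ennreal"
  assumes m: "\<And>i. f i \<in> borel_measurable M"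
    and mono: "\<And>i x. x \<in> space M \<Longrightarrow> f i x \<le> f (Suc i) x"
    and lim: "\<And>x. x \<in> space M \<Longrightarrow> (\<lambda>i. f i x) \<longlonglongrightarrow> u x"
  shows "(\<integral>\<^sup>+x. u x \<partial>M) = (SUP i. \<integral>\<^sup>+x. f i x \<partial>M)"
proof -
  have "u x = (SUP i. f i x)" if "x \<in> space M" for x
  proof -
    have "incseq (\<lambda>i. f i x)" using mono[OF that] by (intro incseq_SucI)
    from LIMSEQ_unique[OF lim[OF that] LIMSEQ_SUP[OF this]] show ?thesis .
  qed
  then have "(\<integral>\<^sup>+x. u x \<partial>M) = (\<integral>\<^sup>+x. (SUP i. f i x) \<partial>M)" by (intro nn_integral_cong)
  also have "\<dots> = (SUP i. \<integral>\<^sup>+x. f i x \<partial>M)"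
    using mono by (intro nn_integral_monotone_convergence_SUP_AE m AE_I2)
  finally show ?thesis .
qed

text \<open>Large values are replaced by 0 and not by the bound: for complex numbers this involves
  no choice of phase, it never increases the norm, and it is exact for all large
  \<open>m\<close>.\<close>

definition truncate :: "nat \<Rightarrow> 'b::real_normed_vector \<Rightarrow> 'b" where
  "truncate m z = (if norm z \<le> real m then z else 0)"

lemma norm_truncate_le: "norm (truncate m z) \<le> real m" "norm (truncate m z) \<le> norm z"
  by (auto simp: truncate_def)

lemma truncate_eventually: "\<forall>\<^sub>F m in sequentially. truncate m z = z"
proof -
  obtain k where "norm z \<le> real k" using real_arch_simple by blast
  then show ?thesis
    by (auto simp: truncate_def eventually_sequentially intro!: exI[of _ k])
qed

lemma truncate_mono: "0 \<le> x \<Longrightarrow> m \<le> n \<Longrightarrow> truncate m x \<le> truncate n (x :: real)"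
  by (auto simp: truncate_def)

lemma truncate_nonneg: "0 \<le> x \<Longrightarrow> 0 \<le> truncate m (x :: real)"
  by (auto simp: truncate_def)

lemma truncate_of_real: "truncate m (of_real x :: complex) = of_real (truncate m x)"
  by (auto simp: truncate_def)

lemma truncate_measurable[measurable]:
  "truncate m \<in> borel_measurable (borel :: 'b::{real_normed_vector, second_countable_topology} measure)"
  unfolding truncate_def[abs_def] by measurable

context conditional_poisson_jumps
begin

text \<open>Besides bounding \<open>C\<close>, this sets it to 0 off the event
  \<open>cum 0 t w \<le> real m\<close>, which supplies the support condition of the bounded case.
  The event is in \<open>F 0\<close>, so \<open>F r\<close>-measurability survives.\<close>

definition truncate_at :: "real \<Rightarrow> nat \<Rightarrow> ('a \<Rightarrow> 'b::real_normed_vector) \<Rightarrow> 'a \<Rightarrow> 'b" where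
  "truncate_at t m C w = (if w \<in> space M \<and> cum 0 t w \<le> real m then truncate m (C w) else 0)"

lemma truncate_at_eventually:
  assumes "w \<in> space M" shows "\<forall>\<^sub>F m in sequentially. truncate_at t m C w = C w"
proof -
  obtain k where k: "cum 0 t w \<le> real k" using real_arch_simple by blast
  show ?thesis
    using truncate_eventually[of "C w"] eventually_ge_at_top[of k]
    by eventually_elim (use k assms in \<open>auto simp: truncate_at_def\<close>)
qed

lemma truncate_at_measurable:
  fixes C :: "'a \<Rightarrow> 'b::{real_normed_vector, second_countable_topology}"
  assumes "0 \<le> r" and [measurable]: "C \<in> borel_measurable (F r)"
  shows "truncate_at t m C \<in> borel_measurable (F r)"
proof -
  have [measurable]: "(\<lambda>w. cum 0 t w) \<in> borel_measurable (F r)"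
    using measurable_F_mono[OF _ assms(1) cum_measurable] by simp
  have "(\<lambda>w. if cum 0 t w \<le> real m then truncate m (C w) else 0) \<in> borel_measurable (F r)" by measurable
  then show ?thesis
    by (rule measurable_cong[THEN iffD1, rotated]) (use assms(1) in \<open>auto simp: truncate_at_def\<close>)
qed

lemma norm_truncate_at_le: "norm (truncate_at t m C w) \<le> real m" "norm (truncate_at t m C w) \<le> norm (C w)"
  using norm_truncate_le by (auto simp: truncate_at_def)

lemma truncate_process_measurable:
  fixes g :: "real \<Rightarrow> 'a \<Rightarrow> 'b::{real_normed_vector, second_countable_topology}"
  assumes "(\<lambda>p. g (fst p) (snd p)) \<in> borel_measurable (borel \<Otimes>\<^sub>M F 0)"
  shows "(\<lambda>p. truncate m (g (fst p) (snd p))) \<in> borel_measurable (borel \<Otimes>\<^sub>M F 0)"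
  using measurable_compose[OF assms truncate_measurable] .

lemma jump_prod_truncate_eventually:
  assumes "0 \<le> r" "w \<in> space M"
  shows "\<forall>\<^sub>F m in sequentially. jump_prod (\<lambda>s w. truncate m (g s w)) r t w
    = jump_prod (g :: real \<Rightarrow> 'a \<Rightarrow> 'b::real_normed_field) r t w"
proof -
  have "\<forall>\<^sub>F m in sequentially. \<forall>n\<in>jumps r t w. truncate m (g (\<tau> n w) w) = g (\<tau> n w) w"
    using finite_jumps[OF assms] by (intro eventually_ball_finite ballI truncate_eventually)
  then show ?thesis by eventually_elim (auto simp: jump_prod_def intro: prod.cong)
qed

lemma drift_truncate_tendsto:
  fixes g :: "real \<Rightarrow> 'a \<Rightarrow> 'b::{banach, real_normed_field, second_countable_topology}"
  assumes g: "(\<lambda>p. g (fst p) (snd p)) \<in> borel_measurable (borel \<Otimes>\<^sub>M F 0)" and w: "w \<in> space M"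
    and i: "set_integrable lborel {a..b} (\<lambda>s. norm (g s w) * X s w)"
  shows "(\<lambda>m. drift (\<lambda>s w. truncate m (g s w)) a b w) \<longlonglongrightarrow> drift g a b w"
  unfolding drift_def set_lebesgue_integral_def
proof (rule integral_dominated_convergence[where w = "\<lambda>s. indicator {a..b} s *\<^sub>R (norm (g s w) * X s w + X s w)"])
  note [measurable] = F0_section[OF g w] X_section[OF w]
  show "(\<lambda>s. indicator {a..b} s *\<^sub>R ((g s w - 1) * of_real (X s w))) \<in> borel_measurable lborel" by measurable
  show "(\<lambda>s. indicator {a..b} s *\<^sub>R ((truncate m (g s w) - 1) * of_real (X s w))) \<in> borel_measurable lborel" for m
    by measurable
  show "integrable lborel (\<lambda>s. indicator {a..b} s *\<^sub>R (norm (g s w) * X s w + X s w))"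
    using set_integral_add(1)[OF i X_integrable[OF w]] by (simp add: set_integrable_def)
  show "AE s in lborel. (\<lambda>m. indicator {a..b} s *\<^sub>R ((truncate m (g s w) - 1) * of_real (X s w)))
    \<longlonglongrightarrow> indicator {a..b} s *\<^sub>R ((g s w - 1) * of_real (X s w))"
  proof (rule AE_I2, rule tendsto_eventually)
    fix s
    show "\<forall>\<^sub>F m in sequentially. indicator {a..b} s *\<^sub>R ((truncate m (g s w) - 1) * of_real (X s w))
      = indicator {a..b} s *\<^sub>R ((g s w - 1) * of_real (X s w))"
      using truncate_eventually[of "g s w"] by eventually_elim simp
  qed
  show "AE s in lborel. norm (indicator {a..b} s *\<^sub>R ((truncate m (g s w) - 1) * of_real (X s w)))
    \<le> indicator {a..b} s *\<^sub>R (norm (g s w) * X s w + X s w)" for m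
  proof (rule AE_I2)
    fix s
    have "norm (truncate m (g s w) - 1) * X s w \<le> (norm (g s w) + 1) * X s w"
      using norm_triangle_ineq4[of "truncate m (g s w)" 1] norm_truncate_le(2)[of m "g s w"] X_nonneg[of s w]
      by (intro mult_right_mono) auto
    then show "norm (indicator {a..b} s *\<^sub>R ((truncate m (g s w) - 1) * of_real (X s w)))
      \<le> indicator {a..b} s *\<^sub>R (norm (g s w) * X s w + X s w)"
      using X_nonneg[of s w] by (auto simp: norm_mult indicator_def distrib_right)
  qed
qed

text \<open>The bounded case is applied to the weight
  \<open>truncate_at t m C w * exp (drift (gm m) r t w)\<close>. The drift is
  \<open>F 0\<close>-measurable, hence admissible as part of an \<open>F r\<close>-measurable
  weight, and it cancels the exponential inside \<open>Z\<close>.\<close>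

lemma truncated_mean:
  fixes g :: "real \<Rightarrow> 'a \<Rightarrow> complex" and C :: "'a \<Rightarrow> complex"
  assumes rt: "0 \<le> r" "r \<le> t" and g: "(\<lambda>p. g (fst p) (snd p)) \<in> borel_measurable (borel \<Otimes>\<^sub>M F 0)"
    and C: "C \<in> borel_measurable (F r)"
  defines "gm \<equiv> \<lambda>m s w. truncate m (g s w)"
  shows "integrable M (\<lambda>w. truncate_at t m C w * jump_prod (gm m) r t w)"
    and "integrable M (\<lambda>w. truncate_at t m C w * exp (drift (gm m) r t w))"
    and "(\<integral>w. truncate_at t m C w * jump_prod (gm m) r t w \<partial>M)
      = (\<integral>w. truncate_at t m C w * exp (drift (gm m) r t w) \<partial>M)"
proof -
  \<comment> \<open>The summand 1 is there because the bounded case asks for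
    \<open>1 \<le> K\<close>, also when \<open>m = 0\<close>.\<close>
  define K where "K = 1 + real m"
  have gm: "(\<lambda>p. gm m (fst p) (snd p)) \<in> borel_measurable (borel \<Otimes>\<^sub>M F 0)"
    unfolding gm_def by (rule truncate_process_measurable[OF g])
  have gK: "norm (gm m s w) \<le> K" "1 \<le> K" for s w
    using norm_truncate_le(1)[of m "g s w"] by (auto simp: gm_def K_def)
  let ?C = "\<lambda>w. truncate_at t m C w * exp (drift (gm m) r t w)"
  have Cm: "?C \<in> borel_measurable (F r)"
  proof -
    have [measurable]: "drift (gm m) r t \<in> borel_measurable (F r)" "truncate_at t m C \<in> borel_measurable (F r)"
      using measurable_F_mono[OF _ rt(1) drift_measurable[OF gm, of r t]] truncate_at_measurable[OF rt(1) C] by auto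
    show ?thesis by measurable
  qed
  have Cb: "norm (?C w) \<le> real m * exp ((K + 1) * real m)" for w
  proof (cases "w \<in> space M \<and> cum 0 t w \<le> real m")
    case True
    have "norm (drift (gm m) r t w) \<le> (K + 1) * cum r t w"
      using True by (intro norm_drift_le[OF gm _ gK(1)]) auto
    also have "\<dots> \<le> (K + 1) * real m"
      using True cum_mono[of w 0 r t t] rt gK(2) by (intro mult_left_mono) auto
    finally have "norm (exp (drift (gm m) r t w)) \<le> exp ((K + 1) * real m)"
      using abs_Re_le_cmod[of "drift (gm m) r t w"] by simp
    then show ?thesis
      unfolding norm_mult by (intro mult_mono norm_truncate_at_le) auto
  qed (auto simp: truncate_at_def)
  have Cs: "cum 0 t w \<le> real m" if "?C w \<noteq> 0" for w
    using that by (auto simp: truncate_at_def split: if_splits)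
  have eq: "?C w * exp (- drift (gm m) r t w) * jump_prod (gm m) r t w
    = truncate_at t m C w * jump_prod (gm m) r t w" for w
    by (simp add: exp_minus)
  note b = bounded_exponential_mean[OF rt gm gK Cm Cb Cs, unfolded eq]
  show "integrable M (\<lambda>w. truncate_at t m C w * jump_prod (gm m) r t w)" by (rule b(1))
  show "(\<integral>w. truncate_at t m C w * jump_prod (gm m) r t w \<partial>M) = (\<integral>w. ?C w \<partial>M)" by (rule b(2))
  show "integrable M ?C"
    using Cb measurable_F_M[OF rt(1) Cm] by (intro integrable_const_bound) auto
qed

context
  fixes r t :: real
  assumes rt: "0 \<le> r" "r \<le> t"
begin

text \<open>For non-negative \<open>g\<close> and \<open>C\<close> the truncations increase with
  \<open>m\<close>, and so do the jump product and the drift. Monotone convergence passes to the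
  limit on both sides, which may be infinite.\<close>

lemma nn_exponential_mean:
  fixes g :: "real \<Rightarrow> 'a \<Rightarrow> real" and C :: "'a \<Rightarrow> real"
  assumes g: "(\<lambda>p. g (fst p) (snd p)) \<in> borel_measurable (borel \<Otimes>\<^sub>M F 0)" and g0: "\<And>s w. 0 \<le> g s w"
    and i: "\<And>w. w \<in> space M \<Longrightarrow> set_integrable lborel {r..t} (\<lambda>s. g s w * X s w)"
    and C: "C \<in> borel_measurable (F r)" and C0: "\<And>w. 0 \<le> C w"
  shows "(\<integral>\<^sup>+w. ennreal (C w * jump_prod g r t w) \<partial>M) = (\<integral>\<^sup>+w. ennreal (C w * exp (drift g r t w)) \<partial>M)"
proof -
  define gm where "gm m s w = truncate m (g s w)" for m s w
  let ?C = "\<lambda>m. truncate_at t m C"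
  have gmm: "(\<lambda>p. gm m (fst p) (snd p)) \<in> borel_measurable (borel \<Otimes>\<^sub>M F 0)" for m
    unfolding gm_def by (rule truncate_process_measurable[OF g])
  have gm0: "0 \<le> gm m s w" for m s w unfolding gm_def by (intro truncate_nonneg g0)
  have gm_mono: "gm m s w \<le> gm (Suc m) s w" for m s w unfolding gm_def by (intro truncate_mono g0) simp
  have C_nonneg: "0 \<le> ?C m w" for m w using C0 by (auto simp: truncate_at_def truncate_nonneg)
  have C_mono: "?C m w \<le> ?C (Suc m) w" for m w
    using C0 by (auto simp: truncate_at_def intro: truncate_mono truncate_nonneg)
  have P_nonneg: "0 \<le> jump_prod (gm m) r t w" for m w unfolding jump_prod_def by (intro prod_nonneg gm0) 
  have P_mono: "jump_prod (gm m) r t w \<le> jump_prod (gm (Suc m)) r t w" for m w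
    unfolding jump_prod_def by (intro prod_mono) (auto simp: gm0 gm_mono)
  have gmi: "set_integrable lborel {r..t} (\<lambda>s. (gm m s w - 1) * X s w)" if w: "w \<in> space M" for m w
  proof -
    have "norm (gm m s w) \<le> real m" for s unfolding gm_def by (rule norm_truncate_le)
    from set_integrable_compensated[OF gmm w bounded_weight_integrable[OF gmm w this]] show ?thesis by simp
  qed
  have D_mono: "drift (gm m) r t w \<le> drift (gm (Suc m)) r t w" if w: "w \<in> space M" for m w
    unfolding drift_def using gm_mono X_nonneg gmi[OF w]
    by (intro set_integral_mono) (auto intro!: mult_right_mono)
  have PM: "jump_prod (gm m) r t \<in> borel_measurable M" for m
    using measurable_F_M[OF _ jump_prod_measurable[OF gmm rt]] rt by simp
  have DM: "drift (gm m) r t \<in> borel_measurable M" for m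
    using measurable_F_M[OF _ drift_measurable[OF gmm]] by simp
  have CM: "?C m \<in> borel_measurable M" for m
    using measurable_F_M[OF rt(1) truncate_at_measurable[OF rt(1) C]] .
  have step: "(\<integral>\<^sup>+w. ennreal (?C m w * jump_prod (gm m) r t w) \<partial>M)
    = (\<integral>\<^sup>+w. ennreal (?C m w * exp (drift (gm m) r t w)) \<partial>M)" for m
  proof -
    \<comment> \<open>The truncated formula is complex; it is applied to the embedded real data, and
      \<open>c1\<close> to \<open>c3\<close> pull the embedding out of each ingredient.\<close>
    have gc: "(\<lambda>p. complex_of_real (g (fst p) (snd p))) \<in> borel_measurable (borel \<Otimes>\<^sub>M F 0)"
      by (rule measurable_compose[OF g]) measurable
    have Cc: "(\<lambda>w. complex_of_real (C w)) \<in> borel_measurable (F r)"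
      by (rule measurable_compose[OF C]) measurable
    have c1: "truncate_at t m (\<lambda>w. complex_of_real (C w)) w = complex_of_real (?C m w)" for w
      by (simp add: truncate_at_def truncate_of_real)
    have c2: "jump_prod (\<lambda>s w. truncate m (complex_of_real (g s w))) r t w
      = complex_of_real (jump_prod (gm m) r t w)" for w
      by (simp add: jump_prod_def truncate_of_real gm_def)
    have c3: "drift (\<lambda>s w. truncate m (complex_of_real (g s w))) r t w
      = complex_of_real (drift (gm m) r t w)" for w
      by (simp add: drift_def truncate_of_real gm_def flip: of_real_diff of_real_mult set_integral_complex_of_real)
        (simp flip: set_integral_complex_of_real)
    note tm = truncated_mean[OF rt gc Cc, of m, unfolded c1 c2 c3 exp_of_real, folded of_real_mult,
        unfolded complex_of_real_integrable_eq integral_complex_of_real of_real_eq_iff]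
    have "(\<integral>\<^sup>+w. ennreal (?C m w * jump_prod (gm m) r t w) \<partial>M)
      = ennreal (\<integral>w. ?C m w * jump_prod (gm m) r t w \<partial>M)"
      using C_nonneg P_nonneg tm(1) by (intro nn_integral_eq_integral) auto
    also have "\<dots> = ennreal (\<integral>w. ?C m w * exp (drift (gm m) r t w) \<partial>M)"
      using tm(3) by simp
    also have "\<dots> = (\<integral>\<^sup>+w. ennreal (?C m w * exp (drift (gm m) r t w)) \<partial>M)"
      using C_nonneg tm(2) by (intro nn_integral_eq_integral[symmetric]) auto
    finally show ?thesis .
  qed
  have "(\<integral>\<^sup>+w. ennreal (C w * jump_prod g r t w) \<partial>M)
    = (SUP m. \<integral>\<^sup>+w. ennreal (?C m w * jump_prod (gm m) r t w) \<partial>M)"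
  proof (rule nn_integral_eq_SUP_of_tendsto)
    show "(\<lambda>w. ennreal (?C m w * jump_prod (gm m) r t w)) \<in> borel_measurable M" for m
      using PM[of m] CM[of m] by measurable
    show "ennreal (?C m w * jump_prod (gm m) r t w) \<le> ennreal (?C (Suc m) w * jump_prod (gm (Suc m)) r t w)" for m w
      by (intro ennreal_leI mult_mono C_mono P_mono C_nonneg P_nonneg)
    show "(\<lambda>m. ennreal (?C m w * jump_prod (gm m) r t w)) \<longlonglongrightarrow> ennreal (C w * jump_prod g r t w)"
      if w: "w \<in> space M" for w
      by (intro tendsto_ennrealI tendsto_mult tendsto_eventually truncate_at_eventually w)
        (unfold gm_def, rule jump_prod_truncate_eventually[OF rt(1) w])
  qed
  also have "\<dots> = (\<integral>\<^sup>+w. ennreal (C w * exp (drift g r t w)) \<partial>M)"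
    unfolding step
  proof (rule nn_integral_eq_SUP_of_tendsto[symmetric])
    show "(\<lambda>w. ennreal (?C m w * exp (drift (gm m) r t w))) \<in> borel_measurable M" for m
      using DM[of m] CM[of m] by measurable
    show "ennreal (?C m w * exp (drift (gm m) r t w)) \<le> ennreal (?C (Suc m) w * exp (drift (gm (Suc m)) r t w))"
      if "w \<in> space M" for m w
      using D_mono[OF that] by (intro ennreal_leI mult_mono C_mono C_nonneg) auto
    show "(\<lambda>m. ennreal (?C m w * exp (drift (gm m) r t w))) \<longlonglongrightarrow> ennreal (C w * exp (drift g r t w))"
      if w: "w \<in> space M" for w
    proof (intro tendsto_ennrealI tendsto_mult tendsto_exp)
      show "(\<lambda>m. ?C m w) \<longlonglongrightarrow> C w" by (intro tendsto_eventually truncate_at_eventually w)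
      have "set_integrable lborel {r..t} (\<lambda>s. norm (g s w) * X s w)"
        using i[OF w] by (simp add: g0)
      then show "(\<lambda>m. drift (gm m) r t w) \<longlonglongrightarrow> drift g r t w"
        unfolding gm_def by (rule drift_truncate_tendsto[OF g w])
    qed
  qed
  finally show ?thesis .
qed

text \<open>Dominated convergence from the truncated formula. The bound for the product side is
  \<open>norm (C w)\<close> times the product of the \<open>norm (g s w)\<close>; the non-negative
  version for these norms turns the assumption \<open>fin\<close> into its integrability.\<close>

lemma exponential_mean:
  fixes g :: "real \<Rightarrow> 'a \<Rightarrow> complex" and C :: "'a \<Rightarrow> complex"
  assumes g: "(\<lambda>p. g (fst p) (snd p)) \<in> borel_measurable (borel \<Otimes>\<^sub>M F 0)"
    and i: "\<And>w. w \<in> space M \<Longrightarrow> set_integrable lborel {r..t} (\<lambda>s. norm (g s w) * X s w)"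
    and C: "C \<in> borel_measurable (F r)"
    and fin: "(\<integral>\<^sup>+w. ennreal (norm (C w) * exp (drift (\<lambda>s w. norm (g s w)) r t w)) \<partial>M) < \<infinity>"
  shows "integrable M (\<lambda>w. C w * jump_prod g r t w)"
    and "(\<integral>w. C w * jump_prod g r t w \<partial>M) = (\<integral>w. C w * exp (drift g r t w) \<partial>M)"
proof -
  let ?n = "\<lambda>s w. norm (g s w)"
  define gm where "gm m s w = truncate m (g s w)" for m s w
  let ?C = "\<lambda>m. truncate_at t m C"
  have gn: "(\<lambda>p. ?n (fst p) (snd p)) \<in> borel_measurable (borel \<Otimes>\<^sub>M F 0)"
    by (rule measurable_compose[OF g]) measurable
  have gmm: "(\<lambda>p. gm m (fst p) (snd p)) \<in> borel_measurable (borel \<Otimes>\<^sub>M F 0)" for m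
    unfolding gm_def by (rule truncate_process_measurable[OF g])
  have CM[measurable]: "C \<in> borel_measurable M" "?C m \<in> borel_measurable M" for m
    using measurable_F_M[OF rt(1)] C truncate_at_measurable[OF rt(1) C] by auto
  have [measurable]: "jump_prod h r t \<in> borel_measurable M" "drift h r t \<in> borel_measurable M"
    if "(\<lambda>p. h (fst p) (snd p)) \<in> borel_measurable (borel \<Otimes>\<^sub>M F 0)" for h :: "real \<Rightarrow> 'a \<Rightarrow> complex"
    using measurable_F_M[OF _ jump_prod_measurable[OF that rt]] measurable_F_M[OF _ drift_measurable[OF that]] rt by auto
  have [measurable]: "jump_prod h r t \<in> borel_measurable M" "drift h r t \<in> borel_measurable M"
    if "(\<lambda>p. h (fst p) (snd p)) \<in> borel_measurable (borel \<Otimes>\<^sub>M F 0)" for h :: "real \<Rightarrow> 'a \<Rightarrow> real"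
    using measurable_F_M[OF _ jump_prod_measurable[OF that rt]] measurable_F_M[OF _ drift_measurable[OF that]] rt by auto
  note [measurable] = g gn gmm
  have nn: "(\<integral>\<^sup>+w. ennreal (norm (C w) * jump_prod ?n r t w) \<partial>M)
    = (\<integral>\<^sup>+w. ennreal (norm (C w) * exp (drift ?n r t w)) \<partial>M)"
    using C by (intro nn_exponential_mean gn i borel_measurable_norm) auto
  have P0: "0 \<le> jump_prod ?n r t w" for w unfolding jump_prod_def by (intro prod_nonneg) auto
  have dom1: "integrable M (\<lambda>w. norm (C w) * jump_prod ?n r t w)"
    using fin P0 by (intro integrableI_nonneg) (auto simp: nn)
  have dom2: "integrable M (\<lambda>w. norm (C w) * exp (drift ?n r t w))"
    using fin by (intro integrableI_nonneg) auto
  have norm_prod: "norm (jump_prod h r t w) = jump_prod (\<lambda>s w. norm (h s w)) r t w" for h :: "real \<Rightarrow> 'a \<Rightarrow> complex" and w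
    by (simp add: jump_prod_def prod_norm)
  show "integrable M (\<lambda>w. C w * jump_prod g r t w)"
    by (rule Bochner_Integration.integrable_bound[OF dom1]) (auto simp: norm_mult norm_prod)
  have L1: "(\<lambda>m. \<integral>w. ?C m w * jump_prod (gm m) r t w \<partial>M) \<longlonglongrightarrow> (\<integral>w. C w * jump_prod g r t w \<partial>M)"
  proof (rule integral_dominated_convergence[OF _ _ dom1])
    show "AE w in M. (\<lambda>m. ?C m w * jump_prod (gm m) r t w) \<longlonglongrightarrow> C w * jump_prod g r t w"
    proof (intro AE_I2 tendsto_mult tendsto_eventually truncate_at_eventually)
      fix w assume w: "w \<in> space M"
      show "\<forall>\<^sub>F m in sequentially. jump_prod (gm m) r t w = jump_prod g r t w"
        unfolding gm_def[abs_def] by (rule jump_prod_truncate_eventually[OF rt(1) w])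
    qed
    show "AE w in M. norm (?C m w * jump_prod (gm m) r t w) \<le> norm (C w) * jump_prod ?n r t w" for m
      unfolding norm_mult norm_prod
      by (intro AE_I2 mult_mono norm_truncate_at_le)
        (auto simp: jump_prod_def gm_def intro!: prod_mono prod_nonneg norm_truncate_le)
  qed auto
  have L2: "(\<lambda>m. \<integral>w. ?C m w * exp (drift (gm m) r t w) \<partial>M) \<longlonglongrightarrow> (\<integral>w. C w * exp (drift g r t w) \<partial>M)"
  proof (rule integral_dominated_convergence[OF _ _ dom2])
    show "AE w in M. (\<lambda>m. ?C m w * exp (drift (gm m) r t w)) \<longlonglongrightarrow> C w * exp (drift g r t w)"
    proof (intro AE_I2 tendsto_mult tendsto_exp)
      fix w assume w: "w \<in> space M"
      show "(\<lambda>m. ?C m w) \<longlonglongrightarrow> C w" by (intro tendsto_eventually truncate_at_eventually w)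
      show "(\<lambda>m. drift (gm m) r t w) \<longlonglongrightarrow> drift g r t w"
        unfolding gm_def by (rule drift_truncate_tendsto[OF g w i[OF w]])
    qed
    show "AE w in M. norm (?C m w * exp (drift (gm m) r t w)) \<le> norm (C w) * exp (drift ?n r t w)" for m
    proof (rule AE_I2)
      fix w assume w: "w \<in> space M"
      have nb: "norm (gm m s w) \<le> real m" for s unfolding gm_def by (rule norm_truncate_le)
      note i1 = set_integrable_compensated[OF gmm w bounded_weight_integrable[OF gmm w nb]]
      have i2: "set_integrable lborel {r..t} (\<lambda>s. (?n s w - 1) * X s w)"
        using set_integrable_compensated[OF gn w, of r t] i[OF w] by simp
      have i1': "complex_integrable lborel (\<lambda>s. indicator {r..t} s *\<^sub>R ((gm m s w - 1) * of_real (X s w)))"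
        using i1 by (simp add: set_integrable_def)
      \<comment> \<open>The norm of an exponential depends on the real part of the exponent only,
        and \<open>Re (gm - 1) \<le> norm g - 1\<close>. Bounding by \<open>norm (gm - 1)\<close>
        would give too large an exponent for \<open>dom2\<close>.\<close>
      have "Re (drift (gm m) r t w) = (\<integral>s. Re (indicator {r..t} s *\<^sub>R ((gm m s w - 1) * of_real (X s w))) \<partial>lborel)"
        unfolding drift_def set_lebesgue_integral_def by (rule integral_Re[OF i1', symmetric])
      also have "\<dots> \<le> (\<integral>s. indicator {r..t} s *\<^sub>R ((?n s w - 1) * X s w) \<partial>lborel)"
      proof (rule integral_mono)
        show "integrable lborel (\<lambda>s. Re (indicator {r..t} s *\<^sub>R ((gm m s w - 1) * of_real (X s w))))"
          using i1' by (rule integrable_Re)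
        show "integrable lborel (\<lambda>s. indicator {r..t} s *\<^sub>R ((?n s w - 1) * X s w))"
          using i2 by (simp add: set_integrable_def)
        fix s
        have "Re (gm m s w) \<le> ?n s w"
          using complex_Re_le_cmod[of "gm m s w"] norm_truncate_le(2)[of m "g s w"] by (simp add: gm_def)
        then show "Re (indicator {r..t} s *\<^sub>R ((gm m s w - 1) * of_real (X s w)))
          \<le> indicator {r..t} s *\<^sub>R ((?n s w - 1) * X s w)"
          using X_nonneg[of s w] by (auto simp: indicator_def intro!: mult_right_mono)
      qed
      also have "\<dots> = drift ?n r t w" by (simp add: drift_def set_lebesgue_integral_def)
      finally show "norm (?C m w * exp (drift (gm m) r t w)) \<le> norm (C w) * exp (drift ?n r t w)"
        unfolding norm_mult by (intro mult_mono norm_truncate_at_le) auto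
    qed
  qed auto
  have "(\<integral>w. ?C m w * jump_prod (gm m) r t w \<partial>M) = (\<integral>w. ?C m w * exp (drift (gm m) r t w) \<partial>M)" for m
    unfolding gm_def[abs_def] by (rule truncated_mean(3)[OF rt g C])
  then show "(\<integral>w. C w * jump_prod g r t w \<partial>M) = (\<integral>w. C w * exp (drift g r t w) \<partial>M)"
    using LIMSEQ_unique[OF L1] L2 by simp
qed

end

end

subsection \<open>The density process\<close>

context finite_measure_subalgebra
begin

lemma complex_cond_exp_eqI:
  fixes f g :: "'a \<Rightarrow> complex"
  assumes f: "integrable M f" and g: "integrable M g" and gF: "g \<in> borel_measurable F"
    and eq: "\<And>A. A \<in> sets F \<Longrightarrow> (\<integral>w. indicator A w *\<^sub>R f w \<partial>M) = (\<integral>w. indicator A w *\<^sub>R g w \<partial>M)"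
  shows "AE w in M. complex_cond_exp M F f w = g w"
proof -
  have i: "integrable M (\<lambda>w. indicator A w *\<^sub>R f w)" "integrable M (\<lambda>w. indicator A w *\<^sub>R g w)"
    if "A \<in> sets F" for A
    using that subalg f g by (auto intro!: integrable_mult_indicator simp: subalgebra_def)
  have "AE w in M. real_cond_exp M F (\<lambda>w. Re (f w)) w = Re (g w)"
  proof (rule real_cond_exp_charact)
    fix A assume A: "A \<in> sets F"
    from arg_cong[OF eq[OF A], of Re] show "(\<integral>x\<in>A. Re (f x) \<partial>M) = (\<integral>x\<in>A. Re (g x) \<partial>M)"
      using i[OF A] by (simp add: set_lebesgue_integral_def flip: integral_Re)
  qed (use f g gF in auto)
  moreover have "AE w in M. real_cond_exp M F (\<lambda>w. Im (f w)) w = Im (g w)"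
  proof (rule real_cond_exp_charact)
    fix A assume A: "A \<in> sets F"
    from arg_cong[OF eq[OF A], of Im] show "(\<integral>x\<in>A. Im (f x) \<partial>M) = (\<integral>x\<in>A. Im (g x) \<partial>M)"
      using i[OF A] by (simp add: set_lebesgue_integral_def flip: integral_Im)
  qed (use f g gF in auto)
  ultimately show ?thesis
    by eventually_elim (simp add: complex_cond_exp_def)
qed

lemma integral_complex_cond_exp_eq:
  fixes f g :: "'a \<Rightarrow> complex"
  assumes f: "integrable M f" and g[measurable]: "g \<in> borel_measurable M"
    and ae: "AE w in M. complex_cond_exp M F f w = g w" and A: "A \<in> sets F"
  shows "(\<integral>w. indicator A w *\<^sub>R f w \<partial>M) = (\<integral>w. indicator A w *\<^sub>R g w \<partial>M)"
proof -
  have AM[measurable]: "A \<in> sets M" using A subalg by (auto simp: subalgebra_def)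
  have fA: "integrable M (\<lambda>w. indicator A w *\<^sub>R f w)" by (rule integrable_mult_indicator[OF AM f])
  let ?r = "real_cond_exp M F (\<lambda>w. Re (f w))" and ?i = "real_cond_exp M F (\<lambda>w. Im (f w))"
  have aer: "AE w in M. Re (g w) = ?r w" and aei: "AE w in M. Im (g w) = ?i w"
    using ae by (eventually_elim, simp add: complex_cond_exp_def complex_eq_iff)+
  have ri: "integrable M ?r" "integrable M ?i" using f by auto
  \<comment> \<open>Integrability of \<open>g\<close> is inherited from the conditional expectations
    with which its real and imaginary parts agree almost surely.\<close>
  have "integrable M (\<lambda>w. Re (g w))"
    by (rule Bochner_Integration.integrable_bound[OF ri(1)]) (use aer in \<open>auto elim: eventually_mono\<close>)
  moreover have "integrable M (\<lambda>w. Im (g w))"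
    by (rule Bochner_Integration.integrable_bound[OF ri(2)]) (use aei in \<open>auto elim: eventually_mono\<close>)
  ultimately have "integrable M (\<lambda>w. of_real (Re (g w)) + \<i> * of_real (Im (g w)))" by auto
  then have g': "integrable M g" by (simp flip: complex_eq)
  have gA: "integrable M (\<lambda>w. indicator A w *\<^sub>R g w)" by (rule integrable_mult_indicator[OF AM g'])
  have R: "(\<integral>w. indicator A w * Re (f w) \<partial>M) = (\<integral>w. indicator A w * Re (g w) \<partial>M)"
  proof -
    have "(\<integral>w. indicator A w * Re (f w) \<partial>M) = (\<integral>w. indicator A w * ?r w \<partial>M)"
      using real_cond_exp_intA[of "\<lambda>w. Re (f w)" A] f A by (simp add: set_lebesgue_integral_def)
    also have "\<dots> = (\<integral>w. indicator A w * Re (g w) \<partial>M)"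
      using aer by (intro integral_cong_AE) (auto elim: eventually_mono)
    finally show ?thesis .
  qed
  have I: "(\<integral>w. indicator A w * Im (f w) \<partial>M) = (\<integral>w. indicator A w * Im (g w) \<partial>M)"
  proof -
    have "(\<integral>w. indicator A w * Im (f w) \<partial>M) = (\<integral>w. indicator A w * ?i w \<partial>M)"
      using real_cond_exp_intA[of "\<lambda>w. Im (f w)" A] f A by (simp add: set_lebesgue_integral_def)
    also have "\<dots> = (\<integral>w. indicator A w * Im (g w) \<partial>M)"
      using aei by (intro integral_cong_AE) (auto elim: eventually_mono)
    finally show ?thesis .
  qed
  show ?thesis
    by (rule complex_eqI) (use R I fA gA in \<open>simp_all flip: integral_Re integral_Im\<close>)
qed

end

context conditional_poisson_jumps
begin

definition density_process :: "(real \<Rightarrow> 'a \<Rightarrow> real) \<Rightarrow> real \<Rightarrow> 'a \<Rightarrow> real" where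
  "density_process g t w = exp (- drift g 0 t w) * jump_prod g 0 t w"

lemma jumps_split:
  assumes "a \<le> b" "b \<le> c"
  shows "jumps a c w = jumps a b w \<union> jumps b c w" "jumps a b w \<inter> jumps b c w = {}"
  using assms by (auto simp: jumps_def)

lemma jump_prod_split:
  assumes "0 \<le> a" "a \<le> b" "b \<le> c" "w \<in> space M"
  shows "jump_prod g a c w = jump_prod g a b w * jump_prod g b c w"
  unfolding jump_prod_def jumps_split(1)[OF assms(2,3)]
  using assms by (intro prod.union_disjoint finite_jumps jumps_split(2)) auto

text \<open>Only finitely many jumps fall into \<open>(t,t+1]\<close>, so the first one after
  \<open>t\<close> keeps a positive distance from \<open>t\<close>.\<close>

lemma eventually_jumps_right:
  assumes "0 \<le> t" "w \<in> space M"
  shows "\<forall>\<^sub>F s in at_right t. jumps 0 s w = jumps 0 t w"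
proof -
  have "\<forall>\<^sub>F s in at_right t. \<forall>n\<in>jumps t (t + 1) w. s < \<tau> n w"
    using finite_jumps[OF assms]
    by (intro eventually_ball_finite ballI) (auto simp: jumps_def eventually_at_right_field)
  moreover have "\<forall>\<^sub>F s in at_right t. t < s \<and> s < t + 1"
    by (auto simp: eventually_at_right_field intro!: exI[of _ "t + 1"])
  ultimately show ?thesis
  proof eventually_elim
    case (elim s)
    have "\<tau> n w \<le> t" if "\<tau> n w \<le> s" for n
    proof (rule ccontr)
      assume "\<not> \<tau> n w \<le> t"
      then have "n \<in> jumps t (t + 1) w" using elim that by (auto simp: jumps_def)
      then show False using elim that by force
    qed
    then show ?case using elim by (auto simp: jumps_def intro: order_trans)
  qed
qed

lemma eventually_jumps_left:
  assumes "0 < t" "w \<in> space M"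
  shows "\<forall>\<^sub>F s in at_left t. jumps 0 s w = {n. 0 < \<tau> n w \<and> \<tau> n w < t}"
proof -
  have "finite {n. 0 < \<tau> n w \<and> \<tau> n w < t}"
    using finite_jumps[OF order_refl assms(2), of t] by (auto simp: jumps_def elim: finite_subset[rotated])
  then have "\<forall>\<^sub>F s in at_left t. \<forall>n\<in>{n. 0 < \<tau> n w \<and> \<tau> n w < t}. \<tau> n w < s"
    by (intro eventually_ball_finite ballI) (auto simp: eventually_at_left_field)
  moreover have "\<forall>\<^sub>F s in at_left t. s < t"
    by (auto simp: eventually_at_left_field intro!: exI[of _ "t - 1"])
  ultimately show ?thesis
    by eventually_elim (auto simp: jumps_def less_imp_le)
qed

end

lemma tendsto_LBINT_upper:
  fixes f :: "real \<Rightarrow> 'b::euclidean_space"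
  assumes f: "\<And>b. set_integrable lborel {0..b} f" and t: "0 \<le> t"
  shows "((\<lambda>s. LBINT u:{0..s}. f u) \<longlongrightarrow> (LBINT u:{0..t}. f u)) (at t within {0..})"
proof -
  have "continuous_on {0..t + 1} (\<lambda>s. LBINT u:{0..s}. f u)" by (rule continuous_on_LBINT[OF f])
  then have "((\<lambda>s. LBINT u:{0..s}. f u) \<longlongrightarrow> (LBINT u:{0..t}. f u)) (at t within {0..t + 1})"
    using t by (auto simp: continuous_on_def)
  also have "at t within {0..t + 1} = at t within {0..}"
    by (rule at_within_nhd[of _ "{..<t + 1}"]) auto
  finally show ?thesis .
qed

lemma
  fixes f :: "real \<Rightarrow> 'b::euclidean_space"
  assumes f: "\<And>b. set_integrable lborel {0..b} f"
  shows LBINT_tendsto_right: "0 \<le> t \<Longrightarrow> ((\<lambda>s. LBINT u:{0..s}. f u) \<longlongrightarrow> (LBINT u:{0..t}. f u)) (at_right t)"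
    and LBINT_tendsto_left: "0 < t \<Longrightarrow> ((\<lambda>s. LBINT u:{0..s}. f u) \<longlongrightarrow> (LBINT u:{0..t}. f u)) (at_left t)"
proof -
  show "0 \<le> t \<Longrightarrow> ((\<lambda>s. LBINT u:{0..s}. f u) \<longlongrightarrow> (LBINT u:{0..t}. f u)) (at_right t)"
    by (rule tendsto_mono[OF at_le tendsto_LBINT_upper[OF f]]) auto
  assume t: "0 < t"
  have "at t within {0..} = at t" using t by (intro at_within_interior) auto
  then show "((\<lambda>s. LBINT u:{0..s}. f u) \<longlongrightarrow> (LBINT u:{0..t}. f u)) (at_left t)"
    using tendsto_LBINT_upper[OF f, of t] t by (auto intro: tendsto_mono[OF at_le[of "{..<t}" UNIV]])
qed

section \<open>Martingale property of the density and its behaviour under a phase factor\<close>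

locale weighted_jumps = conditional_poisson_jumps +
  fixes Y :: "real \<Rightarrow> 'a \<Rightarrow> real"
  assumes Y_measurable: "(\<lambda>p. Y (fst p) (snd p)) \<in> borel_measurable (borel \<Otimes>\<^sub>M F 0)"
    and Y_nonneg: "\<And>s w. 0 \<le> Y s w"
    and YX_integrable: "\<And>a b w. w \<in> space M \<Longrightarrow> set_integrable lborel {a..b} (\<lambda>s. Y s w * X s w)"
begin

abbreviation Z :: "real \<Rightarrow> 'a \<Rightarrow> real" where "Z \<equiv> density_process Y"

lemma drift_Y_integrable: "w \<in> space M \<Longrightarrow> set_integrable lborel {a..b} (\<lambda>s. (Y s w - 1) * of_real (X s w))"
  using set_integrable_compensated[OF Y_measurable, of w a b] YX_integrable[of w a b] by (simp add: Y_nonneg)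

lemma Z_nonneg: "0 \<le> Z t w"
  unfolding density_process_def jump_prod_def using Y_nonneg by (intro mult_nonneg_nonneg prod_nonneg) auto

lemma Z_0: "Z 0 w = 1"
proof -
  have "drift Y 0 0 w = 0"
    by (simp add: drift_def set_lebesgue_integral_def)
      (rule integral_eq_zero_AE, use AE_lborel_singleton[of 0] in eventually_elim, simp)
  moreover have "jumps 0 0 w = {}" by (auto simp: jumps_def)
  ultimately show ?thesis by (simp add: density_process_def jump_prod_def)
qed

lemma Z_split:
  assumes "0 \<le> s" "s \<le> t" "w \<in> space M"
  shows "Z t w = Z s w * exp (- drift Y s t w) * jump_prod Y s t w"
proof -
  have "drift Y 0 t w = drift Y 0 s w + drift Y s t w"
    unfolding drift_def using assms by (intro LBINT_Icc_combine drift_Y_integrable) auto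
  then have "exp (- drift Y 0 t w) = exp (- drift Y 0 s w) * exp (- drift Y s t w)"
    by (simp flip: exp_add)
  then show ?thesis
    using jump_prod_split[OF order_refl assms] by (simp add: density_process_def mult_ac)
qed

lemma Z_measurable: "0 \<le> t \<Longrightarrow> Z t \<in> borel_measurable (F t)"
proof -
  assume t: "0 \<le> t"
  have [measurable]: "drift Y 0 t \<in> borel_measurable (F t)" "jump_prod Y 0 t \<in> borel_measurable (F t)"
    using measurable_F_mono[OF _ t drift_measurable[OF Y_measurable]] jump_prod_measurable[OF Y_measurable order_refl t]
    by auto
  show ?thesis unfolding density_process_def[abs_def] by measurable
qed

lemma Z_measurable_M: "0 \<le> t \<Longrightarrow> Z t \<in> borel_measurable M"
  using measurable_F_M Z_measurable by blast

text \<open>In \<open>Z t = Z s * exp (- drift Y s t) * jump_prod Y s t\<close> all but the last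
  factor are known at time \<open>s\<close>, because the drift up to \<open>t\<close> is already
  \<open>F 0\<close>-measurable. They form the test variable \<open>C\<close> of the exponential
  mean.\<close>

lemma weight_measurable:
  assumes "0 \<le> s" "A \<in> sets (F s)"
  shows "(\<lambda>w. indicator A w * Z s w * exp (- drift Y s t w)) \<in> borel_measurable (F s)"
proof -
  have [measurable]: "drift Y s t \<in> borel_measurable (F s)" "Z s \<in> borel_measurable (F s)" "A \<in> sets (F s)"
    using measurable_F_mono[OF _ assms(1) drift_measurable[OF Y_measurable]] Z_measurable assms by auto
  show ?thesis by measurable
qed

text \<open>The mean of the jump product is \<open>exp (drift Y s t)\<close>, which cancels the
  compensating exponential in the weight. In extended non-negative form the identity also yields the
  integrability of \<open>Z t\<close>, by comparison with \<open>Z 0 = 1\<close>.\<close>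

lemma nn_integral_Z:
  assumes s: "0 \<le> s" "s \<le> t" and A: "A \<in> sets (F s)"
  shows "(\<integral>\<^sup>+w. ennreal (indicator A w * Z t w) \<partial>M) = (\<integral>\<^sup>+w. ennreal (indicator A w * Z s w) \<partial>M)"
proof -
  let ?C = "\<lambda>w. indicator A w * Z s w * exp (- drift Y s t w)"
  have "(\<integral>\<^sup>+w. ennreal (indicator A w * Z t w) \<partial>M) = (\<integral>\<^sup>+w. ennreal (?C w * jump_prod Y s t w) \<partial>M)"
    by (intro nn_integral_cong) (simp add: Z_split[OF s] mult.assoc)
  also have "\<dots> = (\<integral>\<^sup>+w. ennreal (?C w * exp (drift Y s t w)) \<partial>M)"
    using Z_nonneg
    by (intro nn_exponential_mean s Y_measurable Y_nonneg YX_integrable weight_measurable A) auto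
  also have "\<dots> = (\<integral>\<^sup>+w. ennreal (indicator A w * Z s w) \<partial>M)"
    by (simp add: mult.assoc flip: exp_add)
  finally show ?thesis .
qed

lemma nn_integral_Z_F0:
  assumes t: "0 \<le> t" and A: "A \<in> sets (F 0)"
  shows "(\<integral>\<^sup>+w. ennreal (indicator A w * Z t w) \<partial>M) = emeasure M A"
proof -
  have "A \<in> sets M" by (rule sets_F_M[OF order_refl A])
  then show ?thesis
    unfolding nn_integral_Z[OF order_refl t A] Z_0 by (simp add: ennreal_indicator)
qed

lemma Z_integrable:
  assumes t: "0 \<le> t" shows "integrable M (Z t)"
proof (rule integrableI_nonneg)
  have "(\<integral>\<^sup>+w. ennreal (Z t w) \<partial>M) = (\<integral>\<^sup>+w. ennreal (indicator (space M) w * Z t w) \<partial>M)"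
    by (intro nn_integral_cong) simp
  also have "\<dots> = emeasure M (space M)"
    using sets.top[of "F 0"] by (intro nn_integral_Z_F0[OF t]) simp
  finally show "(\<integral>\<^sup>+w. ennreal (Z t w) \<partial>M) < \<infinity>" by (simp add: emeasure_space_1)
qed (use Z_nonneg Z_measurable_M[OF t] in auto)

lemma martingale_Z: "martingale M F Z"
  unfolding martingale_def adapted_def
proof (intro conjI allI impI)
  fix t :: real assume t: "0 \<le> t"
  show "Z t \<in> borel_measurable (F t)" by (rule Z_measurable[OF t])
  show "integrable M (Z t)" by (rule Z_integrable[OF t])
next
  fix s t :: real assume s: "0 \<le> s" "s \<le> t"
  interpret finite_measure_subalgebra M "F s" using subalg[OF s(1)] by unfold_locales
  show "AE w in M. real_cond_exp M (F s) (Z t) w = Z s w"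
  proof (rule real_cond_exp_charact)
    fix A assume A: "A \<in> sets (F s)"
    have AM: "A \<in> sets M" by (rule sets_F_M[OF s(1) A])
    have i: "integrable M (\<lambda>w. indicator A w * Z u w)" if "0 \<le> u" for u
      using integrable_mult_indicator[OF AM Z_integrable[OF that]] by simp
    have "ennreal (\<integral>w. indicator A w * Z t w \<partial>M) = ennreal (\<integral>w. indicator A w * Z s w \<partial>M)"
      using nn_integral_Z[OF s A] i[of t] i[of s] s Z_nonneg
      by (simp add: nn_integral_eq_integral)
    then show "(\<integral>x\<in>A. Z t x \<partial>M) = (\<integral>x\<in>A. Z s x \<partial>M)"
      using Z_nonneg by (simp add: set_lebesgue_integral_def integral_nonneg_AE)
  qed (use s Z_integrable Z_measurable in auto)
qed

lemma Z_tendsto_right: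
  assumes t: "0 \<le> t" and w: "w \<in> space M"
  shows "((\<lambda>s. Z s w) \<longlongrightarrow> Z t w) (at_right t)"
  unfolding density_process_def
proof (intro tendsto_mult tendsto_exp tendsto_minus)
  show "((\<lambda>s. drift Y 0 s w) \<longlongrightarrow> drift Y 0 t w) (at_right t)"
    unfolding drift_def by (rule LBINT_tendsto_right[OF drift_Y_integrable[OF w] t])
  have "\<forall>\<^sub>F s in at_right t. jump_prod Y 0 s w = jump_prod Y 0 t w"
    using eventually_jumps_right[OF t w] by eventually_elim (simp add: jump_prod_def)
  then show "((\<lambda>s. jump_prod Y 0 s w) \<longlongrightarrow> jump_prod Y 0 t w) (at_right t)"
    by (rule tendsto_eventually)
qed

text \<open>
  Tilting \<open>g = \<phi> Y\<close> by a phase \<open>\<phi>\<close> leaves \<open>\<bar>g\<bar> = Y\<close>, so the integrability needed for the complex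
  exponential formula is that of \<open>Z\<close> itself.
\<close>

lemma phase_integral:
  fixes \<phi> :: "real \<Rightarrow> 'a \<Rightarrow> complex"
  assumes rt: "0 \<le> r" "r \<le> t" and A: "A \<in> sets (F r)"
    and \<phi>: "(\<lambda>p. \<phi> (fst p) (snd p)) \<in> borel_measurable (borel \<Otimes>\<^sub>M F 0)"
    and \<phi>1: "\<And>s w. norm (\<phi> s w) = 1"
  shows "(\<integral>w. indicator A w *\<^sub>R (of_real (Z t w) * jump_prod \<phi> r t w) \<partial>M)
    = (\<integral>w. indicator A w *\<^sub>R (of_real (Z t w) * exp (LBINT s:{r..t}. (\<phi> s w - 1) * of_real (Y s w * X s w))) \<partial>M)"
proof -
  let ?Y = "\<lambda>s w. complex_of_real (Y s w)" and ?g = "\<lambda>s w. \<phi> s w * complex_of_real (Y s w)"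
  let ?E = "\<lambda>w. LBINT s:{r..t}. (\<phi> s w - 1) * of_real (Y s w * X s w)"
  define C where "C w = indicator A w * Z r w * exp (- drift Y r t w)" for w
  have C0: "0 \<le> C w" for w using Z_nonneg by (simp add: C_def)
  have CF: "C \<in> borel_measurable (F r)" unfolding C_def[abs_def] by (rule weight_measurable[OF rt(1) A])
  have Ym: "(\<lambda>p. ?Y (fst p) (snd p)) \<in> borel_measurable (borel \<Otimes>\<^sub>M F 0)"
    by (rule measurable_compose[OF Y_measurable]) measurable
  have gm: "(\<lambda>p. ?g (fst p) (snd p)) \<in> borel_measurable (borel \<Otimes>\<^sub>M F 0)"
    using \<phi> Ym by (rule borel_measurable_times)
  have norms: "norm (?Y s w) = Y s w" "norm (?g s w) = Y s w" for s w
    using Y_nonneg by (auto simp: norm_mult \<phi>1)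
  have Em: "(\<lambda>p. (\<phi> (fst p) (snd p) - 1) * of_real (Y (fst p) (snd p) * X (fst p) (snd p))) \<in> borel_measurable (borel \<Otimes>\<^sub>M F 0)"
    using \<phi> Y_measurable X_measurable
    by (intro borel_measurable_times borel_measurable_diff borel_measurable_of_real) auto
  have EF: "?E \<in> borel_measurable (F r)"
    using measurable_F_mono[OF _ rt(1)] borel_measurable_LBINT_section[OF Em, of "\<lambda>_. r" "F 0" "\<lambda>_. t" "\<lambda>x. x"] by simp
  have Ei: "set_integrable lborel {r..t} (\<lambda>s. (\<phi> s w - 1) * of_real (Y s w * X s w))" if w: "w \<in> space M" for w
  proof (rule set_integrable_bound[of _ _ "\<lambda>s. 2 * (Y s w * X s w)"])
    show "set_integrable lborel {r..t} (\<lambda>s. 2 * (Y s w * X s w))"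
      using YX_integrable[OF w] by (intro set_integrable_mult_right) auto
    have [measurable]: "(\<lambda>s. (\<phi> s w - 1) * of_real (Y s w * X s w)) \<in> borel_measurable borel"
      using F0_section[OF Em w] by simp
    show "set_borel_measurable lborel {r..t} (\<lambda>s. (\<phi> s w - 1) * of_real (Y s w * X s w))"
      unfolding set_borel_measurable_def by measurable
    show "AE s in lborel. s \<in> {r..t} \<longrightarrow> norm ((\<phi> s w - 1) * of_real (Y s w * X s w)) \<le> norm (2 * (Y s w * X s w))"
    proof (intro AE_I2 impI)
      fix s
      have "norm (\<phi> s w - 1) \<le> 2" using norm_triangle_ineq4[of "\<phi> s w" 1] \<phi>1[of s w] by simp
      then show "norm ((\<phi> s w - 1) * of_real (Y s w * X s w)) \<le> norm (2 * (Y s w * X s w))"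
        unfolding norm_mult using Y_nonneg[of s w] X_nonneg[of s w] by (intro mult_mono) (auto simp: norm_mult)
    qed
  qed
  \<comment> \<open>A unimodular \<open>\<phi>\<close> satisfies
    \<open>Re (\<phi> - 1) \<le> 0\<close>, and \<open>Y * X\<close> is non-negative, so the
    exponent has non-positive real part.\<close>
  have E1: "norm (exp (?E w)) \<le> 1" if w: "w \<in> space M" for w
  proof -
    have i: "complex_integrable lborel (\<lambda>s. indicator {r..t} s *\<^sub>R ((\<phi> s w - 1) * of_real (Y s w * X s w)))"
      using Ei[OF w] by (simp add: set_integrable_def)
    have "Re (?E w) = (\<integral>s. Re (indicator {r..t} s *\<^sub>R ((\<phi> s w - 1) * of_real (Y s w * X s w))) \<partial>lborel)"
      unfolding set_lebesgue_integral_def by (rule integral_Re[OF i, symmetric])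
    also have "\<dots> \<le> (\<integral>s. 0 \<partial>(lborel :: real measure))"
    proof (rule integral_mono)
      fix s
      have "Re (\<phi> s w) \<le> 1" using complex_Re_le_cmod[of "\<phi> s w"] \<phi>1[of s w] by simp
      then have "(Re (\<phi> s w) - 1) * (Y s w * X s w) \<le> 0"
        using Y_nonneg[of s w] X_nonneg[of s w] by (intro mult_nonpos_nonneg) auto
      then show "Re (indicator {r..t} s *\<^sub>R ((\<phi> s w - 1) * of_real (Y s w * X s w))) \<le> 0"
        by (auto simp: indicator_def)
      show "integrable lborel (\<lambda>s. Re (indicator {r..t} s *\<^sub>R ((\<phi> s w - 1) * of_real (Y s w * X s w))))"
        by (rule integrable_Re[OF i])
    qed simp
    finally show ?thesis by simp
  qed
  \<comment> \<open>One bound for two applications: \<open>h\<close> is 1 in the first and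
    \<open>exp (?E w)\<close> in the second. The drift inside \<open>C\<close> cancels and the
    integrable \<open>Z r\<close> remains.\<close>
  have fin: "(\<integral>\<^sup>+w. ennreal (norm (h w * of_real (C w)) * exp (drift Y r t w)) \<partial>M) < \<infinity>"
    if h: "\<And>w. w \<in> space M \<Longrightarrow> norm (h w :: complex) \<le> 1" for h
  proof -
    have "(\<integral>\<^sup>+w. ennreal (norm (h w * of_real (C w)) * exp (drift Y r t w)) \<partial>M)
      \<le> (\<integral>\<^sup>+w. ennreal (Z r w) \<partial>M)"
    proof (rule nn_integral_mono)
      fix w assume w: "w \<in> space M"
      have "norm (h w * of_real (C w)) * exp (drift Y r t w) \<le> C w * exp (drift Y r t w)"
        using h[OF w] C0[of w] by (auto simp: norm_mult intro!: mult_right_mono mult_left_le_one_le)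
      also have "\<dots> = indicator A w * Z r w" by (simp add: C_def mult.assoc flip: exp_add)
      also have "\<dots> \<le> Z r w" using Z_nonneg[of r w] by (auto simp: indicator_def)
      finally show "ennreal (norm (h w * of_real (C w)) * exp (drift Y r t w)) \<le> ennreal (Z r w)"
        by (rule ennreal_leI)
    qed
    also have "\<dots> < \<infinity>" using Z_integrable[OF rt(1)] Z_nonneg
      by (simp add: nn_integral_eq_integral)
    finally show ?thesis .
  qed
  have C1: "(\<lambda>w. 1 * complex_of_real (C w)) \<in> borel_measurable (F r)" using CF by measurable
  have C2: "(\<lambda>w. exp (?E w) * complex_of_real (C w)) \<in> borel_measurable (F r)" using CF EF by measurable
  have prods: "jump_prod ?g r t w = jump_prod \<phi> r t w * of_real (jump_prod Y r t w)"
    "jump_prod ?Y r t w = of_real (jump_prod Y r t w)" for w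
    by (auto simp: jump_prod_def prod.distrib)
  have CZ: "indicator A w * Z t w = C w * jump_prod Y r t w" if "w \<in> space M" for w
    using Z_split[OF rt that] by (simp add: C_def)
  have drY: "drift ?Y r t w = of_real (drift Y r t w)" for w
    unfolding drift_def by (simp flip: set_integral_complex_of_real)
  have drg: "drift ?g r t w = ?E w + of_real (drift Y r t w)" if w: "w \<in> space M" for w
  proof -
    have "set_integrable lborel {r..t} (\<lambda>s. (?Y s w - 1) * of_real (X s w))"
      using set_integrable_compensated[OF Ym w, of r t] YX_integrable[OF w] norms by simp
    from set_integral_add(2)[OF Ei[OF w] this] have "?E w + drift ?Y r t w
      = (LBINT s:{r..t}. (\<phi> s w - 1) * of_real (Y s w * X s w) + (?Y s w - 1) * of_real (X s w))"
      by (simp add: drift_def)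
    also have "\<dots> = drift ?g r t w"
      unfolding drift_def by (intro set_lebesgue_integral_cong) (auto simp: algebra_simps)
    finally show ?thesis by (simp add: drY)
  qed
  \<comment> \<open>The exponential mean is used in both directions: with
    \<open>g = \<phi> Y\<close> and weight \<open>C\<close> to remove the product, then with
    \<open>g = Y\<close> and weight \<open>exp (?E w) * C\<close> to restore it. The two meet
    because the drift of \<open>\<phi> Y\<close> is \<open>?E\<close> plus the drift of
    \<open>Y\<close>.\<close>
  have "(\<integral>w. indicator A w *\<^sub>R (of_real (Z t w) * jump_prod \<phi> r t w) \<partial>M)
    = (\<integral>w. 1 * of_real (C w) * jump_prod ?g r t w \<partial>M)"
  proof (rule Bochner_Integration.integral_cong[OF refl])
    fix w assume w: "w \<in> space M"
    have "indicator A w *\<^sub>R (of_real (Z t w) * jump_prod \<phi> r t w) = of_real (indicator A w * Z t w) * jump_prod \<phi> r t w"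
      by (simp add: scaleR_conv_of_real)
    then show "indicator A w *\<^sub>R (of_real (Z t w) * jump_prod \<phi> r t w) = 1 * of_real (C w) * jump_prod ?g r t w"
      unfolding CZ[OF w] prods by simp
  qed
  also have "\<dots> = (\<integral>w. 1 * of_real (C w) * exp (drift ?g r t w) \<partial>M)"
    by (rule exponential_mean(2)[OF rt gm _ C1, unfolded norms, OF YX_integrable fin[of "\<lambda>_. 1"]]) auto
  also have "\<dots> = (\<integral>w. exp (?E w) * of_real (C w) * exp (drift ?Y r t w) \<partial>M)"
    by (rule Bochner_Integration.integral_cong[OF refl]) (simp add: drg drY exp_add)
  also have "\<dots> = (\<integral>w. exp (?E w) * of_real (C w) * jump_prod ?Y r t w \<partial>M)"
    by (rule exponential_mean(2)[OF rt Ym _ C2, unfolded norms, OF YX_integrable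
          fin[of "\<lambda>w. exp (?E w)", OF E1], symmetric])
  also have "\<dots> = (\<integral>w. indicator A w *\<^sub>R (of_real (Z t w) * exp (?E w)) \<partial>M)"
  proof (rule Bochner_Integration.integral_cong[OF refl])
    fix w assume w: "w \<in> space M"
    have "indicator A w *\<^sub>R (of_real (Z t w) * exp (?E w)) = of_real (indicator A w * Z t w) * exp (?E w)"
      by (simp add: scaleR_conv_of_real)
    then show "exp (?E w) * of_real (C w) * jump_prod ?Y r t w = indicator A w *\<^sub>R (of_real (Z t w) * exp (?E w))"
      unfolding CZ[OF w] prods by simp
  qed
  finally show ?thesis .
qed

end

subsection \<open>Change of measure\<close>

context complete_filtered_prob_space
begin

text \<open>By completeness every subset of the exceptional null set is itself a null set of
  \<open>M\<close> and hence an event of \<open>F 0\<close>. Preimages under \<open>f\<close> and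
  \<open>g\<close> differ only by such subsets.\<close>

lemma AE_modification_measurable:
  assumes t: "0 \<le> t" and g: "g \<in> measurable (F t) N" and ae: "AE w in M. f w = g w"
    and f: "\<And>w. w \<in> space M \<Longrightarrow> f w \<in> space N"
  shows "f \<in> measurable (F t) N"
proof -
  have sp: "space (F t) = space M" using subalg[OF t] by (simp add: subalgebra_def)
  obtain E where E: "{w \<in> space M. f w \<noteq> g w} \<subseteq> E" "E \<in> null_sets M"
    using ae by (auto elim!: AE_E simp: null_sets_def)
  have sub: "D \<in> sets (F t)" if "D \<subseteq> E" for D
  proof -
    have "D \<in> sets M" using complete[OF that E(2)] .
    then have "D \<in> null_sets M" using null_sets_subset[OF E(2) _ that] by simp
    then show ?thesis using null_sets_F0 sets_mono[OF order_refl t] by auto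
  qed
  show ?thesis
  proof (rule measurableI)
    fix A assume A: "A \<in> sets N"
    have "f -` A \<inter> space (F t) = ((g -` A \<inter> space (F t)) - E) \<union> (f -` A \<inter> space M \<inter> E)"
    proof (rule set_eqI)
      fix x
      have "x \<in> space M \<Longrightarrow> x \<notin> E \<Longrightarrow> f x = g x" using E(1) by auto
      then show "x \<in> f -` A \<inter> space (F t) \<longleftrightarrow> x \<in> ((g -` A \<inter> space (F t)) - E) \<union> (f -` A \<inter> space M \<inter> E)"
        unfolding sp by (cases "x \<in> E") auto
    qed
    also have "\<dots> \<in> sets (F t)"
      using measurable_sets[OF g A] sub[of E] sub[of "f -` A \<inter> space M \<inter> E"] by auto
    finally show "f -` A \<inter> space (F t) \<in> sets (F t)" .
  qed (use f sp in auto)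
qed

lemma AE_modification_measurable_M:
  assumes g: "g \<in> measurable M N" and ae: "AE w in M. f w = g w"
    and f: "\<And>w. w \<in> space M \<Longrightarrow> f w \<in> space N"
  shows "f \<in> measurable M N"
proof -
  \<comment> \<open>The constant filtration \<open>\<lambda>_. M\<close> reduces the claim to the
    one for \<open>F t\<close>.\<close>
  interpret X: complete_filtered_prob_space M "\<lambda>_. M"
    by unfold_locales (auto simp: subalgebra_def null_sets_def)
  show ?thesis using X.AE_modification_measurable[OF order_refl g ae f] .
qed

text \<open>Two measures are involved: adaptedness of \<open>V\<close> uses that
  \<open>M\<close>-null sets belong to \<open>F 0\<close>, while the martingale property holds under
  \<open>Q\<close> and is carried over by the absolute continuity \<open>ac\<close>.\<close>

lemma martingale_modification:
  assumes Q: "finite_measure Q" "sets Q = sets M" and ac: "\<And>P. (AE w in M. P w) \<Longrightarrow> (AE w in Q. P w)"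
    and U: "martingale Q F U" and eq: "\<And>t. 0 \<le> t \<Longrightarrow> AE w in M. V t w = U t w"
  shows "martingale Q F V"
proof -
  have sQ: "subalgebra Q (F t)" if "0 \<le> t" for t
    using subalg[OF that] Q(2) sets_eq_imp_space_eq[OF Q(2)] by (simp add: subalgebra_def)
  have VF: "V t \<in> borel_measurable (F t)" if t: "0 \<le> t" for t
    using U t by (intro AE_modification_measurable[OF t _ eq[OF t]]) (auto simp: martingale_def adapted_def)
  have VQ: "V t \<in> borel_measurable Q" if t: "0 \<le> t" for t
    by (rule measurable_from_subalg[OF sQ[OF t] VF[OF t]])
  have UQ: "integrable Q (U t)" if t: "0 \<le> t" for t using U t by (auto simp: martingale_def)
  have "integrable Q (V t)" if t: "0 \<le> t" for t
    using UQ[OF t] ac[OF eq[OF t]]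
    by (subst integrable_cong_AE[OF VQ[OF t] borel_measurable_integrable[OF UQ[OF t]]]) auto
  moreover have "AE w in Q. real_cond_exp Q (F s) (V t) w = V s w" if s: "0 \<le> s" and st: "s \<le> t" for s t
  proof -
    interpret Q: finite_measure Q by (rule Q(1))
    interpret finite_measure_subalgebra Q "F s" using sQ[OF s] by unfold_locales
    have t: "0 \<le> t" using s st by simp
    have "AE w in Q. real_cond_exp Q (F s) (V t) w = real_cond_exp Q (F s) (U t) w"
      using UQ[OF t] by (intro real_cond_exp_cong ac[OF eq[OF t]] VQ[OF t]) auto
    moreover have "AE w in Q. real_cond_exp Q (F s) (U t) w = U s w"
      using U s st by (auto simp: martingale_def)
    ultimately show ?thesis
      using ac[OF eq[OF s]] by eventually_elim simp
  qed
  ultimately show ?thesis using VF by (simp add: martingale_def adapted_def)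
qed

text \<open>Here one null set has to serve all times at once, since path limits and values at the
  random times \<open>\<sigma> n\<close> enter.\<close>

lemma local_martingale_modification:
  assumes Q: "finite_measure Q" "sets Q = sets M" and ac: "\<And>P. (AE w in M. P w) \<Longrightarrow> (AE w in Q. P w)"
    and U: "local_martingale Q F U" and eq: "AE w in M. \<forall>t\<ge>0. V t w = U t w"
  shows "local_martingale Q F V"
  unfolding local_martingale_def
proof (intro conjI)
  have eqt: "AE w in M. V t w = U t w" if "0 \<le> t" for t
    using eq by eventually_elim (use that in auto)
  show "adapted F V"
    using U unfolding adapted_def local_martingale_def
    by (auto intro!: AE_modification_measurable[OF _ _ eqt])
  have "AE w in Q. \<forall>t\<ge>0. ((\<lambda>s. U s w) \<longlongrightarrow> U t w) (at_right t)"
    using U by (auto simp: local_martingale_def right_continuous_paths_def)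
  then show "right_continuous_paths Q V"
    unfolding right_continuous_paths_def using ac[OF eq]
  proof eventually_elim
    case (elim w)
    show ?case
    proof (intro allI impI)
      fix t :: real assume t: "0 \<le> t"
      have "\<forall>\<^sub>F s in at_right t. V s w = U s w"
        using eventually_at_right_less[of t] by eventually_elim (use elim t in auto)
      then show "((\<lambda>s. V s w) \<longlongrightarrow> V t w) (at_right t)"
        using elim t by (subst tendsto_cong) auto
    qed
  qed
  have "AE w in Q. \<forall>t>0. \<exists>l. ((\<lambda>s. U s w) \<longlongrightarrow> l) (at_left t)"
    using U by (auto simp: local_martingale_def left_limits_paths_def)
  then show "left_limits_paths Q V"
    unfolding left_limits_paths_def using ac[OF eq]
  proof eventually_elim
    case (elim w)
    show ?case
    proof (intro allI impI)
      fix t :: real assume t: "0 < t"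
      have "\<forall>\<^sub>F s in at_left t. 0 < s" using t by (auto simp: eventually_at_left_field)
      then have "\<forall>\<^sub>F s in at_left t. V s w = U s w" by eventually_elim (use elim t in auto)
      moreover obtain l where "((\<lambda>s. U s w) \<longlongrightarrow> l) (at_left t)" using elim t by auto
      ultimately have "((\<lambda>s. V s w) \<longlongrightarrow> l) (at_left t)" by (subst tendsto_cong) auto
      then show "\<exists>l. ((\<lambda>s. V s w) \<longlongrightarrow> l) (at_left t)" by auto
    qed
  qed
  obtain \<sigma> where \<sigma>: "\<And>n::nat. ext_stopping_time F (\<sigma> n)"
    "AE w in Q. incseq (\<lambda>n. \<sigma> n w) \<and> (\<lambda>n. \<sigma> n w) \<longlonglongrightarrow> \<infinity>"
    "\<And>n. martingale Q F (\<lambda>t w. stopped U (\<sigma> n) t w - U 0 w)"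
    using U by (auto simp: local_martingale_def)
  have "martingale Q F (\<lambda>t w. stopped V (\<sigma> n) t w - V 0 w)" for n
  proof (rule martingale_modification[OF Q ac \<sigma>(3)])
    fix t :: real
    show "AE w in M. stopped V (\<sigma> n) t w - V 0 w = stopped U (\<sigma> n) t w - U 0 w"
      using eq by eventually_elim (auto simp: stopped_def)
  qed
  then show "\<exists>\<sigma>. (\<forall>n::nat. ext_stopping_time F (\<sigma> n)) \<and>
      (AE w in Q. incseq (\<lambda>n. \<sigma> n w) \<and> (\<lambda>n. \<sigma> n w) \<longlonglongrightarrow> \<infinity>) \<and>
      (\<forall>n. martingale Q F (\<lambda>t w. stopped V (\<sigma> n) t w - V 0 w))"
    using \<sigma> by blast
qed

end

section \<open>The new measure and the counting process up to the bounded time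
  \<open>S\<close>\<close>

locale stopped_weight = weighted_jumps +
  fixes S :: "'a \<Rightarrow> real" and c :: real
  assumes S_measurable: "S \<in> borel_measurable (F 0)"
    and S_nonneg: "\<And>w. w \<in> space M \<Longrightarrow> 0 \<le> S w"
    and S_bound: "\<And>w. w \<in> space M \<Longrightarrow> S w \<le> c"
begin

definition Y_S :: "real \<Rightarrow> 'a \<Rightarrow> real" where
  "Y_S s w = (if s \<le> S w then Y s w else 1)"

lemma before_S_measurable: "{p \<in> space (borel \<Otimes>\<^sub>M F 0). fst p \<le> S (snd p)} \<in> sets (borel \<Otimes>\<^sub>M F 0)"
proof -
  note [measurable] = S_measurable
  show ?thesis by measurable
qed

lemma Y_S_measurable: "(\<lambda>p. Y_S (fst p) (snd p)) \<in> borel_measurable (borel \<Otimes>\<^sub>M F 0)"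
  unfolding Y_S_def by (rule measurable_If[OF Y_measurable _ before_S_measurable]) simp

lemma c_nonneg: "0 \<le> c"
  using not_empty S_nonneg S_bound by (meson ex_in_conv order_trans)

text \<open>Makes all results on the density available for \<open>Y_S\<close>, under the prefix
  \<open>W\<close>. The integrability of \<open>Y_S * X\<close> follows from
  \<open>Y_S * X \<le> Y * X + X\<close>.\<close>

sublocale W: weighted_jumps M F \<tau> X Y_S
proof unfold_locales
  show "(\<lambda>p. Y_S (fst p) (snd p)) \<in> borel_measurable (borel \<Otimes>\<^sub>M F 0)" by (rule Y_S_measurable)
  show "0 \<le> Y_S s w" for s w using Y_nonneg by (simp add: Y_S_def)
  fix a b w assume w: "w \<in> space M"
  have YX: "set_integrable lborel {a..b} (\<lambda>s. Y s w * X s w + X s w)"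
    using YX_integrable[OF w] X_integrable[OF w] by (rule set_integral_add)
  note [measurable] = F0_section[OF Y_S_measurable w] X_section[OF w]
  show "set_integrable lborel {a..b} (\<lambda>s. Y_S s w * X s w)"
  proof (rule set_integrable_bound[OF YX])
    show "set_borel_measurable lborel {a..b} (\<lambda>s. Y_S s w * X s w)"
      unfolding set_borel_measurable_def by measurable
    show "AE s in lborel. s \<in> {a..b} \<longrightarrow> norm (Y_S s w * X s w) \<le> norm (Y s w * X s w + X s w)"
      using Y_nonneg X_nonneg by (intro AE_I2) (auto simp: Y_S_def abs_mult)
  qed
qed

lemma density_process_at_S:
  assumes w: "w \<in> space M" and d: "S w \<le> d"
  shows "Z (S w) w = W.Z d w"
proof -
  have S0: "0 \<le> S w" by (rule S_nonneg[OF w])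
  have 1: "jump_prod Y_S 0 d w = jump_prod Y 0 (S w) w"
  proof -
    have "jump_prod Y_S 0 d w = jump_prod Y_S 0 (S w) w * jump_prod Y_S (S w) d w"
      by (rule jump_prod_split[OF order_refl S0 d w])
    moreover have "jump_prod Y_S (S w) d w = 1"
      unfolding jump_prod_def by (rule prod.neutral) (auto simp: jumps_def Y_S_def)
    moreover have "jump_prod Y_S 0 (S w) w = jump_prod Y 0 (S w) w"
      unfolding jump_prod_def by (rule prod.cong) (auto simp: jumps_def Y_S_def)
    ultimately show ?thesis by simp
  qed
  have 2: "drift Y_S 0 d w = drift Y 0 (S w) w"
    unfolding drift_def set_lebesgue_integral_def using d S0
    by (intro Bochner_Integration.integral_cong) (auto simp: indicator_def Y_S_def)
  show ?thesis by (simp add: density_process_def 1 2)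
qed

definition Q :: "'a measure" where
  "Q = density M (\<lambda>w. ennreal (Z (S w) w))"

lemma Z_S_measurable: "(\<lambda>w. Z (S w) w) \<in> borel_measurable M"
  using W.Z_measurable_M[OF c_nonneg]
  by (rule measurable_cong[THEN iffD1, rotated]) (rule density_process_at_S[OF _ S_bound, symmetric], assumption+)

text \<open>From \<open>S\<close> on the modified weight is 1, so its density process is constant
  there and any \<open>d \<ge> c\<close> describes the same measure. The freedom in \<open>d\<close>
  is needed to reach past a given time \<open>t\<close> as well.\<close>

lemma Q_eq: "c \<le> d \<Longrightarrow> Q = density M (\<lambda>w. ennreal (W.Z d w))"
proof -
  assume d: "c \<le> d"
  have "AE w in M. ennreal (Z (S w) w) = ennreal (W.Z d w)"
  proof (rule AE_I2)
    fix w assume w: "w \<in> space M"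
    have "S w \<le> d" using S_bound[OF w] d by simp
    then show "ennreal (Z (S w) w) = ennreal (W.Z d w)" by (simp add: density_process_at_S[OF w])
  qed
  then show ?thesis
    unfolding Q_def using c_nonneg d
    by (intro density_cong measurable_compose[OF _ measurable_ennreal] Z_S_measurable W.Z_measurable_M) auto
qed

lemma sets_Q[simp, measurable_cong]: "sets Q = sets M" and space_Q[simp]: "space Q = space M"
  by (simp_all add: Q_def)

lemma emeasure_Q_F0: "A \<in> sets (F 0) \<Longrightarrow> emeasure Q A = emeasure M A"
proof -
  assume A: "A \<in> sets (F 0)"
  have AM[measurable]: "A \<in> sets M" by (rule sets_F_M[OF order_refl A])
  have "emeasure Q A = (\<integral>\<^sup>+w. ennreal (W.Z c w) * indicator A w \<partial>M)"
    unfolding Q_eq[OF order_refl] using W.Z_measurable_M[OF c_nonneg]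
    by (intro emeasure_density AM) measurable
  also have "\<dots> = (\<integral>\<^sup>+w. ennreal (indicator A w * W.Z c w) \<partial>M)"
    by (intro nn_integral_cong) (auto simp: indicator_def)
  also have "\<dots> = emeasure M A" by (rule W.nn_integral_Z_F0[OF c_nonneg A])
  finally show ?thesis .
qed

lemma prob_space_Q: "prob_space Q"
  using emeasure_Q_F0[of "space M"] sets.top[of "F 0"] by (intro prob_spaceI) (simp add: emeasure_space_1)

lemma AE_Q: "AE w in M. P w \<Longrightarrow> AE w in Q. P w"
  unfolding Q_def using Z_S_measurable
  by (subst AE_density) (auto elim: eventually_mono)

lemma integral_Q:
  fixes f :: "'a \<Rightarrow> 'b::{banach, second_countable_topology}"
  assumes "c \<le> d" and f: "f \<in> borel_measurable M"
  shows "(\<integral>w. f w \<partial>Q) = (\<integral>w. W.Z d w *\<^sub>R f w \<partial>M)"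
  unfolding Q_eq[OF assms(1)] using W.Z_nonneg W.Z_measurable_M[of d] c_nonneg assms
  by (intro integral_density) auto

definition stopped_jumps :: "real \<Rightarrow> real \<Rightarrow> 'a \<Rightarrow> nat set" where
  "stopped_jumps r t w = jumps (min r (S w)) (min t (S w)) w"

definition stopped_cum :: "real \<Rightarrow> real \<Rightarrow> 'a \<Rightarrow> real" where
  "stopped_cum r t w = (LBINT s:{min r (S w)..min t (S w)}. Y s w * X s w)"

lemma finite_stopped_jumps: "0 \<le> r \<Longrightarrow> w \<in> space M \<Longrightarrow> finite (stopped_jumps r t w)"
  unfolding stopped_jumps_def using S_nonneg by (intro finite_jumps) auto

lemma stopped_jumps_split:
  assumes "0 \<le> s" "s \<le> t" "w \<in> space M"
  shows "card (stopped_jumps 0 t w) = card (stopped_jumps 0 s w) + card (stopped_jumps s t w)"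
proof -
  have "min 0 (S w) \<le> min s (S w)" "min s (S w) \<le> min t (S w)" using assms S_nonneg by auto
  from jumps_split[OF this, of w] show ?thesis
    using assms finite_stopped_jumps[of _ w] unfolding stopped_jumps_def
    by (simp add: card_Un_disjoint)
qed

lemma YX_measurable: "(\<lambda>p. Y (fst p) (snd p) * X (fst p) (snd p)) \<in> borel_measurable (borel \<Otimes>\<^sub>M F 0)"
  using Y_measurable X_measurable by (rule borel_measurable_times)

lemma stopped_cum_measurable: "stopped_cum r t \<in> borel_measurable (F 0)"
  unfolding stopped_cum_def[abs_def] using S_measurable
  by (intro borel_measurable_LBINT_section[OF YX_measurable]) auto

lemma stopped_cum_nonneg: "0 \<le> stopped_cum r t w"
  unfolding stopped_cum_def set_lebesgue_integral_def using X_nonneg Y_nonneg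
  by (intro integral_nonneg_AE) auto

lemma stopped_cum_split:
  assumes "0 \<le> s" "s \<le> t" "w \<in> space M"
  shows "stopped_cum 0 t w = stopped_cum 0 s w + stopped_cum s t w"
  unfolding stopped_cum_def using assms S_nonneg[OF assms(3)]
  by (intro LBINT_Icc_combine YX_integrable) auto

lemma stopped_cum_le:
  assumes "0 \<le> r" "w \<in> space M"
  shows "stopped_cum r t w \<le> (LBINT s:{0..c}. Y s w * X s w)"
  unfolding stopped_cum_def set_lebesgue_integral_def
proof (rule integral_mono)
  show "integrable lborel (\<lambda>s. indicator {a..b} s *\<^sub>R (Y s w * X s w))" for a b
    using YX_integrable[OF assms(2)] unfolding set_integrable_def .
  then show "integrable lborel (\<lambda>s. indicator {a..b} s *\<^sub>R (Y s w * X s w))" for a b .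
  show "indicator {min r (S w)..min t (S w)} s *\<^sub>R (Y s w * X s w) \<le> indicator {0..c} s *\<^sub>R (Y s w * X s w)" for s
    using X_nonneg Y_nonneg S_nonneg[OF assms(2)] S_bound[OF assms(2)] assms(1)
    by (auto simp: indicator_def)
qed

lemma stopped_jumps_measurable_M: "(\<lambda>w. card (stopped_jumps r t w)) \<in> measurable M (count_space UNIV)"
proof (rule measurable_card)
  have [measurable]: "S \<in> borel_measurable M" by (rule measurable_F_M[OF order_refl S_measurable])
  show "{w \<in> space M. n \<in> stopped_jumps r t w} \<in> sets M" for n
    unfolding stopped_jumps_def jumps_def by simp measurable
qed

text \<open>Whether a jump happens before \<open>S\<close> is decided at the jump time, because
  \<open>S\<close> is \<open>F 0\<close>-measurable: the indicator of \<open>s \<le> S w\<close> is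
  an \<open>F 0\<close>-process and may be evaluated at the jump time.\<close>

lemma stopped_jumps_adapted:
  assumes t: "0 \<le> t" shows "(\<lambda>w. card (stopped_jumps 0 t w)) \<in> measurable (F t) (count_space UNIV)"
proof (rule measurable_card)
  fix n
  have g: "(\<lambda>p. if fst p \<le> S (snd p) then 1 else 0 :: real) \<in> borel_measurable (borel \<Otimes>\<^sub>M F 0)"
    by (rule measurable_If[OF _ _ before_S_measurable]) auto
  have "(\<lambda>w. if 0 < \<tau> n w \<and> \<tau> n w \<le> t then (if \<tau> n w \<le> S w then 1 else 0) else 0 :: real) \<in> borel_measurable (F t)"
    using F0_jump_measurable[of "\<lambda>s w. if s \<le> S w then 1 else 0 :: real" 0 t n 0] g t by simp
  from measurable_sets[OF this, of "{1}"]
  have "(\<lambda>w. if 0 < \<tau> n w \<and> \<tau> n w \<le> t then (if \<tau> n w \<le> S w then 1 else 0) else 0 :: real) -` {1} \<inter> space (F t) \<in> sets (F t)"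
    by simp
  also have "(\<lambda>w. if 0 < \<tau> n w \<and> \<tau> n w \<le> t then (if \<tau> n w \<le> S w then 1 else 0) else 0 :: real) -` {1} \<inter> space (F t)
    = {w \<in> space (F t). n \<in> stopped_jumps 0 t w}"
    using t S_nonneg by (auto simp: stopped_jumps_def jumps_def split: if_splits)
  finally show "{w \<in> space (F t). n \<in> stopped_jumps 0 t w} \<in> sets (F t)" .
qed

text \<open>Over the deterministic interval \<open>(r,d]\<close> the phase contributes
  \<open>iexp u\<close> for each jump counted by \<open>stopped_jumps r t\<close> and 1 for the
  others, while \<open>W.Z d\<close> is the density of \<open>Q\<close>. Hence both integrals under
  \<open>Q\<close> are instances of the phase formula under \<open>M\<close>.\<close>

lemma stopped_char:
  assumes rt: "0 \<le> r" "r \<le> t" and A: "A \<in> sets (F r)"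
  shows "(\<integral>w. indicator A w *\<^sub>R iexp (u * real (card (stopped_jumps r t w))) \<partial>Q)
    = (\<integral>w. indicator A w *\<^sub>R exp ((iexp u - 1) * of_real (stopped_cum r t w)) \<partial>Q)"
proof -
  define d where "d = max c t"
  have d: "c \<le> d" "t \<le> d" "r \<le> d" using rt by (auto simp: d_def)
  \<comment> \<open>Only an upper cut is required: product and integral start at \<open>r\<close>,
    and if \<open>S w < r\<close> the phase is 1 on all of \<open>{r..d}\<close>.\<close>
  define \<phi> :: "real \<Rightarrow> 'a \<Rightarrow> complex" where "\<phi> s w = (if s \<le> min t (S w) then iexp u else 1)" for s w
  have \<phi>m: "(\<lambda>p. \<phi> (fst p) (snd p)) \<in> borel_measurable (borel \<Otimes>\<^sub>M F 0)"
  proof -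
    note [measurable] = S_measurable
    show ?thesis unfolding \<phi>_def by measurable
  qed
  have AM: "A \<in> sets M" by (rule sets_F_M[OF rt(1) A])
  have prod: "jump_prod \<phi> r d w = iexp (u * real (card (stopped_jumps r t w)))" if w: "w \<in> space M" for w
  proof -
    have "jump_prod \<phi> r d w = (\<Prod>n\<in>jumps r d w. if n \<in> stopped_jumps r t w then iexp u else 1)"
      unfolding jump_prod_def
      by (intro prod.cong) (auto simp: \<phi>_def stopped_jumps_def jumps_def)
    also have "\<dots> = (\<Prod>n\<in>jumps r d w \<inter> stopped_jumps r t w. iexp u)"
      using finite_jumps[OF rt(1) w] by (rule prod.inter_restrict[symmetric])
    also have "jumps r d w \<inter> stopped_jumps r t w = stopped_jumps r t w"
      using d by (auto simp: stopped_jumps_def jumps_def)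
    also have "(\<Prod>n\<in>stopped_jumps r t w. iexp u) = exp (of_nat (card (stopped_jumps r t w)) * (\<i> * of_real u))"
      by (simp add: exp_of_nat_mult)
    finally show ?thesis by (simp add: mult_ac)
  qed
  have cum: "(LBINT s:{r..d}. (\<phi> s w - 1) * of_real (Y_S s w * X s w))
      = (iexp u - 1) * of_real (stopped_cum r t w)" if w: "w \<in> space M" for w
  proof -
    have "(LBINT s:{r..d}. (\<phi> s w - 1) * of_real (Y_S s w * X s w))
      = (LBINT s:{min r (S w)..min t (S w)}. (iexp u - 1) * of_real (Y s w * X s w))"
      unfolding set_lebesgue_integral_def
    proof (rule integral_cong_AE)
      note [measurable] = F0_section[OF \<phi>m w] F0_section[OF Y_S_measurable w] F0_section[OF Y_measurable w] X_section[OF w]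
      show "(\<lambda>s. indicator {r..d} s *\<^sub>R ((\<phi> s w - 1) * of_real (Y_S s w * X s w))) \<in> borel_measurable lborel" by measurable
      show "(\<lambda>s. indicator {min r (S w)..min t (S w)} s *\<^sub>R ((iexp u - 1) * of_real (Y s w * X s w)))
        \<in> borel_measurable lborel" by measurable
      show "AE s in lborel. indicator {r..d} s *\<^sub>R ((\<phi> s w - 1) * of_real (Y_S s w * X s w))
        = indicator {min r (S w)..min t (S w)} s *\<^sub>R ((iexp u - 1) * of_real (Y s w * X s w))"
        \<comment> \<open>If \<open>S w < r\<close>, the right-hand interval shrinks to the point
          \<open>S w\<close>, where the integrands may differ.\<close>
        using AE_lborel_singleton[of "S w"]
        by eventually_elim (use d in \<open>auto simp: \<phi>_def Y_S_def indicator_def\<close>)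
    qed
    then show ?thesis
      by (simp add: stopped_cum_def set_integral_complex_of_real del: of_real_mult)
  qed
  have phase: "norm (\<phi> s w) = 1" for s w by (simp add: \<phi>_def)
  have m1: "(\<lambda>w. indicator A w *\<^sub>R iexp (u * real (card (stopped_jumps r t w)))) \<in> borel_measurable M"
    using stopped_jumps_measurable_M[of r t] AM by measurable
  have m2: "(\<lambda>w. indicator A w *\<^sub>R exp ((iexp u - 1) * of_real (stopped_cum r t w))) \<in> borel_measurable M"
    using measurable_F_M[OF order_refl stopped_cum_measurable[of r t]] AM by measurable
  have "(\<integral>w. indicator A w *\<^sub>R iexp (u * real (card (stopped_jumps r t w))) \<partial>Q)
    = (\<integral>w. indicator A w *\<^sub>R (of_real (W.Z d w) * jump_prod \<phi> r d w) \<partial>M)"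
    unfolding integral_Q[OF d(1) m1]
    by (intro Bochner_Integration.integral_cong refl) (simp add: prod scaleR_conv_of_real mult_ac)
  also have "\<dots> = (\<integral>w. indicator A w *\<^sub>R (of_real (W.Z d w) * exp (LBINT s:{r..d}. (\<phi> s w - 1) * of_real (Y_S s w * X s w))) \<partial>M)"
    by (rule W.phase_integral[OF rt(1) d(3) A \<phi>m phase])
  also have "\<dots> = (\<integral>w. indicator A w *\<^sub>R exp ((iexp u - 1) * of_real (stopped_cum r t w)) \<partial>Q)"
    unfolding integral_Q[OF d(1) m2]
  proof (intro Bochner_Integration.integral_cong refl)
    fix w assume w: "w \<in> space M"
    show "indicator A w *\<^sub>R (of_real (W.Z d w) * exp (LBINT s:{r..d}. (\<phi> s w - 1) * of_real (Y_S s w * X s w)))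
      = W.Z d w *\<^sub>R (indicator A w *\<^sub>R exp ((iexp u - 1) * of_real (stopped_cum r t w)))"
      unfolding cum[OF w] by (simp add: scaleR_conv_of_real mult_ac)
  qed
  finally show ?thesis .
qed

lemma subalgebra_Q: "0 \<le> t \<Longrightarrow> subalgebra Q (F t)"
  using subalg[of t] by (simp add: subalgebra_def)

lemma stopped_cond_char:
  assumes rt: "0 \<le> r" "r \<le> t"
  shows "AE w in Q. complex_cond_exp Q (F r) (\<lambda>w. iexp (u * real (card (stopped_jumps r t w)))) w
    = exp ((iexp u - 1) * of_real (stopped_cum r t w))"
proof -
  interpret Q: prob_space Q by (rule prob_space_Q)
  interpret finite_measure_subalgebra Q "F r" using subalgebra_Q[OF rt(1)] by unfold_locales
  have gF: "(\<lambda>w. exp ((iexp u - 1) * of_real (stopped_cum r t w))) \<in> borel_measurable (F r)"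
    using measurable_F_mono[OF order_refl rt(1) stopped_cum_measurable[of r t]] by measurable
  show ?thesis
  proof (rule complex_cond_exp_eqI)
    show "integrable Q (\<lambda>w. iexp (u * real (card (stopped_jumps r t w))))"
      using stopped_jumps_measurable_M[of r t]
      by (intro Q.integrable_const_bound[where B = 1]) (auto simp del: of_real_mult)
    have le: "norm (exp ((iexp u - 1) * of_real (stopped_cum r t w))) \<le> 1" for w
      using stopped_cum_nonneg[of r t w] by (simp add: Re_exp mult_nonpos_nonneg)
    show "integrable Q (\<lambda>w. exp ((iexp u - 1) * of_real (stopped_cum r t w)))"
      using measurable_from_subalg[OF subalgebra_Q[OF rt(1)] gF] le
      by (intro Q.integrable_const_bound[where B = 1]) auto
  qed (use gF stopped_char[OF rt] in auto)
qed

lemma stopped_mean: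
  assumes rt: "0 \<le> r" "r \<le> t" and A: "A \<in> sets (F r)"
  shows "(\<integral>\<^sup>+w. indicator A w * ennreal (real (card (stopped_jumps r t w))) \<partial>Q)
    = (\<integral>\<^sup>+w. indicator A w * ennreal (stopped_cum r t w) \<partial>Q)"
proof -
  interpret Q: prob_space Q by (rule prob_space_Q)
  show ?thesis
  proof (rule Q.nn_integral_mixed_poisson_mean)
    show "(\<lambda>w. card (stopped_jumps r t w)) \<in> measurable Q (count_space UNIV)"
      using stopped_jumps_measurable_M[of r t] by (simp cong: measurable_cong_sets)
    show "stopped_cum r t \<in> borel_measurable Q"
      using measurable_F_M[OF order_refl stopped_cum_measurable[of r t]] by (simp cong: measurable_cong_sets)
    show "A \<in> sets Q" using sets_F_M[OF rt(1) A] by simp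
  qed (use stopped_cum_nonneg stopped_char[OF rt A] in auto)
qed

definition compensated :: "real \<Rightarrow> 'a \<Rightarrow> real" where
  "compensated t w = real (card (stopped_jumps 0 t w)) - stopped_cum 0 t w"

text \<open>The compensator up to the bound \<open>c\<close> is \<open>F 0\<close>-measurable, so
  the localisation can be decided at time 0 by an event; this replaces the usual hitting times of
  the compensator.\<close>

definition localizer :: "nat \<Rightarrow> 'a set" where
  "localizer n = {w \<in> space M. (LBINT s:{0..c}. Y s w * X s w) \<le> real n}"

lemma localizer_F0: "localizer n \<in> sets (F 0)"
proof -
  have "(\<lambda>w. LBINT s:{0..c}. Y s w * X s w) \<in> borel_measurable (F 0)"
    by (rule borel_measurable_LBINT_section[OF YX_measurable]) auto
  from borel_measurable_le[OF this, of "\<lambda>_. real n"] show ?thesis by (simp add: localizer_def)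
qed

lemma localizer_F: "0 \<le> t \<Longrightarrow> localizer n \<in> sets (F t)"
  using localizer_F0 sets_mono[of 0 t] by auto

lemma compensated_adapted: "0 \<le> t \<Longrightarrow> compensated t \<in> borel_measurable (F t)"
proof -
  assume t: "0 \<le> t"
  note [measurable] = stopped_jumps_adapted[OF t] measurable_F_mono[OF order_refl t stopped_cum_measurable[of 0 t]]
  show ?thesis unfolding compensated_def[abs_def] by measurable
qed

lemma localized_integrable:
  assumes rt: "0 \<le> r" "r \<le> t"
  shows "integrable Q (\<lambda>w. indicator (localizer n) w * real (card (stopped_jumps r t w)))"
    and "integrable Q (\<lambda>w. indicator (localizer n) w * stopped_cum r t w)"
proof -
  interpret Q: prob_space Q by (rule prob_space_Q)
  have LM[measurable]: "localizer n \<in> sets M" by (rule sets_F_M[OF order_refl localizer_F0])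
  note [measurable] = stopped_jumps_measurable_M[of r t] measurable_F_M[OF order_refl stopped_cum_measurable[of r t]]
  have fin: "(\<integral>\<^sup>+w. indicator (localizer n) w * ennreal (stopped_cum r t w) \<partial>Q) < \<infinity>"
  proof -
    have "(\<integral>\<^sup>+w. indicator (localizer n) w * ennreal (stopped_cum r t w) \<partial>Q) \<le> (\<integral>\<^sup>+w. ennreal (real n) \<partial>Q)"
      using stopped_cum_le[OF rt(1), of _ t]
      by (intro nn_integral_mono) (force simp: indicator_def localizer_def intro: ennreal_leI)
    also have "\<dots> < \<infinity>" by (simp add: Q.emeasure_space_1[simplified])
    finally show ?thesis .
  qed
  have e: "ennreal (indicator (localizer n) w * x) = indicator (localizer n) w * ennreal x" for w x
    by (auto simp: indicator_def)
  show "integrable Q (\<lambda>w. indicator (localizer n) w * real (card (stopped_jumps r t w)))"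
    using fin stopped_mean[OF rt localizer_F[OF rt(1), of n]]
    by (intro integrableI_nonneg) (auto simp: e simp del: ennreal_of_nat_eq_real_of_nat)
  show "integrable Q (\<lambda>w. indicator (localizer n) w * stopped_cum r t w)"
    using fin stopped_cum_nonneg by (intro integrableI_nonneg) (auto simp: e)
qed

text \<open>For \<open>A\<close> in \<open>F s\<close> the set \<open>A \<inter> localizer n\<close>
  is again in \<open>F s\<close>, so the mean of the increment under \<open>Q\<close> applies on it.
  On the localizer count and compensator have finite means, and the identity of non-negative
  integrals becomes a vanishing difference.\<close>

lemma localized_martingale: "martingale Q F (\<lambda>t w. indicator (localizer n) w * compensated t w)"
proof -
  have adapt: "(\<lambda>w. indicator (localizer n) w * compensated t w) \<in> borel_measurable (F t)" if t: "0 \<le> t" for t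
    using compensated_adapted[OF t] localizer_F[OF t, of n] by measurable
  have int: "integrable Q (\<lambda>w. indicator (localizer n) w * compensated t w)" if t: "0 \<le> t" for t
    unfolding compensated_def right_diff_distrib
    by (intro Bochner_Integration.integrable_diff localized_integrable t order_refl)
  have cond: "AE w in Q. real_cond_exp Q (F s) (\<lambda>w. indicator (localizer n) w * compensated t w) w
    = indicator (localizer n) w * compensated s w" if s: "0 \<le> s" "s \<le> t" for s t
  proof -
    interpret Q: prob_space Q by (rule prob_space_Q)
    interpret finite_measure_subalgebra Q "F s" using subalgebra_Q[OF s(1)] by unfold_locales
    show ?thesis
    proof (rule real_cond_exp_charact)
      fix A assume A: "A \<in> sets (F s)"
      let ?B = "A \<inter> localizer n"
      have B: "?B \<in> sets (F s)" using A localizer_F[OF s(1)] by auto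
      have AQ: "A \<in> sets Q" using sets_F_M[OF s(1) A] by simp
      have ind: "indicator ?B w * x = indicator A w *\<^sub>R (indicator (localizer n) w * x)" for w and x :: real
        by (auto simp: indicator_def)
      have i1: "integrable Q (\<lambda>w. indicator ?B w * real (card (stopped_jumps s t w)))"
        and i2: "integrable Q (\<lambda>w. indicator ?B w * stopped_cum s t w)"
        unfolding ind by (intro integrable_mult_indicator[OF AQ] localized_integrable s)+
      have iA: "integrable Q (\<lambda>w. indicator A w *\<^sub>R (indicator (localizer n) w * compensated u w))" if "0 \<le> u" for u
        by (rule integrable_mult_indicator[OF AQ int[OF that]])
      have e: "ennreal (indicator ?B w * x) = indicator ?B w * ennreal x" for w x
        by (auto simp: indicator_def)
      have "ennreal (\<integral>w. indicator ?B w * real (card (stopped_jumps s t w)) \<partial>Q)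
        = (\<integral>\<^sup>+w. ennreal (indicator ?B w * real (card (stopped_jumps s t w))) \<partial>Q)"
        by (intro nn_integral_eq_integral[symmetric] i1) auto
      also have "\<dots> = (\<integral>\<^sup>+w. ennreal (indicator ?B w * stopped_cum s t w) \<partial>Q)"
        unfolding e by (rule stopped_mean[OF s B])
      also have "\<dots> = ennreal (\<integral>w. indicator ?B w * stopped_cum s t w \<partial>Q)"
        using stopped_cum_nonneg by (intro nn_integral_eq_integral i2) auto
      finally have eq: "(\<integral>w. indicator ?B w * real (card (stopped_jumps s t w)) \<partial>Q)
        = (\<integral>w. indicator ?B w * stopped_cum s t w \<partial>Q)"
        using stopped_cum_nonneg by (subst (asm) ennreal_inj) (auto intro!: integral_nonneg_AE)
      have "(\<integral>w\<in>A. indicator (localizer n) w * compensated t w \<partial>Q) - (\<integral>w\<in>A. indicator (localizer n) w * compensated s w \<partial>Q)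
        = (\<integral>w. indicator A w *\<^sub>R (indicator (localizer n) w * compensated t w) - indicator A w *\<^sub>R (indicator (localizer n) w * compensated s w) \<partial>Q)"
        unfolding set_lebesgue_integral_def
        using s by (intro Bochner_Integration.integral_diff[symmetric] iA) auto
      also have "\<dots> = (\<integral>w. indicator ?B w * real (card (stopped_jumps s t w)) - indicator ?B w * stopped_cum s t w \<partial>Q)"
      proof (rule Bochner_Integration.integral_cong[OF refl])
        fix w assume "w \<in> space Q"
        then have w: "w \<in> space M" by simp
        show "indicator A w *\<^sub>R (indicator (localizer n) w * compensated t w) - indicator A w *\<^sub>R (indicator (localizer n) w * compensated s w)
          = indicator ?B w * real (card (stopped_jumps s t w)) - indicator ?B w * stopped_cum s t w"
          by (auto simp: compensated_def stopped_jumps_split[OF s w] stopped_cum_split[OF s w] indicator_def)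
      qed
      also have "\<dots> = 0" using i1 i2 eq by (subst Bochner_Integration.integral_diff) auto
      finally show "(\<integral>w\<in>A. indicator (localizer n) w * compensated t w \<partial>Q) = (\<integral>w\<in>A. indicator (localizer n) w * compensated s w \<partial>Q)"
        by simp
    qed (use s int adapt in auto)
  qed
  show ?thesis using adapt int cond by (simp add: martingale_def adapted_def)
qed

lemma compensated_0: "w \<in> space M \<Longrightarrow> compensated 0 w = 0"
proof -
  assume w: "w \<in> space M"
  have "stopped_jumps 0 0 w = {}" by (auto simp: stopped_jumps_def jumps_def)
  moreover have "stopped_cum 0 0 w = 0"
    using stopped_cum_split[OF order_refl order_refl w] by simp
  ultimately show ?thesis by (simp add: compensated_def)
qed

text \<open>Up to \<open>S w\<close> the path is a counting function minus a continuous integral,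
  and afterwards it is constant. The cases split at \<open>S w \<le> t\<close> on the right but at
  \<open>S w < t\<close> on the left, because a left neighbourhood of \<open>S w\<close> still lies
  before \<open>S w\<close>.\<close>

lemma compensated_limits:
  assumes w: "w \<in> space M"
  shows compensated_right: "0 \<le> t \<Longrightarrow> ((\<lambda>s. compensated s w) \<longlongrightarrow> compensated t w) (at_right t)"
    and compensated_left: "0 < t \<Longrightarrow> \<exists>l. ((\<lambda>s. compensated s w) \<longlongrightarrow> l) (at_left t)"
proof -
  have S0: "0 \<le> S w" by (rule S_nonneg[OF w])
  let ?f = "\<lambda>s. real (card (jumps 0 s w)) - (LBINT u:{0..s}. Y u w * X u w)"
  have cf: "compensated s w = ?f (min s (S w))" for s
    using S0 by (simp add: compensated_def stopped_jumps_def stopped_cum_def)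
  show "((\<lambda>s. compensated s w) \<longlongrightarrow> compensated t w) (at_right t)" if t: "0 \<le> t"
  proof (cases "S w \<le> t")
    case True
    have "\<forall>\<^sub>F s in at_right t. compensated s w = compensated t w"
      using eventually_at_right_less[of t] by eventually_elim (use True in \<open>simp add: cf min_absorb2\<close>)
    then show ?thesis by (rule tendsto_eventually)
  next
    case False
    have "\<forall>\<^sub>F s in at_right t. real (card (jumps 0 s w)) = real (card (jumps 0 t w))"
      using eventually_jumps_right[OF t w] by eventually_elim simp
    then have "((\<lambda>s. real (card (jumps 0 s w))) \<longlongrightarrow> real (card (jumps 0 t w))) (at_right t)"
      by (rule tendsto_eventually)
    then have lim: "(?f \<longlongrightarrow> ?f t) (at_right t)"
      by (intro tendsto_diff LBINT_tendsto_right[OF YX_integrable[OF w] t])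
    have "\<forall>\<^sub>F s in at_right t. s < S w" using False by (auto simp: eventually_at_right_field intro!: exI[of _ "S w"])
    then have "\<forall>\<^sub>F s in at_right t. compensated s w = ?f s" by eventually_elim (simp add: cf)
    then show ?thesis using lim False by (subst tendsto_cong) (auto simp: cf)
  qed
  show "\<exists>l. ((\<lambda>s. compensated s w) \<longlongrightarrow> l) (at_left t)" if t: "0 < t"
  proof (cases "S w < t")
    case True
    have "\<forall>\<^sub>F s in at_left t. S w < s" using True by (auto simp: eventually_at_left_field)
    then have "\<forall>\<^sub>F s in at_left t. compensated s w = compensated t w"
      by eventually_elim (use True in \<open>simp add: cf min_absorb2\<close>)
    then show ?thesis by (blast intro: tendsto_eventually)
  next
    case False
    have "\<forall>\<^sub>F s in at_left t. real (card (jumps 0 s w)) = real (card {n. 0 < \<tau> n w \<and> \<tau> n w < t})"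
      using eventually_jumps_left[OF t w] by eventually_elim simp
    then have "((\<lambda>s. real (card (jumps 0 s w))) \<longlongrightarrow> real (card {n. 0 < \<tau> n w \<and> \<tau> n w < t})) (at_left t)"
      by (rule tendsto_eventually)
    then have lim: "(?f \<longlongrightarrow> real (card {n. 0 < \<tau> n w \<and> \<tau> n w < t}) - (LBINT u:{0..t}. Y u w * X u w)) (at_left t)"
      by (intro tendsto_diff LBINT_tendsto_left[OF YX_integrable[OF w] t])
    have "\<forall>\<^sub>F s in at_left t. s < t" by (auto simp: eventually_at_left_field intro!: exI[of _ "t - 1"])
    then have "\<forall>\<^sub>F s in at_left t. compensated s w = ?f s" by eventually_elim (use False in \<open>simp add: cf\<close>)
    then have "((\<lambda>s. compensated s w) \<longlongrightarrow> real (card {n. 0 < \<tau> n w \<and> \<tau> n w < t}) - (LBINT u:{0..t}. Y u w * X u w)) (at_left t)"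
      using lim by (subst tendsto_cong) auto
    then show ?thesis by blast
  qed
qed

text \<open>The localising times are \<open>\<infinity>\<close> on \<open>localizer n\<close> and 0
  elsewhere. As the process starts at 0, stopping it there amounts to multiplying it by the
  indicator of the event.\<close>

lemma local_martingale_compensated: "local_martingale Q F compensated"
  unfolding local_martingale_def
proof (intro conjI exI[of _ "\<lambda>n w. if w \<in> localizer n then \<infinity> else 0"] allI)
  interpret Q: prob_space Q by (rule prob_space_Q)
  show "adapted F compensated" by (simp add: adapted_def compensated_adapted)
  show "right_continuous_paths Q compensated"
    unfolding right_continuous_paths_def using compensated_right by (intro AE_I2) auto
  show "left_limits_paths Q compensated"
    unfolding left_limits_paths_def using compensated_left by (intro AE_I2) auto
  show "ext_stopping_time F (\<lambda>w. if w \<in> localizer n then \<infinity> else 0)" for n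
    unfolding ext_stopping_time_def
  proof (intro allI impI)
    fix t :: real assume t: "0 \<le> t"
    have "{w \<in> space (F t). (if w \<in> localizer n then \<infinity> else 0) \<le> ennreal t} = space (F t) - localizer n"
      by (auto simp: top_unique split: if_splits)
    also have "\<dots> \<in> sets (F t)" using localizer_F[OF t] by auto
    finally show "Measurable.pred (F t) (\<lambda>w. (if w \<in> localizer n then \<infinity> else 0) \<le> ennreal t)"
      by (simp add: pred_def)
  qed
  show "AE w in Q. incseq (\<lambda>n. if w \<in> localizer n then \<infinity> else 0 :: ennreal) \<and>
      (\<lambda>n. if w \<in> localizer n then \<infinity> else 0 :: ennreal) \<longlonglongrightarrow> \<infinity>"
  proof (rule AE_I2, rule conjI)
    fix w assume "w \<in> space Q"
    then have w: "w \<in> space M" by simp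
    show "incseq (\<lambda>n. if w \<in> localizer n then \<infinity> else 0 :: ennreal)"
      by (rule incseq_SucI) (auto simp: localizer_def)
    obtain k where k: "(LBINT s:{0..c}. Y s w * X s w) \<le> real k" using real_arch_simple by blast
    have "\<forall>\<^sub>F n in sequentially. (if w \<in> localizer n then \<infinity> else 0 :: ennreal) = \<infinity>"
      using eventually_ge_at_top[of k] by eventually_elim (use w k in \<open>auto simp: localizer_def\<close>)
    then show "(\<lambda>n. if w \<in> localizer n then \<infinity> else 0 :: ennreal) \<longlonglongrightarrow> \<infinity>"
      by (rule tendsto_eventually)
  qed
  show "martingale Q F (\<lambda>t w. stopped compensated (\<lambda>w. if w \<in> localizer n then \<infinity> else 0) t w - compensated 0 w)" for n
  proof (rule martingale_modification[OF _ _ AE_Q localized_martingale[of n]])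
    fix t :: real assume "0 \<le> t"
    then show "AE w in M. stopped compensated (\<lambda>w. if w \<in> localizer n then \<infinity> else 0) t w - compensated 0 w
      = indicator (localizer n) w * compensated t w"
      by (intro AE_I2) (auto simp: stopped_def compensated_0 indicator_def)
  qed (unfold_locales, auto)
qed

end

subsection \<open>Removing the exceptional null set\<close>

lemma (in sigma_finite_subalgebra) complex_cond_exp_cong:
  assumes ae: "AE x in M. f x = g x" and [measurable]: "f \<in> borel_measurable M" "g \<in> borel_measurable M"
  shows "AE x in M. complex_cond_exp M F f x = complex_cond_exp M F g x"
proof -
  have "AE x in M. real_cond_exp M F (\<lambda>x. Re (f x)) x = real_cond_exp M F (\<lambda>x. Re (g x)) x"
    using ae by (intro real_cond_exp_cong) (auto elim: eventually_mono)
  moreover have "AE x in M. real_cond_exp M F (\<lambda>x. Im (f x)) x = real_cond_exp M F (\<lambda>x. Im (g x)) x"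
    using ae by (intro real_cond_exp_cong) (auto elim: eventually_mono)
  ultimately show ?thesis by eventually_elim (simp add: complex_cond_exp_def)
qed

lemma
  fixes P :: "nat \<Rightarrow> bool"
  defines "s \<equiv> (\<Sum>n. if P n then 1 else 0 :: ennreal)"
  shows finite_of_suminf_indicator: "s < \<infinity> \<Longrightarrow> finite {n. P n}"
    and suminf_indicator_eq_card: "finite {n. P n} \<Longrightarrow> s = of_nat (card {n. P n})"
proof -
  have "s = (\<integral>\<^sup>+n. indicator {n. P n} n \<partial>count_space UNIV)"
    by (simp add: s_def nn_integral_count_space_nat indicator_def of_bool_def)
  also have "\<dots> = emeasure (count_space UNIV) {n. P n}" by simp
  finally have s: "s = emeasure (count_space UNIV) {n. P n}" .
  show "finite {n. P n} \<Longrightarrow> s = of_nat (card {n. P n})" unfolding s by simp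
  show "s < \<infinity> \<Longrightarrow> finite {n. P n}"
    unfolding s by (rule ccontr) simp
qed

text \<open>The given process is measurable on the half line only. Composition with
  \<open>max 0\<close> yields a measurable function of all times that agrees with \<open>f\<close>
  wherever the result is not set to 0.\<close>

lemma restricted_measurable_extend:
  fixes f :: "real \<Rightarrow> 'a \<Rightarrow> real"
  assumes f: "(\<lambda>(s, w). f s w) \<in> borel_measurable (restrict_space borel {0..} \<Otimes>\<^sub>M N)"
    and E: "E \<in> sets N"
  shows "(\<lambda>p. if 0 \<le> fst p \<and> snd p \<in> E then f (fst p) (snd p) else 0) \<in> borel_measurable (borel \<Otimes>\<^sub>M N)"
proof -
  have "(\<lambda>p. max 0 (fst p)) \<in> measurable (borel \<Otimes>\<^sub>M N) (restrict_space (borel :: real measure) {0..})"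
    by (intro measurable_restrict_space2) auto
  then have "(\<lambda>p. (max 0 (fst p), snd p)) \<in> measurable (borel \<Otimes>\<^sub>M N) (restrict_space (borel :: real measure) {0..} \<Otimes>\<^sub>M N)"
    by (intro measurable_Pair) auto
  from measurable_compose[OF this f]
  have [measurable]: "(\<lambda>p. f (max 0 (fst p)) (snd p)) \<in> borel_measurable (borel \<Otimes>\<^sub>M N)" by simp
  note [measurable] = E
  have "(\<lambda>p. if 0 \<le> fst p \<and> snd p \<in> E then f (max 0 (fst p)) (snd p) else 0) \<in> borel_measurable (borel \<Otimes>\<^sub>M N)"
    by measurable
  also have "(\<lambda>p. if 0 \<le> fst p \<and> snd p \<in> E then f (max 0 (fst p)) (snd p) else 0)
    = (\<lambda>p. if 0 \<le> fst p \<and> snd p \<in> E then f (fst p) (snd p) else 0)"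
    by (auto simp: fun_eq_iff max_def)
  finally show ?thesis .
qed

lemma set_integrable_of_nn_finite:
  fixes f :: "real \<Rightarrow> real"
  assumes f: "f \<in> borel_measurable borel" and f0: "\<And>s. 0 \<le> f s" and neg: "\<And>s. s < 0 \<Longrightarrow> f s = 0"
    and fin: "\<And>t. 0 \<le> t \<Longrightarrow> (\<integral>\<^sup>+s\<in>{0..t}. ennreal (f s) \<partial>lborel) < \<infinity>"
  shows "set_integrable lborel {a..b} f"
  unfolding set_integrable_def
proof (rule integrableI_nonneg)
  show "(\<lambda>s. indicator {a..b} s *\<^sub>R f s) \<in> borel_measurable lborel" using f by measurable
  have "(\<integral>\<^sup>+s. ennreal (indicator {a..b} s *\<^sub>R f s) \<partial>lborel) \<le> (\<integral>\<^sup>+s\<in>{0..max 0 b}. ennreal (f s) \<partial>lborel)"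
  proof (rule nn_integral_mono)
    fix s
    show "ennreal (indicator {a..b} s *\<^sub>R f s) \<le> ennreal (f s) * indicator {0..max 0 b} s"
      using neg[of s] by (cases "s < 0") (auto simp: indicator_def)
  qed
  also have "\<dots> < \<infinity>" by (rule fin) simp
  finally show "(\<integral>\<^sup>+s. ennreal (indicator {a..b} s *\<^sub>R f s) \<partial>lborel) < \<infinity>" .
qed (use f0 in auto)

locale girsanov_setting = complete_filtered_prob_space M F
  for M :: "'a measure" and F :: "real \<Rightarrow> 'a measure" +
  fixes N :: "real \<Rightarrow> 'a \<Rightarrow> ennreal" and X Y :: "real \<Rightarrow> 'a \<Rightarrow> real" and T :: "nat \<Rightarrow> 'a \<Rightarrow> ennreal"
  assumes T_stopping: "\<And>n. ext_stopping_time F (T n)"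
    and T_zero: "AE w in M. T 0 w = 0"
    and T_less: "\<And>n. AE w in M. T (Suc n) w < \<infinity> \<longrightarrow> T n w < T (Suc n) w"
    and N_eq: "\<And>t w. 0 \<le> t \<Longrightarrow> w \<in> space M \<Longrightarrow> N t w = (\<Sum>n. if T (Suc n) w \<le> ennreal t then 1 else 0)"
    and X_process: "nonneg_F0_process M F X" and X_loc: "locally_integrable M X"
    and N_finite: "\<And>t. 0 \<le> t \<Longrightarrow> AE w in M. N t w < \<infinity>"
    and N_char: "\<And>(u::real) r t. 0 \<le> r \<Longrightarrow> r \<le> t \<Longrightarrow>
        (AE w in M.
           complex_cond_exp M (F r)
             (\<lambda>w. iexp (u * (enn2real (N t w) - enn2real (N r w)))) w =
           exp ((iexp u - 1) * of_real (LBINT s:{r..t}. X s w)))"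
    and Y_process: "nonneg_F0_process M F Y" and YX_loc: "locally_integrable M (\<lambda>s w. Y s w * X s w)"
begin

text \<open>Finiteness of \<open>N\<close> is required at integer times only: this is a countable
  condition, and since \<open>N\<close> increases in time it rules out infinitely many jumps on
  every bounded interval.\<close>

definition good :: "'a set" where
  "good = {w \<in> space M. T 0 w = 0 \<and> (\<forall>n. T (Suc n) w < \<infinity> \<longrightarrow> T n w < T (Suc n) w) \<and>
     (\<forall>k::nat. N (real k) w < \<infinity>) \<and>
     (\<forall>t\<ge>0. (\<integral>\<^sup>+s\<in>{0..t}. ennreal (X s w) \<partial>lborel) < \<infinity>) \<and>
     (\<forall>t\<ge>0. (\<integral>\<^sup>+s\<in>{0..t}. ennreal (Y s w * X s w) \<partial>lborel) < \<infinity>)}"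

lemma good_space: "w \<in> good \<Longrightarrow> w \<in> space M"
  by (simp add: good_def)

lemma AE_good: "AE w in M. w \<in> good"
proof -
  have "AE w in M. \<forall>n. T (Suc n) w < \<infinity> \<longrightarrow> T n w < T (Suc n) w"
    using T_less by (simp add: AE_all_countable)
  moreover have "AE w in M. \<forall>k::nat. N (real k) w < \<infinity>"
    using N_finite by (simp add: AE_all_countable)
  ultimately show ?thesis
    using T_zero X_loc[unfolded locally_integrable_def] YX_loc[unfolded locally_integrable_def] AE_space
    by eventually_elim (simp add: good_def)
qed

text \<open>The definition quantifies over uncountably many times; that \<open>good\<close> is an
  event at all is deduced from completeness, as its complement lies in a null set.\<close>

lemma good_F0: "good \<in> sets (F 0)"
proof -
  have sp: "space (F 0) = space M" using subalg[of 0] by (simp add: subalgebra_def)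
  obtain E where E: "{w \<in> space M. w \<notin> good} \<subseteq> E" "E \<in> null_sets M"
    using AE_good by (auto elim!: AE_E simp: null_sets_def)
  have "space M - good \<in> null_sets M"
    using E complete[of "space M - good" E] by (intro null_sets_subset[OF E(2)]) auto
  then have "space M - good \<in> sets (F 0)" using null_sets_F0 by auto
  then have "space (F 0) - (space M - good) \<in> sets (F 0)" by auto
  also have "space (F 0) - (space M - good) = good" using sp good_space by auto
  finally show ?thesis .
qed

text \<open>The shift by \<open>Suc\<close> skips \<open>T 0 = 0\<close>, which is not a jump. Off
  \<open>good\<close> every jump time is -1 and \<open>X'\<close> is 0, so a bad path has no jumps
  and no intensity and satisfies all pathwise requirements.\<close>

definition \<tau> :: "nat \<Rightarrow> 'a \<Rightarrow> real" where
  "\<tau> n w = (if w \<in> good \<and> T (Suc n) w < \<infinity> then enn2real (T (Suc n) w) else - 1)"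

definition X' :: "real \<Rightarrow> 'a \<Rightarrow> real" where
  "X' s w = (if 0 \<le> s \<and> w \<in> good then X s w else 0)"

definition Y' :: "real \<Rightarrow> 'a \<Rightarrow> real" where
  "Y' s w = (if 0 \<le> s \<and> w \<in> good then Y s w else 0)"

lemma T_strict:
  assumes w: "w \<in> good" and nm: "n < m" and fin: "T m w < \<infinity>"
  shows "T n w < T m w"
  using nm fin
proof (induction m)
  case (Suc m)
  have lt: "T m w < T (Suc m) w" using w Suc.prems(2) by (simp add: good_def)
  then have "T m w < \<infinity>" using Suc.prems(2) by (rule less_trans)
  then have "T n w \<le> T m w" using Suc by (cases "n = m") (auto simp: less_Suc_eq intro: less_imp_le)
  then show ?case using lt by simp
qed simp

lemma \<tau>_good:
  assumes w: "w \<in> good" and t: "0 \<le> t"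
  shows "0 < \<tau> n w \<and> \<tau> n w \<le> t \<longleftrightarrow> T (Suc n) w \<le> ennreal t"
proof
  assume "0 < \<tau> n w \<and> \<tau> n w \<le> t"
  then have "T (Suc n) w < \<infinity>" "enn2real (T (Suc n) w) \<le> t"
    by (auto simp: \<tau>_def split: if_splits)
  then show "T (Suc n) w \<le> ennreal t"
    by (metis ennreal_enn2real ennreal_leI infinity_ennreal_def)
next
  assume le: "T (Suc n) w \<le> ennreal t"
  then have fin: "T (Suc n) w < \<infinity>" by (metis ennreal_less_top infinity_ennreal_def le_less_trans)
  have "T 0 w < T (Suc n) w" by (rule T_strict[OF w _ fin]) simp
  then have "0 < T (Suc n) w" using w by (simp add: good_def)
  then have "0 < enn2real (T (Suc n) w)" using fin by (simp add: enn2real_positive_iff)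
  moreover have "enn2real (T (Suc n) w) \<le> t" by (rule enn2real_leI[OF t le])
  ultimately show "0 < \<tau> n w \<and> \<tau> n w \<le> t" using w fin by (simp add: \<tau>_def)
qed

lemma \<tau>_bad: "w \<notin> good \<Longrightarrow> \<tau> n w = - 1"
  by (simp add: \<tau>_def)

lemma \<tau>_event:
  assumes t: "0 \<le> t" shows "{w \<in> space M. 0 < \<tau> n w \<and> \<tau> n w \<le> t} \<in> sets (F t)"
proof -
  have sp: "space (F t) = space M" using subalg[OF t] by (simp add: subalgebra_def)
  have g: "good \<in> sets (F t)" using good_F0 sets_mono[of 0 t] t by auto
  have "{w \<in> space (F t). T (Suc n) w \<le> ennreal t} \<in> sets (F t)"
    using T_stopping[of "Suc n"] t by (simp add: ext_stopping_time_def pred_def)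
  then have "{w \<in> space (F t). T (Suc n) w \<le> ennreal t} \<inter> good \<in> sets (F t)" using g by (rule sets.Int)
  also have "{w \<in> space (F t). T (Suc n) w \<le> ennreal t} \<inter> good = {w \<in> space M. 0 < \<tau> n w \<and> \<tau> n w \<le> t}"
  proof (rule set_eqI)
    fix w
    show "w \<in> {w \<in> space (F t). T (Suc n) w \<le> ennreal t} \<inter> good \<longleftrightarrow> w \<in> {w \<in> space M. 0 < \<tau> n w \<and> \<tau> n w \<le> t}"
      using \<tau>_good[OF _ t, of w n] \<tau>_bad[of w n] by (cases "w \<in> good") (auto simp: sp)
  qed
  finally show ?thesis .
qed

text \<open>The stopping property gives the events
  \<open>0 < \<tau> n w \<and> \<tau> n w \<le> t\<close> only. They determine every superlevel set
  because \<open>\<tau> n\<close> is either -1 or positive.\<close>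

lemma \<tau>_measurable: "\<tau> n \<in> borel_measurable M"
proof (rule borel_measurableI_greater)
  fix c :: real
  have ev: "{w \<in> space M. 0 < \<tau> n w \<and> \<tau> n w \<le> t} \<in> sets M" if "0 \<le> t" for t
    using \<tau>_event[OF that, of n] subalg[OF that] by (auto simp: subalgebra_def)
  have pos: "{w \<in> space M. 0 < \<tau> n w} \<in> sets M"
  proof -
    have "{w \<in> space M. 0 < \<tau> n w} = (\<Union>k::nat. {w \<in> space M. 0 < \<tau> n w \<and> \<tau> n w \<le> real k})"
      using real_arch_simple by auto
    also have "\<dots> \<in> sets M" using ev by (intro sets.countable_UN) auto
    finally show ?thesis .
  qed
  have cases: "\<tau> n w = - 1 \<or> 0 < \<tau> n w" for w
  proof (cases "w \<in> good \<and> T (Suc n) w < \<infinity>")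
    case True
    then have "T (Suc n) w \<le> ennreal (enn2real (T (Suc n) w))" by simp
    then show ?thesis using \<tau>_good[of w "enn2real (T (Suc n) w)" n] True by simp
  qed (auto simp: \<tau>_def)
  have "{w \<in> space M. c < \<tau> n w} = (if c < - 1 then space M else if c < 0 then {w \<in> space M. 0 < \<tau> n w}
    else {w \<in> space M. 0 < \<tau> n w} - {w \<in> space M. 0 < \<tau> n w \<and> \<tau> n w \<le> c})"
  proof (rule set_eqI)
    fix w
    show "w \<in> {w \<in> space M. c < \<tau> n w} \<longleftrightarrow> w \<in> (if c < - 1 then space M else if c < 0 then {w \<in> space M. 0 < \<tau> n w}
      else {w \<in> space M. 0 < \<tau> n w} - {w \<in> space M. 0 < \<tau> n w \<and> \<tau> n w \<le> c})"
      using cases[of w] by auto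
  qed
  also have "\<dots> \<in> sets M" using ev[of c] pos by auto
  finally show "{w \<in> space M. c < \<tau> n w} \<in> sets M" .
qed

lemma \<tau>_inj:
  assumes pos: "0 < \<tau> n w" and eq: "\<tau> n w = \<tau> m w" shows "n = m"
proof -
  have w: "w \<in> good" "T (Suc n) w < \<infinity>" "T (Suc m) w < \<infinity>"
    using pos eq by (auto simp: \<tau>_def split: if_splits)
  then have "enn2real (T (Suc n) w) = enn2real (T (Suc m) w)" using eq by (simp add: \<tau>_def)
  then have "T (Suc n) w = T (Suc m) w" using w by (metis ennreal_enn2real infinity_ennreal_def)
  then show "n = m"
    using T_strict[OF w(1), of "Suc n" "Suc m"] T_strict[OF w(1), of "Suc m" "Suc n"] w
    by (cases n m rule: linorder_cases) auto
qed

lemma \<tau>_finite: "finite {n. 0 < \<tau> n w \<and> \<tau> n w \<le> t}"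
proof (cases "w \<in> good")
  case True
  obtain k :: nat where k: "t \<le> real k" using real_arch_simple by blast
  have "N (real k) w < \<infinity>" using True by (simp add: good_def)
  then have "finite {n. T (Suc n) w \<le> ennreal (real k)}"
    using N_eq[of "real k" w] good_space[OF True] by (intro finite_of_suminf_indicator) simp
  then show ?thesis
    by (rule finite_subset[rotated]) (use \<tau>_good[OF True, of "real k"] k in force)
qed (simp add: \<tau>_bad)

lemma N_good:
  assumes w: "w \<in> good" and t: "0 \<le> t"
  shows "enn2real (N t w) = real (card {n. 0 < \<tau> n w \<and> \<tau> n w \<le> t})"
proof -
  have eq: "{n. T (Suc n) w \<le> ennreal t} = {n. 0 < \<tau> n w \<and> \<tau> n w \<le> t}"
    using \<tau>_good[OF w t] by auto
  have "N t w = of_nat (card {n. T (Suc n) w \<le> ennreal t})"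
    unfolding N_eq[OF t good_space[OF w]] by (rule suminf_indicator_eq_card) (simp add: eq \<tau>_finite)
  then show ?thesis unfolding eq by (simp add: ennreal_of_nat_eq_real_of_nat)
qed

lemma process_measurable:
  assumes "nonneg_F0_process M F f"
  shows "(\<lambda>p. if 0 \<le> fst p \<and> snd p \<in> good then f (fst p) (snd p) else 0) \<in> borel_measurable (borel \<Otimes>\<^sub>M F 0)"
  using assms by (intro restricted_measurable_extend good_F0) (simp add: nonneg_F0_process_def)

lemma X'_measurable: "(\<lambda>p. X' (fst p) (snd p)) \<in> borel_measurable (borel \<Otimes>\<^sub>M F 0)"
  unfolding X'_def by (rule process_measurable[OF X_process])

lemma Y'_measurable: "(\<lambda>p. Y' (fst p) (snd p)) \<in> borel_measurable (borel \<Otimes>\<^sub>M F 0)"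
  unfolding Y'_def by (rule process_measurable[OF Y_process])

lemma X'_nonneg: "0 \<le> X' s w" and Y'_nonneg: "0 \<le> Y' s w"
  using X_process Y_process by (auto simp: X'_def Y'_def nonneg_F0_process_def good_def)

lemma section_measurable:
  assumes f: "(\<lambda>p. f (fst p) (snd p)) \<in> borel_measurable (borel \<Otimes>\<^sub>M F 0)" and w: "w \<in> space M"
  shows "(\<lambda>s. f s w) \<in> borel_measurable borel"
  using measurable_compose[OF measurable_Pair2'[of w "F 0" borel] f] w subalg[of 0]
  by (simp add: subalgebra_def)

lemma
  assumes w: "w \<in> space M"
  shows X'_integrable: "set_integrable lborel {a..b} (\<lambda>s. X' s w)"
    and Y'X'_integrable: "set_integrable lborel {a..b} (\<lambda>s. Y' s w * X' s w)"
proof -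
  note [measurable] = section_measurable[OF X'_measurable w] section_measurable[OF Y'_measurable w]
  have X: "(\<integral>\<^sup>+s\<in>{0..t}. ennreal (X' s w) \<partial>lborel) \<le> (if w \<in> good then \<integral>\<^sup>+s\<in>{0..t}. ennreal (X s w) \<partial>lborel else 0)"
    and YX: "(\<integral>\<^sup>+s\<in>{0..t}. ennreal (Y' s w * X' s w) \<partial>lborel) \<le> (if w \<in> good then \<integral>\<^sup>+s\<in>{0..t}. ennreal (Y s w * X s w) \<partial>lborel else 0)" for t
    by (auto simp: X'_def Y'_def indicator_def intro!: nn_integral_mono)
  show "set_integrable lborel {a..b} (\<lambda>s. X' s w)"
  proof (rule set_integrable_of_nn_finite)
    show "(\<integral>\<^sup>+s\<in>{0..t}. ennreal (X' s w) \<partial>lborel) < \<infinity>" if "0 \<le> t" for t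
      using that by (intro le_less_trans[OF X]) (auto simp: good_def)
  qed (auto simp: X'_nonneg, simp add: X'_def)
  show "set_integrable lborel {a..b} (\<lambda>s. Y' s w * X' s w)"
  proof (rule set_integrable_of_nn_finite)
    show "(\<integral>\<^sup>+s\<in>{0..t}. ennreal (Y' s w * X' s w) \<partial>lborel) < \<infinity>" if "0 \<le> t" for t
      using that by (intro le_less_trans[OF YX]) (auto simp: good_def)
  qed (auto simp: X'_nonneg Y'_nonneg, simp add: X'_def)
qed

lemma LBINT_modified:
  fixes h :: "real \<Rightarrow> real \<Rightarrow> 'b::{banach, second_countable_topology}"
  assumes "w \<in> good" "0 \<le> a"
  shows "(LBINT s:{a..b}. h (X' s w) (Y' s w)) = (LBINT s:{a..b}. h (X s w) (Y s w))"
  using assms by (intro set_lebesgue_integral_cong) (auto simp: X'_def Y'_def)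

lemma N_measurable: "0 \<le> t \<Longrightarrow> (\<lambda>w. enn2real (N t w)) \<in> borel_measurable M"
proof -
  assume t: "0 \<le> t"
  have "{w \<in> space M. 0 < \<tau> n w \<and> \<tau> n w \<le> t} \<in> sets M" for n
    using \<tau>_event[OF t, of n] subalg[OF t] by (auto simp: subalgebra_def)
  then have c: "(\<lambda>w. card {n. 0 < \<tau> n w \<and> \<tau> n w \<le> t}) \<in> measurable M (count_space UNIV)"
    by (intro measurable_card) simp
  have "{w \<in> space M. T (Suc n) w \<le> ennreal t} \<in> sets M" for n
  proof -
    have "{w \<in> space (F t). T (Suc n) w \<le> ennreal t} \<in> sets (F t)"
      using T_stopping[of "Suc n"] t by (simp add: ext_stopping_time_def pred_def)
    then show ?thesis using subalg[OF t] by (simp add: subalgebra_def subset_iff)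
  qed
  then have "(\<lambda>w. \<Sum>n. if T (Suc n) w \<le> ennreal t then 1 else 0 :: ennreal) \<in> borel_measurable M"
    by (intro borel_measurable_suminf_order measurable_If) auto
  then have "N t \<in> borel_measurable M"
    by (rule measurable_cong[THEN iffD1, rotated]) (simp add: N_eq[OF t])
  then show ?thesis by measurable
qed

lemma increment_good:
  assumes w: "w \<in> good" and rt: "0 \<le> r" "r \<le> t"
  shows "enn2real (N t w) - enn2real (N r w) = real (card {n. r < \<tau> n w \<and> \<tau> n w \<le> t})"
proof -
  have "{n. 0 < \<tau> n w \<and> \<tau> n w \<le> t} = {n. 0 < \<tau> n w \<and> \<tau> n w \<le> r} \<union> {n. r < \<tau> n w \<and> \<tau> n w \<le> t}"
    using rt by auto
  moreover have "finite {n. r < \<tau> n w \<and> \<tau> n w \<le> t}"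
    using \<tau>_finite[of w t] rt by (rule_tac finite_subset[rotated]) auto
  ultimately have "card {n. 0 < \<tau> n w \<and> \<tau> n w \<le> t}
    = card {n. 0 < \<tau> n w \<and> \<tau> n w \<le> r} + card {n. r < \<tau> n w \<and> \<tau> n w \<le> t}"
    by (simp add: card_Un_disjoint[OF \<tau>_finite, of _ w r] disjoint_iff)
  then show ?thesis using rt by (simp add: N_good[OF w])
qed

text \<open>The conditional identity for \<open>N\<close> is integrated over \<open>A\<close>; then
  count and intensity are exchanged for their versions on \<open>good\<close>, which changes the
  integrands on a null set only.\<close>

lemma increment_char:
  assumes rt: "0 \<le> r" "r \<le> t" and A: "A \<in> sets (F r)"
  shows "(\<integral>w. indicator A w *\<^sub>R iexp (u * real (card {n. r < \<tau> n w \<and> \<tau> n w \<le> t})) \<partial>M)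
    = (\<integral>w. indicator A w *\<^sub>R exp ((iexp u - 1) * of_real (LBINT s:{r..t}. X' s w)) \<partial>M)"
proof -
  interpret FS: finite_measure_subalgebra M "F r" using subalg[OF rt(1)] by unfold_locales
  let ?f = "\<lambda>w. iexp (u * (enn2real (N t w) - enn2real (N r w)))"
  let ?g = "\<lambda>w. exp ((iexp u - 1) * of_real (LBINT s:{r..t}. X' s w))"
  have AM: "A \<in> sets M" using A subalg[OF rt(1)] by (auto simp: subalgebra_def)
  have [measurable]: "(\<lambda>w. enn2real (N t w)) \<in> borel_measurable M" "(\<lambda>w. enn2real (N r w)) \<in> borel_measurable M"
    using rt by (auto intro: N_measurable)
  have fm: "?f \<in> borel_measurable M" by measurable
  have f: "integrable M ?f"
    by (intro integrable_const_bound[where B = 1] fm) (auto simp del: of_real_mult of_real_diff)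
  have "(\<lambda>w. LBINT s:{r..t}. X' s w) \<in> borel_measurable (F 0)"
    by (rule borel_measurable_LBINT_section[OF X'_measurable]) auto
  then have [measurable]: "(\<lambda>w. LBINT s:{r..t}. X' s w) \<in> borel_measurable M"
    using measurable_from_subalg[OF subalg[OF order_refl]] by blast
  have g: "?g \<in> borel_measurable M" by measurable
  have ae: "AE w in M. complex_cond_exp M (F r) ?f w = ?g w"
    using N_char[OF rt, of u] AE_good
    by eventually_elim (use LBINT_modified[where h = "\<lambda>x y. x" and a = r and b = t] rt in simp)
  have "(\<integral>w. indicator A w *\<^sub>R iexp (u * real (card {n. r < \<tau> n w \<and> \<tau> n w \<le> t})) \<partial>M)
    = (\<integral>w. indicator A w *\<^sub>R ?f w \<partial>M)"
  proof (rule integral_cong_AE)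
    show "(\<lambda>w. indicator A w *\<^sub>R ?f w) \<in> borel_measurable M" using AM by measurable
    note [measurable] = \<tau>_measurable
    have [measurable]: "(\<lambda>w. card {n. r < \<tau> n w \<and> \<tau> n w \<le> t}) \<in> measurable M (count_space UNIV)"
      by (rule measurable_card) simp
    show "(\<lambda>w. indicator A w *\<^sub>R iexp (u * real (card {n. r < \<tau> n w \<and> \<tau> n w \<le> t}))) \<in> borel_measurable M"
      using AM by measurable
    show "AE w in M. indicator A w *\<^sub>R iexp (u * real (card {n. r < \<tau> n w \<and> \<tau> n w \<le> t}))
      = indicator A w *\<^sub>R ?f w"
      using AE_good by eventually_elim (simp only: increment_good[OF _ rt])
  qed
  also have "\<dots> = (\<integral>w. indicator A w *\<^sub>R ?g w \<partial>M)"
    by (rule FS.integral_complex_cond_exp_eq[OF f g ae A])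
  finally show ?thesis .
qed

section \<open>Identification of the stochastic exponential with the density process\<close>

sublocale weighted_jumps M F \<tau> X' Y'
  by unfold_locales
    (assumption | rule \<tau>_event \<tau>_measurable \<tau>_inj \<tau>_finite X'_measurable Y'_measurable X'_nonneg Y'_nonneg
      X'_integrable Y'X'_integrable increment_char)+

text \<open>Just before \<open>s\<close> the process counts the jump times below \<open>s\<close>.
  By injectivity at most one jump time equals \<open>s\<close>, so the jump has size 0 or 1.\<close>

lemma jump_good:
  assumes w: "w \<in> good" and s: "0 < s"
  shows "jump N s w = (if \<exists>n. \<tau> n w = s then 1 else 0)"
proof -
  have wM: "w \<in> space M" by (rule good_space[OF w])
  let ?L = "{n. 0 < \<tau> n w \<and> \<tau> n w < s}" and ?E = "{n. \<tau> n w = s}"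
  have "\<forall>\<^sub>F r in at_left s. 0 < r" using s by (auto simp: eventually_at_left_field)
  then have "\<forall>\<^sub>F r in at_left s. enn2real (N r w) = real (card ?L)"
    using eventually_jumps_left[OF s wM] by eventually_elim (simp add: N_good[OF w] jumps_def)
  then have "((\<lambda>r. enn2real (N r w)) \<longlongrightarrow> real (card ?L)) (at_left s)"
    by (rule tendsto_eventually)
  then have lim: "Lim (at_left s) (\<lambda>r. enn2real (N r w)) = real (card ?L)"
    by (intro tendsto_Lim) auto
  have fin: "finite ?L" "finite ?E"
    using \<tau>_finite[of w s] s by (auto elim!: finite_subset[rotated])
  have "{n. 0 < \<tau> n w \<and> \<tau> n w \<le> s} = ?L \<union> ?E" using s by auto
  moreover have "?L \<inter> ?E = {}" by auto
  ultimately have "enn2real (N s w) = real (card ?L) + real (card ?E)"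
    using N_good[OF w, of s] s fin by (simp add: card_Un_disjoint)
  moreover have "card ?E = (if \<exists>n. \<tau> n w = s then 1 else 0)"
  proof (cases "\<exists>n. \<tau> n w = s")
    case True
    then obtain n where n: "\<tau> n w = s" by blast
    have "m = n" if "\<tau> m w = s" for m using \<tau>_inj[of m w n] that n s by simp
    then have E: "?E = {n}" using n by blast
    have "card ?E = 1" unfolding E by simp
    then show ?thesis unfolding if_P[OF True] .
  qed auto
  ultimately show ?thesis by (simp add: jump_def lim)
qed

text \<open>Distinct jumps have distinct times, so the product over times can be indexed by
  \<open>n\<close>; with jump size 1 the factor \<open>1 + (Y - 1)\<close> is
  \<open>Y\<close>.\<close>

lemma stoch_exponential_good:
  assumes w: "w \<in> good" and t: "0 \<le> t"
  shows "stoch_exponential N X Y t w = Z t w"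
proof -
  have wM: "w \<in> space M" by (rule good_space[OF w])
  have "(LBINT s:{0..t}. (Y s w - 1) * X s w) = drift Y' 0 t w"
    using LBINT_modified[OF w order_refl, where h = "\<lambda>x y. (y - 1) * x" and b = t] by (simp add: drift_def)
  moreover have "(\<Prod>s\<in>{s\<in>{0<..t}. jump N s w \<noteq> 0}. 1 + (Y s w - 1) * jump N s w) = jump_prod Y' 0 t w"
  proof -
    have "{s\<in>{0<..t}. jump N s w \<noteq> 0} = (\<lambda>n. \<tau> n w) ` jumps 0 t w"
      by (auto simp: jump_good[OF w] jumps_def split: if_splits)
    then have "(\<Prod>s\<in>{s\<in>{0<..t}. jump N s w \<noteq> 0}. 1 + (Y s w - 1) * jump N s w)
      = (\<Prod>n\<in>jumps 0 t w. 1 + (Y (\<tau> n w) w - 1) * jump N (\<tau> n w) w)"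
      by (simp add: prod.reindex[OF inj_on_jumps[OF order_refl wM]])
    also have "\<dots> = (\<Prod>n\<in>jumps 0 t w. Y' (\<tau> n w) w)"
      using w by (intro prod.cong) (auto simp: jump_good[OF w] jumps_def Y'_def)
    finally show ?thesis by (simp add: jump_prod_def)
  qed
  ultimately show ?thesis by (simp add: stoch_exponential_def density_process_def)
qed

lemma stoch_exponential_martingale:
  "(AE w in M. \<forall>t\<ge>0. 0 \<le> stoch_exponential N X Y t w)"
  "right_continuous_paths M (stoch_exponential N X Y)"
  "martingale M F (stoch_exponential N X Y)"
  "w \<in> space M \<Longrightarrow> stoch_exponential N X Y 0 w = 1"
proof -
  show "AE w in M. \<forall>t\<ge>0. 0 \<le> stoch_exponential N X Y t w"
    using AE_good by eventually_elim (simp add: stoch_exponential_good Z_nonneg)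
  show "right_continuous_paths M (stoch_exponential N X Y)"
    unfolding right_continuous_paths_def using AE_good
  proof eventually_elim
    case (elim w)
    show ?case
    proof (intro allI impI)
      fix t :: real assume t: "0 \<le> t"
      have "\<forall>\<^sub>F s in at_right t. stoch_exponential N X Y s w = Z s w"
        using eventually_at_right_less[of t]
        by eventually_elim (use t in \<open>simp add: stoch_exponential_good[OF elim]\<close>)
      then show "((\<lambda>s. stoch_exponential N X Y s w) \<longlongrightarrow> stoch_exponential N X Y t w) (at_right t)"
        using Z_tendsto_right[OF t good_space[OF elim]]
        by (subst tendsto_cong) (simp_all add: stoch_exponential_good[OF elim t])
    qed
  qed
  show "martingale M F (stoch_exponential N X Y)"
    by (rule martingale_modification[OF _ refl _ martingale_Z])
      (use AE_good in \<open>auto elim!: eventually_mono intro: stoch_exponential_good finite_measure_axioms\<close>)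
  \<comment> \<open>The initial value is claimed on every path, also off \<open>good\<close>, and is
    therefore computed from the definition and not through \<open>Z\<close>.\<close>
  have "(LBINT s:{0..0}. (Y s w - 1) * X s w) = 0"
    unfolding set_lebesgue_integral_def
    by (rule integral_eq_zero_AE, use AE_lborel_singleton[of 0] in eventually_elim, simp)
  then show "stoch_exponential N X Y 0 w = 1" by (simp add: stoch_exponential_def)
qed

lemma stoch_exponential_measure_change:
  fixes S :: "'a \<Rightarrow> real"
  assumes S: "S \<in> borel_measurable (F 0)" and S_nonneg: "\<forall>w\<in>space M. 0 \<le> S w"
    and S_bounded: "\<exists>C. \<forall>w\<in>space M. S w \<le> C"
  defines "R \<equiv> density M (\<lambda>w. ennreal (stoch_exponential N X Y (S w) w))"
  shows "prob_space R"
    and "A \<in> sets M \<Longrightarrow> measure R A = (\<integral>w. indicat_real A w * stoch_exponential N X Y (S w) w \<partial>M)"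
    and "A \<in> sets (F 0) \<Longrightarrow> measure R A = measure M A"
    and "local_martingale R F
      (\<lambda>t w. enn2real (N (min t (S w)) w) - (LBINT s:{0..min t (S w)}. Y s w * X s w))"
    and "0 \<le> r \<Longrightarrow> r \<le> t \<Longrightarrow> AE w in R.
      complex_cond_exp R (F r)
        (\<lambda>w. iexp (u * (enn2real (N (min t (S w)) w) - enn2real (N (min r (S w)) w)))) w =
      exp ((iexp u - 1) * of_real (LBINT s:{min r (S w)..min t (S w)}. Y s w * X s w))"
proof -
  have S0: "0 \<le> S w" if "w \<in> space M" for w using S_nonneg that by blast
  obtain C where SC: "\<And>w. w \<in> space M \<Longrightarrow> S w \<le> C" using S_bounded by blast
  interpret SW: stopped_weight M F \<tau> X' Y' S C
    by unfold_locales (use S S0 SC in auto)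
  let ?Z = "\<lambda>w. stoch_exponential N X Y (S w) w"
  have Zeq: "AE w in M. ?Z w = SW.W.Z C w"
    using AE_good
  proof eventually_elim
    case (elim w)
    note w = good_space[OF elim]
    show ?case
      using stoch_exponential_good[OF elim S0[OF w]] SW.density_process_at_S[OF w SC[OF w]] by simp
  qed
  \<comment> \<open>The stochastic exponential is taken at a random time; its measurability comes
    from the deterministic-time version \<open>SW.W.Z C\<close>, with which it agrees almost
    surely.\<close>
  have ZM: "?Z \<in> borel_measurable M"
    using AE_modification_measurable[OF SW.c_nonneg SW.W.Z_measurable[OF SW.c_nonneg] Zeq]
    by (rule measurable_F_M[OF SW.c_nonneg]) simp
  \<comment> \<open>Densities that agree almost surely define the same measure, so statements about
    \<open>SW.Q\<close> become statements about \<open>R\<close> without a further exceptional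
    set.\<close>
  have RQ: "R = SW.Q"
    unfolding R_def SW.Q_eq[OF order_refl] using Zeq ZM SW.W.Z_measurable_M[OF SW.c_nonneg]
    by (intro density_cong) (auto elim: eventually_mono)
  show "prob_space R" unfolding RQ by (rule SW.prob_space_Q)
  interpret R: prob_space SW.Q by (rule SW.prob_space_Q)
  show "measure R A = (\<integral>w. indicat_real A w * ?Z w \<partial>M)" if A: "A \<in> sets M"
  proof -
    have "measure R A = (\<integral>w. indicat_real A w \<partial>SW.Q)" unfolding RQ using A by simp
    also have "\<dots> = (\<integral>w. SW.W.Z C w *\<^sub>R indicat_real A w \<partial>M)"
      using A by (intro SW.integral_Q) auto
    also have "\<dots> = (\<integral>w. indicat_real A w * ?Z w \<partial>M)"
      using A ZM SW.W.Z_measurable_M[OF SW.c_nonneg] Zeq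
      by (intro integral_cong_AE) (auto elim: eventually_mono)
    finally show ?thesis .
  qed
  show "measure R A = measure M A" if "A \<in> sets (F 0)"
    unfolding RQ measure_def SW.emeasure_Q_F0[OF that] ..
  have cum: "(LBINT s:{min r (S w)..min t (S w)}. Y s w * X s w) = SW.stopped_cum r t w"
    if w: "w \<in> good" and r: "0 \<le> r" for w r t
    using LBINT_modified[OF w, where h = "\<lambda>x y. y * x" and a = "min r (S w)" and b = "min t (S w)"] r S0[OF good_space[OF w]]
    by (simp add: SW.stopped_cum_def)
  have count: "enn2real (N (min t (S w)) w) - enn2real (N (min r (S w)) w) = real (card (SW.stopped_jumps r t w))"
    if w: "w \<in> good" and rt: "0 \<le> r" "r \<le> t" for w r t
    using increment_good[OF w, of "min r (S w)" "min t (S w)"] rt S0[OF good_space[OF w]]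
    by (auto simp: SW.stopped_jumps_def jumps_def)
  show "local_martingale R F
      (\<lambda>t w. enn2real (N (min t (S w)) w) - (LBINT s:{0..min t (S w)}. Y s w * X s w))"
    unfolding RQ
  proof (rule local_martingale_modification[OF _ SW.sets_Q SW.AE_Q SW.local_martingale_compensated])
    show "AE w in M. \<forall>t\<ge>0. enn2real (N (min t (S w)) w) - (LBINT s:{0..min t (S w)}. Y s w * X s w)
      = SW.compensated t w"
      using AE_good
    proof eventually_elim
      case (elim w)
      have "min 0 (S w) = 0" using S0[OF good_space[OF elim]] by simp
      moreover have "enn2real (N 0 w) = 0"
        using N_good[OF elim order_refl] by (auto simp: card_eq_0_iff)
      ultimately show ?case
        using count[OF elim order_refl] cum[OF elim order_refl] by (simp add: SW.compensated_def)
    qed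
  qed (unfold_locales, assumption)
  show "AE w in R.
      complex_cond_exp R (F r)
        (\<lambda>w. iexp (u * (enn2real (N (min t (S w)) w) - enn2real (N (min r (S w)) w)))) w =
      exp ((iexp u - 1) * of_real (LBINT s:{min r (S w)..min t (S w)}. Y s w * X s w))"
    if rt: "0 \<le> r" "r \<le> t"
  proof -
    interpret FS: finite_measure_subalgebra SW.Q "F r"
      using SW.subalgebra_Q[OF rt(1)] by unfold_locales
    let ?f = "\<lambda>w. iexp (u * (enn2real (N (min t (S w)) w) - enn2real (N (min r (S w)) w)))"
    let ?g = "\<lambda>w. iexp (u * real (card (SW.stopped_jumps r t w)))"
    have t: "0 \<le> t" using rt by simp
    have fg: "AE w in M. ?f w = ?g w"
      using AE_good by eventually_elim (simp only: count[OF _ rt])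
    have g: "?g \<in> borel_measurable M" using SW.stopped_jumps_measurable_M[of r t] by measurable
    \<comment> \<open>\<open>N\<close> is read at random times here; measurability is taken from the
      count \<open>?g\<close>, of which \<open>?f\<close> is a modification.\<close>
    have f: "?f \<in> borel_measurable M"
      using AE_modification_measurable_M[OF g fg] by simp
    have "AE w in SW.Q. complex_cond_exp SW.Q (F r) ?f w = complex_cond_exp SW.Q (F r) ?g w"
      using f g by (intro FS.complex_cond_exp_cong SW.AE_Q[OF fg]) (simp_all cong: measurable_cong_sets)
    moreover have "AE w in SW.Q. w \<in> good" by (rule SW.AE_Q[OF AE_good])
    ultimately show ?thesis
      unfolding RQ using SW.stopped_cond_char[OF rt, of u]
      by eventually_elim (simp only: cum[OF _ rt(1)])
  qed
qed

end

theorem theorem2p5: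
  fixes M :: "'a measure" and F :: "real \<Rightarrow> 'a measure"
    and N :: "real \<Rightarrow> 'a \<Rightarrow> ennreal" and X Y :: "real \<Rightarrow> 'a \<Rightarrow> real"
  assumes "complete_filtered_prob_space M F"
    and "conditional_poisson_process M F N X"
    and "nonneg_F0_process M F Y"
    and "locally_integrable M (\<lambda>s \<omega>. Y s \<omega> * X s \<omega>)"
  shows
    "let Z = stoch_exponential N X Y in
      ((AE \<omega> in M. \<forall>t\<ge>0. 0 \<le> Z t \<omega>) \<and>
       right_continuous_paths M Z \<and>
       martingale M F Z \<and>
       (\<forall>\<omega>\<in>space M. Z 0 \<omega> = 1)) \<and>
      (\<forall>S. S \<in> borel_measurable (F 0) \<longrightarrow> (\<forall>\<omega>\<in>space M. 0 \<le> S \<omega>) \<longrightarrow>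
           (\<exists>C. \<forall>\<omega>\<in>space M. S \<omega> \<le> C) \<longrightarrow>
         (let Q = density M (\<lambda>\<omega>. ennreal (Z (S \<omega>) \<omega>)) in
            prob_space Q \<and>
            (\<forall>A\<in>sets M. measure Q A = (\<integral>\<omega>. indicat_real A \<omega> * Z (S \<omega>) \<omega> \<partial>M)) \<and>
            (\<forall>A\<in>sets (F 0). measure Q A = measure M A) \<and>
            local_martingale Q F
              (\<lambda>t \<omega>. enn2real (N (min t (S \<omega>)) \<omega>) -
                     (LBINT s:{0..min t (S \<omega>)}. Y s \<omega> * X s \<omega>)) \<and>
            (\<forall>(u::real) r t. 0 \<le> r \<longrightarrow> r \<le> t \<longrightarrow>
               (AE \<omega> in Q.
                  complex_cond_exp Q (F r)
                    (\<lambda>\<omega>. exp (\<i> * of_real (u * (enn2real (N (min t (S \<omega>)) \<omega>) -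
                                               enn2real (N (min r (S \<omega>)) \<omega>))))) \<omega> =
                  exp ((exp (\<i> * of_real u) - 1) *
                       of_real (LBINT s:{min r (S \<omega>)..min t (S \<omega>)}. Y s \<omega> * X s \<omega>))))))"
proof -
  interpret complete_filtered_prob_space M F by (rule assms(1))
  obtain T :: "nat \<Rightarrow> 'a \<Rightarrow> ennreal" where T: "\<And>n. ext_stopping_time F (T n)" "AE \<omega> in M. T 0 \<omega> = 0"
    "\<And>n. AE \<omega> in M. T (Suc n) \<omega> < \<infinity> \<longrightarrow> T n \<omega> < T (Suc n) \<omega>"
    "\<And>t \<omega>. 0 \<le> t \<Longrightarrow> \<omega> \<in> space M \<Longrightarrow> N t \<omega> = (\<Sum>n. if T (Suc n) \<omega> \<le> ennreal t then 1 else 0)"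
  proof -
    have "simple_point_process M F N" using assms(2) by (simp add: conditional_poisson_process_def)
    then show thesis unfolding simple_point_process_def by (elim exE conjE) (rule that; simp)
  qed
  interpret girsanov_setting M F N X Y T
  proof unfold_locales
    show "nonneg_F0_process M F X" "locally_integrable M X"
      and "\<And>t. 0 \<le> t \<Longrightarrow> AE \<omega> in M. N t \<omega> < \<infinity>"
      and "\<And>(u::real) r t. 0 \<le> r \<Longrightarrow> r \<le> t \<Longrightarrow> AE \<omega> in M.
           complex_cond_exp M (F r)
             (\<lambda>\<omega>. exp (\<i> * of_real (u * (enn2real (N t \<omega>) - enn2real (N r \<omega>))))) \<omega> =
           exp ((exp (\<i> * of_real u) - 1) * of_real (LBINT s:{r..t}. X s \<omega>))"
      using assms(2) unfolding conditional_poisson_process_def by blast+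
  qed (fact T assms(3,4))+
  show ?thesis
    unfolding Let_def
    by (intro conjI allI ballI impI;
        rule stoch_exponential_martingale stoch_exponential_measure_change; assumption)
qed

end
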